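(* Let $F$ be a fixed graph which is not vertex-balanced. For every $\delta>0$ there exist constants $K_1,K_2>0$ such that, for $n$ restricted to multiples of $v(F)$, if $K_1n^{2-1/d^*(F)}\leq t\leq n^{2-\delta}$, then there exists a successful $\big(t,\,K_2t^{1-d^*(F)}n^{2d^*(F)-1}\big)$-strategy for an $F$-factor.
   Context: Budget-constrained random graph process: let $M=\binom{n}{2}$. The edges of $K_n$ on vertex set $[n]$ are put in a uniformly random order $e_1,e_2,\ldots,e_M$. Builder is presented $e_1,\ldots,e_t$ one by one and, as each edge is presented and without knowledge of future edges, must irrevocably decide (possibly using additional randomness) whether to purchase it; she may purchase at most $b$ edges in total. A $(t,b)$-strategy is a rule for these decisions; $B_t$ denotes the graph of purchased edges after time $t$. A strategy is successful for a property if $B_t$ satisfies it with probability tending to $1$ as $n\to\infty$. An $F$-factor in an $n$-vertex graph is a collection of $n/v(F)$ vertex-disjoint copies of $F$. For $F$ with at least two vertices, $d(F)=e(F)/(v(F)-1)$, $d^*(F)=\max\{d(F'):F'\subseteq F,\ v(F')\geq 2\}$, and for $v\in V(F)$, $d^*(v,F)=\max\{d(F'):F'\subseteq F,\ v(F')\geq 2,\ v\in V(F')\}$. $F$ is vertex-balanced if $d^*(v,F)=d^*(F)$ for every $v\in V(F)$. *)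

theory Defs
  imports "HOL-Probability.Probability" "HOL-Combinatorics.Multiset_Permutations"
begin

text \<open>A finite simple graph is a pair of a vertex set and a set of two-element vertex sets.\<close>

type_synonym 'a graph = "'a set \<times> 'a set set"

abbreviation verts :: "'a graph \<Rightarrow> 'a set" where "verts G \<equiv> fst G"

abbreviation edges :: "'a graph \<Rightarrow> 'a set set" where "edges G \<equiv> snd G"

definition all_edges :: "'a set \<Rightarrow> 'a set set" where
  "all_edges V = {e. e \<subseteq> V \<and> card e = 2}"

definition simple_graph :: "'a graph \<Rightarrow> bool" where
  "simple_graph G \<longleftrightarrow> finite (verts G) \<and> edges G \<subseteq> all_edges (verts G)"

definition subgraph :: "'a graph \<Rightarrow> 'a graph \<Rightarrow> bool" where
  "subgraph H G \<longleftrightarrow> simple_graph H \<and> verts H \<subseteq> verts G \<and> edges H \<subseteq> edges G"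

definition isomorphic :: "'a graph \<Rightarrow> 'b graph \<Rightarrow> bool" where
  "isomorphic G H \<longleftrightarrow> (\<exists>f. bij_betw f (verts G) (verts H) \<and> edges H = (\<lambda>e. f ` e) ` edges G)"

definition density :: "'a graph \<Rightarrow> real" where
  "density F = real (card (edges F)) / (real (card (verts F)) - 1)"

definition max_density :: "'a graph \<Rightarrow> real" where
  "max_density F = Max {density H | H. subgraph H F \<and> card (verts H) \<ge> 2}"

definition max_density_at :: "'a \<Rightarrow> 'a graph \<Rightarrow> real" where
  "max_density_at v F = Max {density H | H. subgraph H F \<and> card (verts H) \<ge> 2 \<and> v \<in> verts H}"

text \<open>For a graph with fewer than two vertices all the maxima above range over the empty set,
  so that it counts as vertex-balanced.\<close>

definition vertex_balanced :: "'a graph \<Rightarrow> bool" where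
  "vertex_balanced F \<longleftrightarrow> (\<forall>v\<in>verts F. max_density_at v F = max_density F)"

definition has_factor :: "'a graph \<Rightarrow> 'b graph \<Rightarrow> bool" where
  "has_factor F G \<longleftrightarrow> (\<exists>\<C>. finite \<C> \<and> card \<C> * card (verts F) = card (verts G) \<and>
     (\<forall>H\<in>\<C>. subgraph H G \<and> isomorphic F H) \<and>
     (\<forall>H\<in>\<C>. \<forall>H'\<in>\<C>. H \<noteq> H' \<longrightarrow> verts H \<inter> verts H' = {}))"

text \<open>The possible orders in which the edges of the complete graph on \<open>{1..n}\<close> are presented.\<close>

definition edge_orders :: "nat \<Rightarrow> nat set list set" where
  "edge_orders n = permutations_of_set (all_edges {1..n})"

text \<open>A deterministic rule is applied to the nonempty list of edges presented so far, and decides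
  whether the last of them is purchased; Builder's earlier decisions are determined by this
  list and the rule. A strategy is a random deterministic rule, drawn independently of the order
  of the edges. Only finitely many edge lists are relevant for a given \<open>n\<close>, so a discrete
  distribution covers every use of additional randomness.\<close>

type_synonym rule = "nat set list \<Rightarrow> bool"

type_synonym strategy = "rule pmf"

definition purchased :: "rule \<Rightarrow> nat \<Rightarrow> nat set list \<Rightarrow> nat set set" where
  "purchased D t es = {es ! i | i. i < t \<and> i < length es \<and> D (take (Suc i) es)}"

definition is_strategy :: "nat \<Rightarrow> nat \<Rightarrow> real \<Rightarrow> strategy \<Rightarrow> bool" where
  "is_strategy n t b S \<longleftrightarrow>
     (\<forall>D\<in>set_pmf S. \<forall>es\<in>edge_orders n. real (card (purchased D t es)) \<le> b)"

definition success_prob :: "nat \<Rightarrow> nat \<Rightarrow> strategy \<Rightarrow> (nat graph \<Rightarrow> bool) \<Rightarrow> real" where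
  "success_prob n t S P =
     measure_pmf.prob (pair_pmf S (pmf_of_set (edge_orders n)))
       {(D, es). P ({1..n}, purchased D t es)}"

definition multiples_at_top :: "nat \<Rightarrow> nat filter" where
  "multiples_at_top v = inf at_top (principal {n. v dvd n})"

end

theory Submission
  imports Defs "HOL-Real_Asymp.Real_Asymp"
begin

text \<open>
  Let \<open>d\<close> be the maximum density of \<open>F\<close>, \<open>h\<close> its number of vertices and \<open>p = t / M\<close>. Builder splits
  the vertices into blocks of about \<open>h N\<close> vertices, where \<open>N\<close> is of order \<open>p\<close> to the power \<open>-d\<close>, and
  buys exactly the edges inside blocks. This costs about \<open>n N p\<close> edges, which is the given budget.
  It suffices that a random graph on a block has an \<open>F\<close>-factor except with polynomially small
  probability of arbitrarily large exponent, and independent repetition reduces this to some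
  positive exponent.

  Two subgraphs of density \<open>d\<close> that share a vertex have a union of density \<open>d\<close>, so the maximal
  ones partition the vertices of \<open>F\<close> into classes (with trivial classes for the remaining vertices),
  and some class is trivial since \<open>F\<close> is not vertex-balanced. The vertices of a block that belong to
  this class leave room for a constant fraction of surplus copies of the other classes. A random
  placement of these copies is a spread family of edge sets, so one round of the
  minimal-fragment argument shows that almost all copies of some placement are present at
  density \<open>K p\<close>, without a logarithmic factor. Discarding the incomplete copies leaves \<open>N\<close>
  copies of each class. They are linked to copies of \<open>F\<close> by random permutations of the classes.
  The density of the edges between classes is strictly below \<open>d\<close>, hence this second
  family is spread with a polynomial margin, and a bounded number of rounds of the
  minimal-fragment argument makes the fragments empty.
\<close>

subsection \<open>Random subsets\<close>

text \<open>Why \<open>N\<close> has this order: about \<open>N\<close> copies of a subgraph of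
  density \<open>d\<close> can be expected in a block only if \<open>N powr (-1/d)\<close> is at
  most of order \<open>p\<close>, so \<open>p powr (-d)\<close> is the smallest useful block size.
  The cost \<open>n * N * p\<close> is then of order \<open>n * p powr (1 - d)\<close>, and with
  \<open>p\<close> of order \<open>t / n^2\<close> this is the budget
  \<open>t powr (1 - d) * n powr (2*d - 1)\<close>. The lower bound on \<open>t\<close> says that
  such a block fits into the \<open>n\<close> vertices. The upper bound makes \<open>N\<close> at
  least \<open>n powr \<delta>\<close>, so a failure probability polynomial in \<open>N\<close> with
  exponent \<open>2 / \<delta>\<close> survives the union bound over at most \<open>n\<close>
  blocks. The obstacle is coverage: requiring every vertex to lie in a subgraph of density
  \<open>d\<close> would cost a logarithm because of vertices that no such subgraph contains.
  Vertices playing the role of a trivial class need no inner edge, so the dense copies may miss many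
  vertices. The edges between classes must all be present, but there the strict inequality of
  densities replaces logarithmically many rounds by a bounded number.\<close>

definition rs_expect :: "real \<Rightarrow> 'b set \<Rightarrow> ('b set \<Rightarrow> real) \<Rightarrow> real" where
  "rs_expect p X f = (\<Sum>W\<in>Pow X. p ^ card W * (1 - p) ^ card (X - W) * f W)"

lemma rs_expect_empty [simp]: "rs_expect p {} f = f {}"
  by (simp add: rs_expect_def)

text \<open>Conditioning on whether \<open>x\<close> is chosen. With the expectation written as a
  finite sum, this recursion takes the place of product measures in the inductions on the ground
  set.\<close>

lemma rs_expect_insert:
  assumes "finite X" "x \<notin> X"
  shows "rs_expect p (insert x X) f =
    (1 - p) * rs_expect p X f + p * rs_expect p X (\<lambda>W. f (insert x W))"
proof -
  let ?g = "\<lambda>Y W. p ^ card W * (1 - p) ^ card (Y - W)"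
  have inj: "inj_on (insert x) (Pow X)"
    using assms(2) by (auto simp: inj_on_def)
  have "rs_expect p (insert x X) f = (\<Sum>W\<in>Pow X. ?g (insert x X) W * f W)
      + (\<Sum>W\<in>insert x ` Pow X. ?g (insert x X) W * f W)"
    unfolding rs_expect_def Pow_insert using assms by (intro sum.union_disjoint) auto
  also have "(\<Sum>W\<in>insert x ` Pow X. ?g (insert x X) W * f W)
      = (\<Sum>W\<in>Pow X. ?g (insert x X) (insert x W) * f (insert x W))"
    by (simp add: sum.reindex[OF inj] o_def)
  also have "\<dots> = (\<Sum>W\<in>Pow X. p * (?g X W * f (insert x W)))"
  proof (rule sum.cong[OF refl])
    fix W assume W: "W \<in> Pow X"
    then have "finite W" "x \<notin> W" using assms finite_subset by auto
    moreover have "insert x X - insert x W = X - W" using assms by auto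
    ultimately show "?g (insert x X) (insert x W) * f (insert x W) = p * (?g X W * f (insert x W))"
      by simp
  qed
  also have "(\<Sum>W\<in>Pow X. ?g (insert x X) W * f W) = (\<Sum>W\<in>Pow X. (1 - p) * (?g X W * f W))"
  proof (rule sum.cong[OF refl])
    fix W assume W: "W \<in> Pow X"
    then have "insert x X - W = insert x (X - W)" using assms by auto
    then have "card (insert x X - W) = Suc (card (X - W))"
      using assms by simp
    then show "?g (insert x X) W * f W = (1 - p) * (?g X W * f W)" by simp
  qed
  finally show ?thesis by (simp add: rs_expect_def sum_distrib_left)
qed

lemma rs_expect_const [simp]: "finite X \<Longrightarrow> rs_expect p X (\<lambda>_. c) = c"
  by (induction X rule: finite_induct) (auto simp: rs_expect_insert algebra_simps)

lemma rs_expect_add: "rs_expect p X (\<lambda>W. f W + g W) = rs_expect p X f + rs_expect p X g"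
  by (simp add: rs_expect_def algebra_simps sum.distrib)

lemma rs_expect_cmult: "rs_expect p X (\<lambda>W. c * f W) = c * rs_expect p X f"
  by (simp add: rs_expect_def sum_distrib_left algebra_simps)

lemma rs_expect_sum: "rs_expect p X (\<lambda>W. \<Sum>i\<in>A. f i W) = (\<Sum>i\<in>A. rs_expect p X (f i))"
  unfolding rs_expect_def sum_distrib_left by (rule sum.swap)

lemma rs_expect_mono:
  assumes "0 \<le> p" "p \<le> 1" "\<And>W. W \<subseteq> X \<Longrightarrow> f W \<le> g W"
  shows "rs_expect p X f \<le> rs_expect p X g"
  unfolding rs_expect_def using assms by (intro sum_mono mult_left_mono) auto

lemma rs_expect_card: "finite X \<Longrightarrow> rs_expect p X (\<lambda>W. real (card W)) = p * real (card X)"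
proof (induction X rule: finite_induct)
  case empty
  then show ?case by simp
next
  case (insert x X)
  have "rs_expect p X (\<lambda>W. real (card (insert x W))) = rs_expect p X (\<lambda>W. 1 + real (card W))"
    unfolding rs_expect_def
  proof (rule sum.cong[OF refl])
    fix W assume "W \<in> Pow X"
    then have "finite W" "x \<notin> W" using insert finite_subset by auto
    then show "p ^ card W * (1 - p) ^ card (X - W) * real (card (insert x W)) =
      p ^ card W * (1 - p) ^ card (X - W) * (1 + real (card W))" by simp
  qed
  then show ?case using insert
    by (simp add: rs_expect_insert rs_expect_add algebra_simps)
qed

text \<open>A union of two independent random subsets with parameters \<open>p\<^sub>1\<close> and \<open>p\<^sub>2\<close> has
  parameter \<open>1 - (1 - p\<^sub>1) (1 - p\<^sub>2) \<le> p\<^sub>1 + p\<^sub>2\<close>.\<close>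

lemma rs_expect_union_le:
  assumes "finite X" "antimono f" "0 \<le> p\<^sub>1" "0 \<le> p\<^sub>2" "p\<^sub>1 + p\<^sub>2 \<le> 1"
  shows "rs_expect (p\<^sub>1 + p\<^sub>2) X f \<le>
    rs_expect p\<^sub>1 X (\<lambda>W\<^sub>1. rs_expect p\<^sub>2 X (\<lambda>W\<^sub>2. f (W\<^sub>1 \<union> W\<^sub>2)))"
  using assms(1,2)
proof (induction X arbitrary: f rule: finite_induct)
  case empty
  then show ?case by simp
next
  case (insert x X)
  let ?p = "p\<^sub>1 + p\<^sub>2" and ?fx = "\<lambda>W. f (insert x W)"
  define a where "a = rs_expect ?p X f"
  define b where "b = rs_expect ?p X ?fx"
  define A where "A = rs_expect p\<^sub>1 X (\<lambda>W\<^sub>1. rs_expect p\<^sub>2 X (\<lambda>W\<^sub>2. f (W\<^sub>1 \<union> W\<^sub>2)))"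
  define B where "B = rs_expect p\<^sub>1 X (\<lambda>W\<^sub>1. rs_expect p\<^sub>2 X (\<lambda>W\<^sub>2. ?fx (W\<^sub>1 \<union> W\<^sub>2)))"
  have "antimono ?fx" using antimonoD[OF insert.prems] by (intro antimonoI) (meson Set.insert_mono)
  then have bB: "b \<le> B" unfolding b_def B_def by (rule insert.IH)
  have aA: "a \<le> A" unfolding a_def A_def by (rule insert.IH[OF insert.prems])
  have ba: "b \<le> a" unfolding a_def b_def
    using antimonoD[OF insert.prems] assms by (intro rs_expect_mono) (auto simp: subset_insertI)
  \<comment> \<open>\<open>q\<close> is the probability that \<open>x\<close> lies in the union of
    the two random sets. Since \<open>b \<le> a\<close>, giving \<open>b\<close> the smaller weight
    \<open>q\<close> instead of \<open>p\<^sub>1 + p\<^sub>2\<close> can only increase the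
    value.\<close>
  define q where "q = p\<^sub>1 + p\<^sub>2 - p\<^sub>1 * p\<^sub>2"
  have q: "0 \<le> q" "q \<le> ?p" "q \<le> 1"
  proof -
    show "q \<le> ?p" using assms by (simp add: q_def)
    then show "q \<le> 1" using assms by simp
    have "p\<^sub>1 * p\<^sub>2 \<le> p\<^sub>1 * 1" using assms by (intro mult_left_mono) auto
    then show "0 \<le> q" using assms by (simp add: q_def)
  qed
  have "rs_expect ?p (insert x X) f = a - ?p * (a - b)"
    using insert by (simp add: rs_expect_insert a_def b_def algebra_simps)
  also have "\<dots> \<le> a - q * (a - b)" using ba q by (simp add: mult_right_mono)
  also have "\<dots> = (1 - q) * a + q * b" by (simp add: algebra_simps)
  also have "\<dots> \<le> (1 - q) * A + q * B"
    using aA bB q by (intro add_mono mult_left_mono) auto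
  also have "\<dots> = rs_expect p\<^sub>1 (insert x X)
      (\<lambda>W\<^sub>1. rs_expect p\<^sub>2 (insert x X) (\<lambda>W\<^sub>2. f (W\<^sub>1 \<union> W\<^sub>2)))"
    using insert by (simp add: rs_expect_insert rs_expect_add rs_expect_cmult A_def B_def q_def)
      (simp add: algebra_simps)
  finally show ?case .
qed

text \<open>Independent repetition. For the indicator of a failure, submultiplicativity says that a
  union fails only if both parts fail; \<open>r\<close> independent sets of parameter
  \<open>p\<close> have a union that is dominated by one set of parameter
  \<open>r * p\<close>.\<close>

lemma rs_expect_power_le:
  assumes X: "finite X" and f: "antimono f" "\<And>W. 0 \<le> f W"
    and sub: "\<And>W W'. f (W \<union> W') \<le> f W * f W'"
    and p: "0 \<le> p" "real r * p \<le> 1" and "r > 0"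
  shows "rs_expect (real r * p) X f \<le> rs_expect p X f ^ r"
  using \<open>r > 0\<close> p(2)
proof (induction r)
  case 0
  then show ?case by simp
next
  case (Suc r)
  show ?case
  proof (cases "r = 0")
    case True
    then show ?thesis by simp
  next
    case False
    have rp: "0 \<le> real r * p" "p + real r * p \<le> 1" using Suc p by (auto simp: algebra_simps)
    have p1: "p \<le> 1" "real r * p \<le> 1" using rp p by linarith+
    have nn: "0 \<le> rs_expect p X f"
      unfolding rs_expect_def using p p1 f by (intro sum_nonneg mult_nonneg_nonneg) auto
    have "rs_expect (real (Suc r) * p) X f = rs_expect (p + real r * p) X f"
      by (simp add: algebra_simps)
    also have "\<dots> \<le> rs_expect p X (\<lambda>W. rs_expect (real r * p) X (\<lambda>W'. f (W \<union> W')))"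
      using rp p X f by (intro rs_expect_union_le) auto
    also have "\<dots> \<le> rs_expect p X (\<lambda>W. rs_expect (real r * p) X (\<lambda>W'. f W * f W'))"
      using rp p p1 sub by (intro rs_expect_mono) auto
    also have "\<dots> = rs_expect p X f * rs_expect (real r * p) X f"
      using rs_expect_cmult[of p X "rs_expect (real r * p) X f" f]
      by (simp add: rs_expect_cmult mult.commute)
    also have "\<dots> \<le> rs_expect p X f * rs_expect p X f ^ r"
      using Suc.IH p1 False nn by (intro mult_left_mono) auto
    finally show ?thesis by simp
  qed
qed

subsection \<open>Spread families and minimal fragments\<close>

text \<open>Weights sit on indices rather than on sets, since several indices may yield the same
  set. The instance \<open>A = {}\<close> bounds the total weight by 1 only from above, so for
  nonnegative weights the property passes to subfamilies and to families of smaller sets.\<close>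

definition spread :: "real \<Rightarrow> 'i set \<Rightarrow> ('i \<Rightarrow> real) \<Rightarrow> ('i \<Rightarrow> 'b set) \<Rightarrow> bool" where
  "spread R I \<mu> S \<longleftrightarrow> (\<forall>A. finite A \<longrightarrow> (\<Sum>s | s \<in> I \<and> A \<subseteq> S s. \<mu> s) \<le> (1 / R) ^ card A)"

text \<open>\<open>T W s\<close> is a smallest set \<open>S s' - W\<close> with \<open>S s' \<subseteq> S s \<union> W\<close>. The set \<open>Z = W \<union> T W s\<close> contains
  some canonical member \<open>S s''\<close> of the family, and by minimality \<open>T W s \<subseteq> S s''\<close>. So \<open>Z\<close>
  leaves only \<open>l choose k\<close> possibilities for a fragment of size \<open>k\<close>.\<close>

lemma minimal_fragments:
  fixes S :: "'i \<Rightarrow> 'b set"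
  assumes X: "finite X" and I: "finite I"
    and S: "\<And>s. s \<in> I \<Longrightarrow> S s \<subseteq> X" "\<And>s. s \<in> I \<Longrightarrow> card (S s) \<le> l"
    and \<mu>: "\<And>s. s \<in> I \<Longrightarrow> 0 \<le> \<mu> s" and spread: "spread R I \<mu> S"
    and p: "0 < p" "p \<le> 1" and R: "0 < R"
  obtains T where "\<And>W s. s \<in> I \<Longrightarrow> T W s \<subseteq> S s"
    "\<And>W s. s \<in> I \<Longrightarrow> \<exists>s'\<in>I. T W s = S s' - W"
    "\<And>k. rs_expect p X (\<lambda>W. \<Sum>s | s \<in> I \<and> card (T W s) = k. \<mu> s)
      \<le> real (l choose k) * (1 / (p * R)) ^ k"
proof -
  define m where "m W s = arg_min_on (\<lambda>s'. card (S s' - W)) {s' \<in> I. S s' \<subseteq> S s \<union> W}" for W s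
  define T where "T W s = S (m W s) - W" for W s
  have m: "m W s \<in> I" "S (m W s) \<subseteq> S s \<union> W" if "s \<in> I" for W s
    using arg_min_if_finite(1)[of "{s' \<in> I. S s' \<subseteq> S s \<union> W}" "\<lambda>s'. card (S s' - W)"] that I
    by (auto simp: m_def)
  have min: "card (T W s) \<le> card (S s' - W)" if "s \<in> I" "s' \<in> I" "S s' \<subseteq> S s \<union> W" for W s s'
    unfolding T_def m_def using arg_min_least[of "{s' \<in> I. S s' \<subseteq> S s \<union> W}" s' "\<lambda>s'. card (S s' - W)"] that I
    by auto
  have T1: "T W s \<subseteq> S s" if "s \<in> I" for W s using m(2)[OF that] by (auto simp: T_def)
  have T2: "\<exists>s'\<in>I. T W s = S s' - W" if "s \<in> I" for W s using m(1)[OF that] by (auto simp: T_def)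
  \<comment> \<open>\<open>ch Z\<close> is a function of \<open>Z\<close> alone and not of the pair
    \<open>W\<close>, \<open>s\<close> that produced \<open>Z\<close>; this keeps the number of
    possible fragments small.\<close>
  define ch where "ch Z = (if \<exists>s\<in>I. S s \<subseteq> Z then S (SOME s. s \<in> I \<and> S s \<subseteq> Z) else {})" for Z
  have ch: "ch Z \<subseteq> X \<and> card (ch Z) \<le> l" for Z
  proof (cases "\<exists>s\<in>I. S s \<subseteq> Z")
    case True
    then have "(SOME s. s \<in> I \<and> S s \<subseteq> Z) \<in> I" using someI_ex[of "\<lambda>s. s \<in> I \<and> S s \<subseteq> Z"] by blast
    then show ?thesis using S True by (auto simp: ch_def)
  qed (auto simp: ch_def)
  have Tch: "T W s \<subseteq> ch (W \<union> T W s)" if s: "s \<in> I" for W s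
  proof -
    have ex: "\<exists>s'. s' \<in> I \<and> S s' \<subseteq> W \<union> T W s"
      using m(1)[OF s, of W] by (auto simp: T_def)
    define s'' where "s'' = (SOME s'. s' \<in> I \<and> S s' \<subseteq> W \<union> T W s)"
    have s'': "s'' \<in> I" "S s'' \<subseteq> W \<union> T W s" using someI_ex[OF ex] by (auto simp: s''_def)
    have fin: "finite (T W s)" using T1[OF s] S(1)[OF s] X by (meson finite_subset subset_trans)
    have "card (T W s) \<le> card (S s'' - W)"
      using s'' T1[OF s] by (intro min[OF s]) auto
    then have "S s'' - W = T W s" using s'' fin by (intro card_seteq) auto
    then show ?thesis using ex by (auto simp: ch_def s''_def)
  qed
  let ?w = "\<lambda>W. p ^ card W * (1 - p) ^ card (X - W)"
  have "rs_expect p X (\<lambda>W. \<Sum>s | s \<in> I \<and> card (T W s) = k. \<mu> s)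
      \<le> real (l choose k) * (1 / (p * R)) ^ k" for k
  proof -
    \<comment> \<open>Double counting: \<open>(W, s)\<close> is encoded by \<open>(Z, A, s)\<close>
      with fragment \<open>A\<close> and \<open>Z = W \<union> A\<close>. Since \<open>A\<close> is
      disjoint from \<open>W\<close>, the pair is recovered from \<open>W = Z - A\<close>.
      \<open>D\<close> keeps only \<open>A \<subseteq> ch Z\<close>, \<open>card A = k\<close> and
      \<open>A \<subseteq> S s\<close>, and the last condition is where spreadness enters.\<close>
    define P where "P = (SIGMA W:Pow X. {s \<in> I. card (T W s) = k})"
    define D where "D = (SIGMA Z:Pow X. SIGMA A:{A. A \<subseteq> ch Z \<and> card A = k}. {s \<in> I. A \<subseteq> S s})"
    define h where "h = (\<lambda>(W, s). (W \<union> T W s, T W s, s))"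
    define g where "g = (\<lambda>(Z, A::'b set, s). (1 / p) ^ k * ?w Z * \<mu> s)"
    have finA: "finite {A. A \<subseteq> ch Z \<and> card A = k}" for Z
      by (rule finite_subset[of _ "Pow X"]) (use ch X in auto)
    have finD: "finite D" unfolding D_def using X I finA by (intro finite_SigmaI) auto
    have inj: "inj_on h P"
    proof (rule inj_onI)
      fix x y assume "x \<in> P" "y \<in> P" "h x = h y"
      then show "x = y" by (cases x; cases y) (auto simp: h_def T_def)
    qed
    have "rs_expect p X (\<lambda>W. \<Sum>s | s \<in> I \<and> card (T W s) = k. \<mu> s)
        = (\<Sum>W\<in>Pow X. \<Sum>s | s \<in> I \<and> card (T W s) = k. ?w W * \<mu> s)"
      by (simp add: rs_expect_def sum_distrib_left)
    also have "\<dots> = (\<Sum>(W, s)\<in>P. ?w W * \<mu> s)"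
      unfolding P_def using X I by (subst sum.Sigma) auto
    also have "\<dots> \<le> (\<Sum>x\<in>P. g (h x))"
    proof (rule sum_mono, clarify)
      fix W s assume "(W, s) \<in> P"
      then have W: "W \<subseteq> X" and s: "s \<in> I" and k: "card (T W s) = k" by (auto simp: P_def)
      have TX: "T W s \<subseteq> X - W" using T1[OF s, of W] S(1)[OF s] by (auto simp: T_def)
      have fin: "finite W" "finite (T W s)" "finite (X - W)"
        using W TX X by (auto intro: finite_subset)
      have c1: "card (W \<union> T W s) = card W + k"
        using fin TX k by (subst card_Un_disjoint) auto
      have "X - (W \<union> T W s) = (X - W) - T W s" by auto
      then have c2: "card (X - W) = card (X - (W \<union> T W s)) + k"
        using card_Diff_subset[OF fin(2) TX] card_mono[OF fin(3) TX] k by simp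
      \<comment> \<open>Multiplied out, because \<open>1 - p\<close> may be 0; the factor
        \<open>(1 - p) ^ k\<close> is then dropped.\<close>
      have "?w W * p ^ k = ?w (W \<union> T W s) * (1 - p) ^ k"
        unfolding c1 c2 by (simp add: power_add)
      also have "\<dots> \<le> ?w (W \<union> T W s) * 1"
        using p by (intro mult_left_mono power_le_one mult_nonneg_nonneg) auto
      finally have "?w W \<le> (1 / p) ^ k * ?w (W \<union> T W s)"
        using p by (simp add: field_simps)
      then show "?w W * \<mu> s \<le> g (h (W, s))"
        unfolding g_def h_def using \<mu>[OF s] by (auto intro: mult_right_mono)
    qed
    also have "\<dots> = sum g (h ` P)" by (simp add: sum.reindex[OF inj])
    also have "\<dots> \<le> sum g D"
    proof (rule sum_mono2[OF finD])
      show "h ` P \<subseteq> D"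
      proof (rule image_subsetI)
        fix x assume "x \<in> P"
        then obtain W s where x: "x = (W, s)" and W: "W \<subseteq> X" and s: "s \<in> I"
          and k: "card (T W s) = k" by (auto simp: P_def)
        then show "h x \<in> D" using T1[OF s, of W] S(1)[OF s] Tch[OF s, of W]
          by (auto simp: D_def h_def)
      qed
      show "0 \<le> g x" if "x \<in> D - h ` P" for x
        using that p \<mu> by (auto simp: D_def g_def)
    qed
    also have "sum g D = (\<Sum>Z\<in>Pow X. \<Sum>A | A \<subseteq> ch Z \<and> card A = k. \<Sum>s | s \<in> I \<and> A \<subseteq> S s.
        (1 / p) ^ k * ?w Z * \<mu> s)"
      unfolding D_def g_def using X I finA
      by (simp add: sum.Sigma finite_SigmaI)
    also have "\<dots> \<le> (\<Sum>Z\<in>Pow X. \<Sum>A | A \<subseteq> ch Z \<and> card A = k. (1 / p) ^ k * ?w Z * (1 / R) ^ k)"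
    proof (intro sum_mono)
      fix Z A assume "Z \<in> Pow X" and "A \<in> {A. A \<subseteq> ch Z \<and> card A = k}"
      then have A: "A \<subseteq> ch Z" "card A = k" by auto
      then have "finite A" using ch[of Z] X by (meson finite_subset)
      then have "(\<Sum>s | s \<in> I \<and> A \<subseteq> S s. \<mu> s) \<le> (1 / R) ^ k"
        using spread A(2) by (auto simp: spread_def)
      then show "(\<Sum>s | s \<in> I \<and> A \<subseteq> S s. (1 / p) ^ k * ?w Z * \<mu> s) \<le> (1 / p) ^ k * ?w Z * (1 / R) ^ k"
        unfolding sum_distrib_left[symmetric] using p by (intro mult_left_mono) auto
    qed
    also have "\<dots> \<le> (\<Sum>Z\<in>Pow X. real (l choose k) * ((1 / p) ^ k * ?w Z * (1 / R) ^ k))"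
    proof (rule sum_mono)
      fix Z assume "Z \<in> Pow X"
      have "card {A. A \<subseteq> ch Z \<and> card A = k} = card (ch Z) choose k"
        using ch[of Z] X by (intro n_subsets) (meson finite_subset)
      also have "\<dots> \<le> l choose k" using ch by (intro binomial_right_mono) auto
      finally show "(\<Sum>A | A \<subseteq> ch Z \<and> card A = k. (1 / p) ^ k * ?w Z * (1 / R) ^ k)
          \<le> real (l choose k) * ((1 / p) ^ k * ?w Z * (1 / R) ^ k)"
        using p R by (simp add: mult_right_mono del: of_nat_mult)
    qed
    also have "\<dots> = real (l choose k) * (1 / (p * R)) ^ k * rs_expect p X (\<lambda>_. 1)"
      by (simp add: rs_expect_def sum_distrib_left power_divide power_mult_distrib algebra_simps)
    finally show ?thesis using X by simp
  qed
  with T1 T2 show ?thesis by (intro that)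
qed

section \<open>Estimates for factorials and binomial coefficients\<close>

lemma power_self_le_exp_fact: "real k ^ k \<le> exp 1 ^ k * fact k"
proof -
  \<comment> \<open>A single term of the exponential series at \<open>k\<close>.\<close>
  have "(\<Sum>i\<in>{k}. real k ^ i /\<^sub>R fact i) \<le> (\<Sum>i. real k ^ i /\<^sub>R fact i)"
    by (intro sum_le_suminf summable_exp_generic) auto
  then have "real k ^ k / fact k \<le> exp (real k)"
    by (simp add: exp_def divide_inverse mult.commute)
  then show ?thesis by (simp add: field_simps exp_of_nat_mult[symmetric])
qed

lemma binomial_le_exp_power:
  assumes "k > 0"
  shows "real (n choose k) \<le> (exp 1 * real n / real k) ^ k"
proof -
  have e: "1 / fact k \<le> (exp 1 / real k) ^ k"
    using power_self_le_exp_fact[of k] assms by (simp add: field_simps power_divide)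
  have "real (n choose k) * fact k \<le> real n ^ k"
  proof (cases "k \<le> n")
    case True
    then have "fact k * fact (n - k) * (n choose k) = (fact n :: real)"
      using binomial_fact_lemma[OF True] by (metis of_nat_fact of_nat_mult)
    moreover have "(fact n :: real) \<le> real n ^ k * fact (n - k)"
    proof -
      have "fact (n - k) dvd (fact n :: nat)" by (simp add: fact_dvd)
      then have "fact n = fact n div fact (n - k) * (fact (n - k) :: nat)" by simp
      also have "\<dots> \<le> n ^ k * fact (n - k)"
        by (intro mult_right_mono fact_div_fact_le_pow True) simp
      finally have "real (fact n) \<le> real (n ^ k * fact (n - k))" by (rule of_nat_mono)
      then show ?thesis by simp
    qed
    ultimately have "fact (n - k) * (real (n choose k) * fact k) \<le> fact (n - k) * real n ^ k"
      by (simp add: mult_ac)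
    then show ?thesis by (rule mult_left_le_imp_le) simp
  qed (simp add: binomial_eq_0)
  then have "real (n choose k) \<le> real n ^ k * (1 / fact k)" by (simp add: field_simps)
  also have "\<dots> \<le> real n ^ k * (exp 1 / real k) ^ k" using e by (intro mult_left_mono) auto
  finally show ?thesis by (simp add: power_mult_distrib power_divide mult.commute)
qed

text \<open>For \<open>k > L'\<close> the bound on fragments of size \<open>k\<close> is at most
  \<open>(exp 1 * L / (L' * (p * R))) ^ k\<close>, so the tail is a geometric series of ratio at
  most 1/2. The size bounds are real numbers so that they can be divided repeatedly without
  rounding; \<open>Suc (nat \<lfloor>L'\<rfloor>)\<close> is the least integer above
  \<open>L'\<close>.\<close>

lemma minimal_fragments_tail:
  fixes S :: "'i \<Rightarrow> 'b set"
  assumes X: "finite X" and I: "finite I"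
    and S: "\<And>s. s \<in> I \<Longrightarrow> S s \<subseteq> X" "\<And>s. s \<in> I \<Longrightarrow> real (card (S s)) \<le> L"
    and \<mu>: "\<And>s. s \<in> I \<Longrightarrow> 0 \<le> \<mu> s" and spread: "spread R I \<mu> S"
    and p: "0 < p" "p \<le> 1" and R: "0 < R" and L: "0 < L" "0 < L'"
    and \<theta>: "exp 1 * L / (L' * (p * R)) \<le> \<theta>" "\<theta> \<le> 1 / 2"
  obtains T where "\<And>W s. s \<in> I \<Longrightarrow> T W s \<subseteq> S s"
    "\<And>W s. s \<in> I \<Longrightarrow> \<exists>s'\<in>I. T W s = S s' - W"
    "rs_expect p X (\<lambda>W. \<Sum>s | s \<in> I \<and> L' < real (card (T W s)). \<mu> s) \<le> 2 * \<theta> ^ Suc (nat \<lfloor>L'\<rfloor>)"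
proof -
  define l where "l = nat \<lfloor>L\<rfloor>"
  have Sl: "card (S s) \<le> l" if "s \<in> I" for s
    using S(2)[OF that] L unfolding l_def by (simp add: le_nat_floor)
  obtain T where T: "\<And>W s. s \<in> I \<Longrightarrow> T W s \<subseteq> S s"
    "\<And>W s. s \<in> I \<Longrightarrow> \<exists>s'\<in>I. T W s = S s' - W"
    and tail: "\<And>k. rs_expect p X (\<lambda>W. \<Sum>s | s \<in> I \<and> card (T W s) = k. \<mu> s)
      \<le> real (l choose k) * (1 / (p * R)) ^ k"
    using minimal_fragments[OF X I S(1) Sl \<mu> spread p R] by blast
  have \<theta>0: "0 \<le> \<theta>" using \<theta>(1) p R L
    by (meson divide_nonneg_pos exp_ge_zero less_imp_le mult_nonneg_nonneg mult_pos_pos order_trans)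
  define k1 where "k1 = Suc (nat \<lfloor>L'\<rfloor>)"
  have k1: "k1 \<le> k \<longleftrightarrow> L' < real k" for k
    unfolding k1_def using L(2) by linarith
  have Tl: "card (T W s) \<le> l" if "s \<in> I" for W s
    using card_mono[OF _ T(1)[OF that]] Sl[OF that] finite_subset[OF S(1)[OF that] X]
    by (meson le_trans)
  have "(\<Sum>s | s \<in> I \<and> L' < real (card (T W s)). \<mu> s)
      = (\<Sum>k\<in>{k1..l}. \<Sum>s | s \<in> I \<and> card (T W s) = k. \<mu> s)" for W
  proof -
    have "{s \<in> I. L' < real (card (T W s))} = (\<Union>k\<in>{k1..l}. {s \<in> I. card (T W s) = k})"
      using Tl k1 by auto
    then show ?thesis using I by (subst sum.UNION_disjoint[symmetric]) auto
  qed
  then have "rs_expect p X (\<lambda>W. \<Sum>s | s \<in> I \<and> L' < real (card (T W s)). \<mu> s)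
      = (\<Sum>k\<in>{k1..l}. rs_expect p X (\<lambda>W. \<Sum>s | s \<in> I \<and> card (T W s) = k. \<mu> s))"
    by (simp add: rs_expect_sum)
  also have "\<dots> \<le> (\<Sum>k\<in>{k1..l}. \<theta> ^ k)"
  proof (rule sum_mono)
    fix k assume "k \<in> {k1..l}"
    then have k: "L' < real k" using k1 by auto
    then have k0: "k > 0" using L by (intro gr0I) auto
    have lL: "real l \<le> L" using L by (simp add: l_def)
    have "real (l choose k) * (1 / (p * R)) ^ k \<le> (exp 1 * real l / real k) ^ k * (1 / (p * R)) ^ k"
      using p R by (intro mult_right_mono binomial_le_exp_power k0) auto
    also have "\<dots> = (exp 1 * real l / (real k * (p * R))) ^ k"
      by (simp add: power_mult_distrib power_divide)
    also have "\<dots> \<le> (exp 1 * L / (L' * (p * R))) ^ k"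
      using p R L lL k by (intro power_mono frac_le mult_mono mult_left_mono mult_pos_pos) auto
    also have "\<dots> \<le> \<theta> ^ k" using \<theta> p R L by (intro power_mono) auto
    finally show "rs_expect p X (\<lambda>W. \<Sum>s | s \<in> I \<and> card (T W s) = k. \<mu> s) \<le> \<theta> ^ k"
      using tail[of k] by linarith
  qed
  also have "\<dots> \<le> 2 * \<theta> ^ k1"
  proof (cases "k1 \<le> l")
    case True
    have "(\<Sum>k\<in>{k1..l}. \<theta> ^ k) = (\<theta> ^ k1 - \<theta> ^ Suc l) / (1 - \<theta>)"
      using True \<theta> by (simp add: sum_gp)
    also have "\<dots> \<le> \<theta> ^ k1 / (1 - \<theta>)" using \<theta> \<theta>0 by (intro divide_right_mono) auto
    also have "\<dots> \<le> \<theta> ^ k1 / (1 / 2)" using \<theta> \<theta>0 by (intro divide_left_mono) auto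
    finally show ?thesis by simp
  qed (use \<theta>0 in auto)
  finally show ?thesis using T by (intro that[of T]) (auto simp: k1_def)
qed

text \<open>The parameter \<open>q\<close> is the factor by which the size of the fragments drops in each round.\<close>

lemma spread_rounds:
  fixes S :: "'i \<Rightarrow> 'b set"
  assumes X: "finite X" and p: "0 < p" and R: "0 < R" and q: "0 < q"
    and \<theta>: "exp 1 * q / (p * R) \<le> \<theta>" "\<theta> \<le> 1 / 2"
    and "finite I" "\<And>s. s \<in> I \<Longrightarrow> S s \<subseteq> X" "\<And>s. s \<in> I \<Longrightarrow> real (card (S s)) \<le> L"
    and "\<And>s. s \<in> I \<Longrightarrow> 0 \<le> \<mu> s" "spread R I \<mu> S" "real r * p \<le> 1" "0 < L" "L < q ^ r"
  shows "rs_expect (real r * p) X (\<lambda>W. of_bool (\<not> (\<exists>s\<in>I. S s \<subseteq> W)))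
    \<le> 1 - sum \<mu> I + 2 * real r * \<theta>"
  using assms(7-)
proof (induction r arbitrary: I S L)
  case 0
  show ?case
  proof (cases "I = {}")
    case True
    then show ?thesis using X by simp
  next
    case False
    \<comment> \<open>Here \<open>L < q ^ 0 = 1\<close>, so all members are empty and every
      \<open>W\<close> contains one.\<close>
    have "S s = {}" if "s \<in> I" for s
    proof -
      have "real (card (S s)) < 1" using 0 that by (metis le_less_trans power_0)
      then have "card (S s) = 0" by simp
      then show ?thesis using finite_subset[OF 0(2)[OF that] X] by simp
    qed
    then have "\<exists>s\<in>I. S s \<subseteq> W" for W using False by auto
    moreover have "sum \<mu> I \<le> 1" using 0(5) by (auto simp: spread_def dest: spec[of _ "{}"])
    ultimately show ?thesis using X by simp
  qed
next
  case (Suc r)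
  have rp: "0 \<le> real r * p" "p + real r * p \<le> 1" using Suc.prems p by (auto simp: algebra_simps)
  then have p1: "p \<le> 1" "real r * p \<le> 1" using p by linarith+
  have Lq: "0 < L / q" using Suc.prems q by simp
  have "exp 1 * L / (L / q * (p * R)) = exp 1 * q / (p * R)"
    using Suc.prems q by (simp add: field_simps)
  then have "exp 1 * L / (L / q * (p * R)) \<le> \<theta>" using \<theta> by simp
  from minimal_fragments_tail[OF X Suc.prems(1-5) p p1(1) R Suc.prems(7) Lq this \<theta>(2)]
  obtain T where T: "\<And>W s. s \<in> I \<Longrightarrow> T W s \<subseteq> S s"
    "\<And>W s. s \<in> I \<Longrightarrow> \<exists>s'\<in>I. T W s = S s' - W"
    and tail: "rs_expect p X (\<lambda>W. \<Sum>s | s \<in> I \<and> L / q < real (card (T W s)). \<mu> s)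
      \<le> 2 * \<theta> ^ Suc (nat \<lfloor>L / q\<rfloor>)"
    by blast
  have \<theta>0: "0 \<le> \<theta>" using \<theta>(1) p R q
    by (meson divide_nonneg_pos exp_ge_zero less_imp_le mult_nonneg_nonneg mult_pos_pos order_trans)
  \<comment> \<open>Only the first power is kept: when \<open>L / q\<close> is below 1 the exponent
    is exactly 1.\<close>
  have "\<theta> ^ Suc (nat \<lfloor>L / q\<rfloor>) \<le> \<theta> ^ 1" using \<theta>0 \<theta> by (intro power_decreasing) auto
  with tail have tail: "rs_expect p X (\<lambda>W. \<Sum>s | s \<in> I \<and> L / q < real (card (T W s)). \<mu> s) \<le> 2 * \<theta>"
    by simp
  let ?f = "\<lambda>W. of_bool (\<not> (\<exists>s\<in>I. S s \<subseteq> W)) :: real"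
  have step: "rs_expect (real r * p) X (\<lambda>W'. ?f (W \<union> W')) \<le>
    (1 - sum \<mu> I + 2 * real r * \<theta>) + (\<Sum>s | s \<in> I \<and> L / q < real (card (T W s)). \<mu> s)" for W
  proof -
    \<comment> \<open>Indices with a large fragment are discarded. Their weight reappears in
      \<open>1 - sum \<mu> ?I\<close> and is paid for by \<open>tail\<close>; hence the induction
      runs over families whose total weight may be below 1.\<close>
    let ?I = "{s \<in> I. real (card (T W s)) \<le> L / q}"
    have "rs_expect (real r * p) X (\<lambda>W'. ?f (W \<union> W'))
        \<le> rs_expect (real r * p) X (\<lambda>W'. of_bool (\<not> (\<exists>s\<in>?I. T W s \<subseteq> W')))"
    proof (rule rs_expect_mono[OF rp(1) p1(2)])
      fix W'
      have "\<exists>s\<in>I. S s \<subseteq> W \<union> W'" if "s \<in> ?I" "T W s \<subseteq> W'" for s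
        using T(2)[of s W] that by auto
      then show "?f (W \<union> W') \<le> of_bool (\<not> (\<exists>s\<in>?I. T W s \<subseteq> W'))" by auto
    qed
    also have "\<dots> \<le> 1 - sum \<mu> ?I + 2 * real r * \<theta>"
    proof (rule Suc.IH[where L = "L / q"])
      show "spread R ?I \<mu> (T W)" unfolding spread_def
      proof (intro allI impI)
        fix A :: "'b set" assume "finite A"
        have "(\<Sum>s | s \<in> ?I \<and> A \<subseteq> T W s. \<mu> s) \<le> (\<Sum>s | s \<in> I \<and> A \<subseteq> S s. \<mu> s)"
        proof (rule sum_mono2)
          show "{s \<in> ?I. A \<subseteq> T W s} \<subseteq> {s \<in> I. A \<subseteq> S s}" using T(1)[of _ W] by blast
        qed (use Suc.prems in auto)
        also have "\<dots> \<le> (1 / R) ^ card A" using Suc.prems \<open>finite A\<close> by (auto simp: spread_def)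
        finally show "(\<Sum>s | s \<in> ?I \<and> A \<subseteq> T W s. \<mu> s) \<le> (1 / R) ^ card A" .
      qed
      show "T W s \<subseteq> X" if "s \<in> ?I" for s using that T(1)[of s W] Suc.prems(2)[of s] by auto
    qed (use Suc.prems p1 q in \<open>auto simp: field_simps\<close>)
    also have "sum \<mu> ?I = sum \<mu> I - (\<Sum>s | s \<in> I \<and> L / q < real (card (T W s)). \<mu> s)"
    proof -
      have "I = ?I \<union> {s \<in> I. L / q < real (card (T W s))}" by auto
      then have "sum \<mu> I = sum \<mu> (?I \<union> {s \<in> I. L / q < real (card (T W s))})" by simp
      also have "\<dots> = sum \<mu> ?I + (\<Sum>s | s \<in> I \<and> L / q < real (card (T W s)). \<mu> s)"
        using Suc.prems(1) by (intro sum.union_disjoint) auto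
      finally show ?thesis by simp
    qed
    finally show ?thesis by simp
  qed
  have "rs_expect (real (Suc r) * p) X ?f = rs_expect (p + real r * p) X ?f"
    by (simp add: algebra_simps)
  also have "\<dots> \<le> rs_expect p X (\<lambda>W. rs_expect (real r * p) X (\<lambda>W'. ?f (W \<union> W')))"
    using rp p X by (intro rs_expect_union_le) (auto simp: antimono_def)
  also have "\<dots> \<le> rs_expect p X (\<lambda>W. (1 - sum \<mu> I + 2 * real r * \<theta>)
      + (\<Sum>s | s \<in> I \<and> L / q < real (card (T W s)). \<mu> s))"
    using p p1 step by (intro rs_expect_mono) auto
  also have "\<dots> \<le> (1 - sum \<mu> I + 2 * real r * \<theta>) + 2 * \<theta>"
    using tail X by (simp add: rs_expect_add)
  finally show ?case by (simp add: algebra_simps)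
qed

subsection \<open>Spreadness of random permutations\<close>

definition perm_families :: "'c set \<Rightarrow> nat \<Rightarrow> ('c \<Rightarrow> nat \<Rightarrow> nat) set" where
  "perm_families C N = (\<Pi>\<^sub>E P\<in>C. {\<pi>. \<pi> permutes {..<N}})"

text \<open>\<open>(u, i)\<close> is the \<open>i\<close>-th vertex available for the role
  \<open>u\<close>, and slot \<open>i\<close> of class \<open>P\<close> belongs to copy
  \<open>\<sigma> P i\<close>; the inverse lists the members of copy \<open>c\<close>. In this form,
  lying in the same copy is an equation between values of the permutations. Vertices of one class
  move together: \<open>\<kappa> = id\<close> moves all roles separately,
  \<open>\<kappa> = tight_hull F\<close> moves whole classes.\<close>

definition copy_edges ::
    "('a \<Rightarrow> 'c) \<Rightarrow> 'a set set \<Rightarrow> nat \<Rightarrow> ('c \<Rightarrow> nat \<Rightarrow> nat) \<Rightarrow> ('a \<times> nat) set set" where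
  "copy_edges \<kappa> E N \<sigma> = (\<lambda>(e, c). (\<lambda>u. (u, inv (\<sigma> (\<kappa> u)) c)) ` e) ` (E \<times> {..<N})"

lemma finite_perm_families: "finite C \<Longrightarrow> finite (perm_families C N)"
  unfolding perm_families_def by (intro finite_PiE finite_permutations) auto

lemma card_perm_families: "finite C \<Longrightarrow> card (perm_families C N) = fact N ^ card C"
  unfolding perm_families_def by (simp add: card_PiE card_permutations)

lemma card_copy_edges_le:
  assumes "finite E"
  shows "card (copy_edges \<kappa> E N \<sigma>) \<le> card E * N"
proof -
  have "card (copy_edges \<kappa> E N \<sigma>) \<le> card (E \<times> {..<N})"
    unfolding copy_edges_def using assms by (intro card_image_le) simp
  then show ?thesis by (simp add: card_cartesian_product)
qed

text \<open>Composition with the inverse of one fixed solution maps all solutions injectively to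
  permutations that fix \<open>Y\<close>. The prescribed values may be contradictory, so only an
  upper bound holds.\<close>

lemma card_permutes_prescribed_le:
  assumes "finite S" "Y \<subseteq> S"
  shows "card {\<pi>. \<pi> permutes S \<and> (\<forall>i\<in>Y. \<pi> i = g i)} \<le> fact (card S - card Y)"
proof (cases "{\<pi>. \<pi> permutes S \<and> (\<forall>i\<in>Y. \<pi> i = g i)} = {}")
  case False
  then obtain \<pi>0 where \<pi>0: "\<pi>0 permutes S" "\<And>i. i \<in> Y \<Longrightarrow> \<pi>0 i = g i" by auto
  have inj0: "inv \<pi>0 (\<pi>0 x) = x" "\<pi>0 (inv \<pi>0 x) = x" for x
    using \<pi>0(1) by (auto simp: permutes_inverses)
  have "card {\<pi>. \<pi> permutes S \<and> (\<forall>i\<in>Y. \<pi> i = g i)} \<le> card {\<pi>. \<pi> permutes (S - Y)}"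
  proof (rule card_inj_on_le[where f = "\<lambda>\<pi>. inv \<pi>0 \<circ> \<pi>"])
    show "inj_on (\<lambda>\<pi>. inv \<pi>0 \<circ> \<pi>) {\<pi>. \<pi> permutes S \<and> (\<forall>i\<in>Y. \<pi> i = g i)}"
    proof (rule inj_onI)
      fix \<pi> \<pi>' assume "inv \<pi>0 \<circ> \<pi> = inv \<pi>0 \<circ> \<pi>'"
      then have "\<pi>0 \<circ> (inv \<pi>0 \<circ> \<pi>) = \<pi>0 \<circ> (inv \<pi>0 \<circ> \<pi>')" by simp
      then show "\<pi> = \<pi>'" by (simp add: fun_eq_iff inj0)
    qed
    show "(\<lambda>\<pi>. inv \<pi>0 \<circ> \<pi>) ` {\<pi>. \<pi> permutes S \<and> (\<forall>i\<in>Y. \<pi> i = g i)} \<subseteq> {\<pi>. \<pi> permutes (S - Y)}"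
    proof clarify
      fix \<pi> assume \<pi>: "\<pi> permutes S" "\<forall>i\<in>Y. \<pi> i = g i"
      have "inv \<pi>0 \<circ> \<pi> permutes S"
        using \<pi>(1) permutes_inv[OF \<pi>0(1)] by (rule permutes_compose)
      moreover have "(inv \<pi>0 \<circ> \<pi>) i = i" if "i \<in> Y" for i
        using \<pi>(2) \<pi>0(2)[OF that] that inj0(1)[of i] by simp
      ultimately show "inv \<pi>0 \<circ> \<pi> permutes (S - Y)"
        by (auto intro: permutes_superset)
    qed
    show "finite {\<pi>. \<pi> permutes (S - Y)}" using assms by (intro finite_permutations) auto
  qed
  also have "\<dots> = fact (card (S - Y))" using assms by (intro card_permutations) auto
  also have "card (S - Y) = card S - card Y"
    using assms by (intro card_Diff_subset) (auto intro: finite_subset)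
  finally show ?thesis .
next
  case True
  show ?thesis unfolding True by simp
qed

text \<open>This says that the falling factorial of length \<open>k\<close> is at least
  \<open>(N / exp 1) ^ k\<close>; it combines \<open>(N / k) ^ k \<le> N choose k\<close> with
  \<open>k ^ k \<le> exp 1 ^ k * fact k\<close>.\<close>

lemma fact_diff_le:
  assumes "k \<le> N" "N > 0"
  shows "(fact (N - k) :: real) \<le> fact N * (exp 1 / real N) ^ k"
proof (cases "k = 0")
  case False
  have "(real N / real k) ^ k \<le> real (N choose k)"
    using binomial_ge_n_over_k_pow_k[OF assms(1)] by simp
  then have "real N ^ k \<le> real k ^ k * real (N choose k)"
    using False by (simp add: power_divide field_simps)
  also have "\<dots> \<le> (exp 1 ^ k * fact k) * real (N choose k)" using power_self_le_exp_fact by (intro mult_right_mono) auto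
  finally have "fact (N - k) * real N ^ k \<le> fact (N - k) * ((exp 1 ^ k * fact k) * real (N choose k))"
    by (intro mult_left_mono) auto
  also have "\<dots> = exp 1 ^ k * fact N"
  proof -
    have "fact k * fact (N - k) * (N choose k) = (fact N :: real)"
      using binomial_fact_lemma[OF assms(1)] by (metis of_nat_fact of_nat_mult)
    then show ?thesis by (simp add: mult_ac)
  qed
  finally show ?thesis using assms by (simp add: power_divide field_simps)
qed simp

text \<open>Fix a set \<open>A\<close> of edges. Two of the slots \<open>(\<kappa> u, i)\<close> touched by \<open>A\<close> are identified if they lie in the
  same copy for every family of permutations whose copies contain \<open>A\<close>. This relation is coarser
  than connectedness via \<open>A\<close>, but all slots in a class belong to different parts, so the
  density hypothesis applies to each class.\<close>

lemma card_perm_families_copy_edges_le: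
  fixes \<kappa> :: "'a \<Rightarrow> 'c" and D :: real
  assumes C: "finite C" and N: "N > 0" "exp 2 \<le> real N" and E: "finite E"
    and E2: "\<And>e. e \<in> E \<Longrightarrow> card e = 2 \<and> inj_on \<kappa> e \<and> \<kappa> ` e \<subseteq> C"
    and D: "0 < D" "\<And>U. U \<subseteq> C \<Longrightarrow> U \<noteq> {} \<Longrightarrow> real (card {e \<in> E. \<kappa> ` e \<subseteq> U}) \<le> D * (real (card U) - 1)"
    and A: "finite A"
  shows "real (card {\<sigma> \<in> perm_families C N. A \<subseteq> copy_edges \<kappa> E N \<sigma>})
    \<le> real (card (perm_families C N)) * (1 / (real N / exp 2) powr (1 / D)) ^ card A"
proof (cases "{\<sigma> \<in> perm_families C N. A \<subseteq> copy_edges \<kappa> E N \<sigma>} = {}")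
  case True
  then show ?thesis by (simp only: card.empty) simp
next
  case False
  define IA where "IA = {\<sigma> \<in> perm_families C N. A \<subseteq> copy_edges \<kappa> E N \<sigma>}"
  obtain \<sigma>0 where \<sigma>0: "\<sigma>0 \<in> IA" using False by (auto simp: IA_def)
  have perm: "\<sigma> P permutes {..<N}" if "\<sigma> \<in> IA" "P \<in> C" for \<sigma> P
    using that by (auto simp: IA_def perm_families_def)
  have edge: "\<exists>c<N. \<forall>x\<in>a. \<sigma> (\<kappa> (fst x)) (snd x) = c" and fstE: "fst ` a \<in> E"
    and fsti: "inj_on fst a" if \<sigma>: "\<sigma> \<in> IA" and a: "a \<in> A" for \<sigma> a
  proof -
    obtain e c where ec: "e \<in> E" "c < N" "a = (\<lambda>u. (u, inv (\<sigma> (\<kappa> u)) c)) ` e"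
      using \<sigma> a by (auto simp: IA_def copy_edges_def)
    have "\<sigma> (\<kappa> u) (inv (\<sigma> (\<kappa> u)) c) = c" if "u \<in> e" for u
      using perm[OF \<sigma>, of "\<kappa> u"] E2[OF ec(1)] that by (auto simp: permutes_inverses)
    then show "\<exists>c<N. \<forall>x\<in>a. \<sigma> (\<kappa> (fst x)) (snd x) = c" using ec by auto
    show "fst ` a \<in> E" using ec by (simp add: image_image)
    show "inj_on fst a" using ec by (auto simp: inj_on_def)
  qed
  define sv where "sv x = (\<kappa> (fst x), snd x)" for x :: "'a \<times> nat"
  define Y where "Y = sv ` \<Union>A"
  \<comment> \<open>\<open>ev y\<close> records the copy of the slot \<open>y\<close> under all
    admissible families at once, so its fibres \<open>Q z\<close> are the classes of the relation on
    slots.\<close>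
  define ev where "ev y = (\<lambda>\<sigma>\<in>IA. \<sigma> (fst y) (snd y))" for y :: "'c \<times> nat"
  have cardA: "card a = 2" if "a \<in> A" for a
    using E2[OF fstE[OF \<sigma>0 that]] card_image[OF fsti[OF \<sigma>0 that]] by simp
  have finA: "finite a" if "a \<in> A" for a using cardA[OF that] by (simp add: card_ge_0_finite)
  have finY: "finite Y" using A finA by (auto simp: Y_def)
  have YC: "fst y \<in> C" "snd y < N" if y: "y \<in> Y" for y
  proof -
    obtain x a where xa: "y = sv x" "x \<in> a" "a \<in> A" using y unfolding Y_def by blast
    show 1: "fst y \<in> C" using E2[OF fstE[OF \<sigma>0 xa(3)]] xa by (auto simp: sv_def)
    have "\<sigma>0 (fst y) (snd y) < N" using edge[OF \<sigma>0 xa(3)] xa by (auto simp: sv_def)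
    then show "snd y < N" using permutes_in_image[OF perm[OF \<sigma>0 1], of "snd y"] by simp
  qed
  have ev_edge: "ev (sv x) = ev (sv x')" if "a \<in> A" "x \<in> a" "x' \<in> a" for a x x'
  proof -
    have "\<sigma> (\<kappa> (fst x)) (snd x) = \<sigma> (\<kappa> (fst x')) (snd x')" if "\<sigma> \<in> IA" for \<sigma>
      using edge[OF that \<open>a \<in> A\<close>] \<open>x \<in> a\<close> \<open>x' \<in> a\<close> by auto
    then show ?thesis by (auto simp: ev_def sv_def restrict_def)
  qed
  define Q where "Q z = {y \<in> Y. ev y = z}" for z
  define c where "c = card (ev ` Y)"
  define u where "u = card Y"
  have finQ: "finite (Q z)" for z using finY by (simp add: Q_def)
  \<comment> \<open>Slots of one class lie in the same copy under \<open>\<sigma>0\<close>, and a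
    permutation takes each value once, so no part contributes two slots.\<close>
  have inj_fst: "inj_on fst (Q z)" for z
  proof (rule inj_onI)
    fix y y' assume y: "y \<in> Q z" "y' \<in> Q z" "fst y = fst y'"
    then have "ev y \<sigma>0 = ev y' \<sigma>0" "y \<in> Y" by (auto simp: Q_def)
    then have "\<sigma>0 (fst y) (snd y) = \<sigma>0 (fst y) (snd y')" using \<sigma>0 y(3) by (simp add: ev_def)
    then have "snd y = snd y'"
      using permutes_inj[OF perm[OF \<sigma>0 YC(1)[OF \<open>y \<in> Y\<close>]]] by (simp add: inj_def)
    then show "y = y'" using y(3) by (simp add: prod_eq_iff)
  qed
  have u_sum: "u = (\<Sum>z\<in>ev ` Y. card (Q z))"
    unfolding u_def Q_def using finY by (subst card_UN_disjoint[symmetric]) (auto intro: arg_cong[of _ _ card])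
  have cu: "2 * c \<le> u"
  proof -
    have "(\<Sum>z\<in>ev ` Y. 2) \<le> (\<Sum>z\<in>ev ` Y. card (Q z))"
    proof (rule sum_mono)
      fix z assume "z \<in> ev ` Y"
      then obtain x a where xa: "z = ev (sv x)" "x \<in> a" "a \<in> A" unfolding Y_def by blast
      have "card a > 1" using cardA[OF xa(3)] by simp
      then obtain x' where x': "x' \<in> a" "x' \<noteq> x"
        using xa(2) by (metis card_le_Suc0_iff_eq finA xa(3) One_nat_def not_less)
      have "fst x' \<noteq> fst x" using fsti[OF \<sigma>0 xa(3)] x' xa by (auto dest: inj_onD)
      then have "\<kappa> (fst x') \<noteq> \<kappa> (fst x)"
        using E2[OF fstE[OF \<sigma>0 xa(3)]] x' xa by (auto dest: inj_onD)
      then have ne: "sv x' \<noteq> sv x" by (simp add: sv_def)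
      have "{sv x', sv x} \<subseteq> Q z" using xa x' ev_edge[OF xa(3) x'(1) xa(2)] by (auto simp: Q_def Y_def)
      then have "card {sv x', sv x} \<le> card (Q z)" by (rule card_mono[OF finQ])
      then show "2 \<le> card (Q z)" using ne by simp
    qed
    then show ?thesis using u_sum by (simp add: c_def)
  qed
  \<comment> \<open>Both ends of an edge of \<open>A\<close> lie in one class, so \<open>A\<close>
    splits over the classes. Summing the density hypothesis gives \<open>D\<close> times the number
    of slots minus the number of classes.\<close>
  have Acu: "real (card A) \<le> D * (real u - real c)"
  proof -
    define Az where "Az z = {a \<in> A. sv ` a \<subseteq> Q z}" for z
    have "A \<subseteq> (\<Union>z\<in>ev ` Y. Az z)"
    proof
      fix a assume a: "a \<in> A"
      then have "a \<noteq> {}" using cardA[OF a] by (metis card.empty zero_neq_numeral)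
      then obtain x where x: "x \<in> a" by blast
      have "sv ` a \<subseteq> Q (ev (sv x))" using ev_edge[OF a _ x] a by (auto simp: Q_def Y_def)
      then show "a \<in> (\<Union>z\<in>ev ` Y. Az z)" using a x by (auto simp: Az_def Y_def)
    qed
    then have "card A \<le> card (\<Union>z\<in>ev ` Y. Az z)"
      using A finY by (intro card_mono) (auto simp: Az_def)
    also have "\<dots> \<le> (\<Sum>z\<in>ev ` Y. card (Az z))" using finY by (intro card_UN_le) auto
    finally have "real (card A) \<le> (\<Sum>z\<in>ev ` Y. real (card (Az z)))"
      by (metis of_nat_le_iff of_nat_sum)
    also have "\<dots> \<le> (\<Sum>z\<in>ev ` Y. D * (real (card (Q z)) - 1))"
    proof (rule sum_mono)
      fix z assume "z \<in> ev ` Y"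
      then have ne: "Q z \<noteq> {}" by (auto simp: Q_def)
      have "card (Az z) \<le> card {e \<in> E. \<kappa> ` e \<subseteq> fst ` Q z}"
      proof (rule card_inj_on_le[where f = "(`) fst"])
        show "inj_on ((`) fst) (Az z)"
        proof (rule inj_onI)
          have sub: "a \<subseteq> a'" if aa: "a \<in> Az z" "a' \<in> Az z" "fst ` a = fst ` a'" for a a'
          proof
            fix x assume x: "x \<in> a"
            then obtain x' where x': "x' \<in> a'" "fst x' = fst x"
              using aa(3) by (metis imageE imageI)
            have "sv x \<in> Q z" "sv x' \<in> Q z" using aa x x' by (auto simp: Az_def)
            then have "sv x = sv x'" using x'(2) by (intro inj_onD[OF inj_fst[of z]]) (auto simp: sv_def)
            then have "x = x'" using x'(2) by (simp add: sv_def prod_eq_iff)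
            then show "x \<in> a'" using x' by simp
          qed
          fix a a' assume "a \<in> Az z" "a' \<in> Az z" "fst ` a = fst ` a'"
          then show "a = a'" using sub[of a a'] sub[of a' a] by auto
        qed
        show "(`) fst ` Az z \<subseteq> {e \<in> E. \<kappa> ` e \<subseteq> fst ` Q z}"
        proof (rule image_subsetI)
          fix a assume a: "a \<in> Az z"
          have "\<kappa> ` fst ` a = fst ` sv ` a" by (simp add: image_image sv_def)
          also have "\<dots> \<subseteq> fst ` Q z" using a by (auto simp: Az_def)
          finally show "fst ` a \<in> {e \<in> E. \<kappa> ` e \<subseteq> fst ` Q z}" using a fstE[OF \<sigma>0] by (auto simp: Az_def)
        qed
        show "finite {e \<in> E. \<kappa> ` e \<subseteq> fst ` Q z}" using E by simp
      qed
      then have "real (card (Az z)) \<le> real (card {e \<in> E. \<kappa> ` e \<subseteq> fst ` Q z})" by simp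
      also have "\<dots> \<le> D * (real (card (fst ` Q z)) - 1)"
        using ne YC(1) by (intro D(2)) (auto simp: Q_def)
      also have "card (fst ` Q z) = card (Q z)" by (rule card_image[OF inj_fst])
      finally show "real (card (Az z)) \<le> D * (real (card (Q z)) - 1)" .
    qed
    also have "\<dots> = D * (real u - real c)"
      by (simp add: sum_distrib_left[symmetric] sum_subtractf u_sum c_def)
    finally show ?thesis .
  qed
  define YP where "YP P = {i. (P, i) \<in> Y}" for P
  have YPN: "YP P \<subseteq> {..<N}" for P using YC(2) by (force simp: YP_def)
  have finYP: "finite (YP P)" for P using YPN finite_subset by blast
  have u_YP: "u = (\<Sum>P\<in>C. card (YP P))"
  proof -
    have "Y = (SIGMA P:C. YP P)" using YC(1) by (force simp: YP_def)
    then show ?thesis unfolding u_def using C finYP by simp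
  qed
  \<comment> \<open>Choosing a copy for each class, in at most \<open>N ^ c\<close> ways, prescribes
    the values of the permutations at all \<open>u\<close> touched slots.\<close>
  have "card IA \<le> N ^ c * (\<Prod>P\<in>C. fact (N - card (YP P)))"
  proof -
    define H where "H = (ev ` Y \<rightarrow>\<^sub>E {..<N})"
    define fib where "fib h = (\<Pi>\<^sub>E P\<in>C. {\<pi>. \<pi> permutes {..<N} \<and> (\<forall>i\<in>YP P. \<pi> i = h (ev (P, i)))})" for h
    have "IA \<subseteq> (\<Union>h\<in>H. fib h)"
    proof
      fix \<sigma> assume \<sigma>: "\<sigma> \<in> IA"
      define h where "h = (\<lambda>z\<in>ev ` Y. z \<sigma>)"
      have "ev y \<sigma> < N" if "y \<in> Y" for y
        using YC[OF that] permutes_in_image[OF perm[OF \<sigma> YC(1)[OF that]], of "snd y"] \<sigma>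
        by (simp add: ev_def)
      then have "h \<in> H" by (auto simp: H_def h_def)
      moreover have "\<sigma> \<in> fib h"
      proof -
        have "h (ev y) = \<sigma> (fst y) (snd y)" if "y \<in> Y" for y
          using that \<sigma> by (simp add: h_def ev_def)
        from this[of "(_, _)"] show ?thesis
          using \<sigma> perm[OF \<sigma>] by (auto simp: fib_def PiE_iff YP_def IA_def perm_families_def)
      qed
      ultimately show "\<sigma> \<in> (\<Union>h\<in>H. fib h)" by auto
    qed
    moreover have finH: "finite H" unfolding H_def using finY by (intro finite_PiE) auto
    moreover have finfib: "finite (fib h)" for h
      unfolding fib_def using C by (intro finite_PiE) (auto intro: finite_subset[OF _ finite_permutations[of "{..<N}"]])
    ultimately have "card IA \<le> card (\<Union>h\<in>H. fib h)" by (intro card_mono) auto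
    also have "\<dots> \<le> (\<Sum>h\<in>H. card (fib h))" by (rule card_UN_le[OF finH])
    also have "\<dots> \<le> (\<Sum>h\<in>H. \<Prod>P\<in>C. fact (N - card (YP P)))"
    proof (rule sum_mono)
      fix h
      have "card (fib h) = (\<Prod>P\<in>C. card {\<pi>. \<pi> permutes {..<N} \<and> (\<forall>i\<in>YP P. \<pi> i = h (ev (P, i)))})"
        unfolding fib_def using C by (rule card_PiE)
      also have "\<dots> \<le> (\<Prod>P\<in>C. fact (N - card (YP P)))"
        using card_permutes_prescribed_le[OF _ YPN] by (intro prod_mono) auto
      finally show "card (fib h) \<le> (\<Prod>P\<in>C. fact (N - card (YP P)))" .
    qed
    also have "\<dots> = N ^ c * (\<Prod>P\<in>C. fact (N - card (YP P)))"
      using finY by (simp add: H_def card_PiE c_def)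
    finally show ?thesis .
  qed
  then have "real (card IA) \<le> real N ^ c * (\<Prod>P\<in>C. fact (N - card (YP P)))"
    by (metis (mono_tags, lifting) of_nat_fact of_nat_le_iff of_nat_mult of_nat_power of_nat_prod prod.cong)
  also have "\<dots> \<le> real N ^ c * (\<Prod>P\<in>C. fact N * (exp 1 / real N) ^ card (YP P))"
    using N card_mono[OF _ YPN] by (intro mult_left_mono prod_mono) (auto intro!: fact_diff_le)
  also have "\<dots> = fact N ^ card C * (real N ^ c * (exp 1 / real N) ^ u)"
    by (simp add: prod.distrib u_YP power_sum)
  \<comment> \<open>Each class has at least two slots, so \<open>u \<le> 2 * (u - c)\<close> and
    \<open>exp 1 ^ u\<close> is absorbed into \<open>exp 2 ^ (u - c)\<close>. This is the origin of
    \<open>exp 2\<close> in the spread parameter.\<close>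
  also have "real N ^ c * (exp 1 / real N) ^ u \<le> (exp 2 / real N) ^ (u - c)"
  proof -
    have u: "u = c + (u - c)" "u \<le> 2 * (u - c)" using cu by auto
    have "real N ^ c * (exp 1 / real N) ^ u = exp 1 ^ u * (1 / real N) ^ (u - c)"
      using N by (subst (1 2) u(1)) (simp add: power_add power_divide field_simps)
    also have "\<dots> \<le> exp 1 ^ (2 * (u - c)) * (1 / real N) ^ (u - c)"
      using u(2) by (intro mult_right_mono power_increasing) auto
    also have "\<dots> = (exp 2 / real N) ^ (u - c)"
      by (simp add: power_mult power_divide exp_of_nat_mult[symmetric])
    finally show ?thesis .
  qed
  also have "(exp 2 / real N) ^ (u - c) = (exp 2 / real N) powr (real u - real c)"
    using N cu by (simp add: powr_realpow[symmetric] of_nat_diff)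
  \<comment> \<open>The base is at most 1 because \<open>exp 2 \<le> N\<close>, so the lower bound
    on \<open>u - c\<close> in \<open>Acu\<close> becomes an upper bound here.\<close>
  also have "\<dots> \<le> (exp 2 / real N) powr (real (card A) / D)"
    using Acu D N by (intro powr_mono') (auto simp: field_simps)
  also have "\<dots> = (1 / (real N / exp 2) powr (1 / D)) ^ card A"
  proof -
    have "(exp 2 / real N) powr (real (card A) / D) = ((exp 2 / real N) powr (1 / D)) powr real (card A)"
      by (simp add: powr_powr)
    also have "\<dots> = ((exp 2 / real N) powr (1 / D)) ^ card A"
      using N by (intro powr_realpow) auto
    also have "(exp 2 / real N) powr (1 / D) = 1 / (real N / exp 2) powr (1 / D)"
      using N by (simp add: powr_divide)
    finally show ?thesis .
  qed
  finally show ?thesis unfolding IA_def using C by (simp add: card_perm_families)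
qed

text \<open>\<open>\<phi>\<close> carries the abstract vertices \<open>(u, i)\<close> to actual
  ones. By injectivity a set \<open>A\<close> that occurs at all has a preimage of the same size
  among the abstract edges, to which the count applies.\<close>

lemma spread_copy_edges:
  fixes \<kappa> :: "'a \<Rightarrow> 'c" and D :: real and \<phi> :: "'a \<times> nat \<Rightarrow> 'v"
  assumes C: "finite C" and N: "N > 0" "exp 2 \<le> real N" and E: "finite E"
    and E2: "\<And>e. e \<in> E \<Longrightarrow> card e = 2 \<and> inj_on \<kappa> e \<and> \<kappa> ` e \<subseteq> C \<and> e \<subseteq> V"
    and D: "0 < D" "\<And>U. U \<subseteq> C \<Longrightarrow> U \<noteq> {} \<Longrightarrow> real (card {e \<in> E. \<kappa> ` e \<subseteq> U}) \<le> D * (real (card U) - 1)"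
    and \<phi>: "inj_on \<phi> (V \<times> {..<N})"
  shows "spread ((real N / exp 2) powr (1 / D)) (perm_families C N)
    (\<lambda>_. 1 / real (card (perm_families C N))) (\<lambda>\<sigma>. (`) \<phi> ` copy_edges \<kappa> E N \<sigma>)"
  unfolding spread_def
proof (intro allI impI)
  fix A :: "'v set set" assume A: "finite A"
  let ?I = "perm_families C N"
  let ?R = "(real N / exp 2) powr (1 / D)"
  have sub: "copy_edges \<kappa> E N \<sigma> \<subseteq> Pow (V \<times> {..<N})" if "\<sigma> \<in> ?I" for \<sigma>
  proof
    fix a assume "a \<in> copy_edges \<kappa> E N \<sigma>"
    then obtain e c where ec: "e \<in> E" "c < N" "a = (\<lambda>u. (u, inv (\<sigma> (\<kappa> u)) c)) ` e"
      by (auto simp: copy_edges_def)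
    have "inv (\<sigma> (\<kappa> u)) c < N" if "u \<in> e" for u
    proof -
      have "\<sigma> (\<kappa> u) permutes {..<N}" using \<open>\<sigma> \<in> ?I\<close> E2[OF ec(1)] that by (auto simp: perm_families_def)
      from permutes_in_image[OF permutes_inv[OF this], of c] ec show ?thesis by simp
    qed
    then show "a \<in> Pow (V \<times> {..<N})" using ec E2[OF ec(1)] by auto
  qed
  have "real (card {\<sigma> \<in> ?I. A \<subseteq> (`) \<phi> ` copy_edges \<kappa> E N \<sigma>})
      \<le> real (card ?I) * (1 / ?R) ^ card A"
  proof (cases "{\<sigma> \<in> ?I. A \<subseteq> (`) \<phi> ` copy_edges \<kappa> E N \<sigma>} = {}")
    case True
    then show ?thesis by (simp only: card.empty) simp
  next
    case False
    then obtain \<sigma>0 where \<sigma>0: "\<sigma>0 \<in> ?I" "A \<subseteq> (`) \<phi> ` copy_edges \<kappa> E N \<sigma>0" by auto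
    then obtain A' where A': "A' \<subseteq> copy_edges \<kappa> E N \<sigma>0" "A = (`) \<phi> ` A'"
      by (meson subset_imageE)
    have inj: "inj_on ((`) \<phi>) (Pow (V \<times> {..<N}))" by (rule inj_on_image_Pow[OF \<phi>])
    have A'V: "A' \<subseteq> Pow (V \<times> {..<N})" using A' sub[OF \<sigma>0(1)] by auto
    then have injA': "inj_on ((`) \<phi>) A'" by (rule inj_on_subset[OF inj])
    then have cA: "card A = card A'" "finite A'"
      using A' A by (auto simp: card_image dest: finite_imageD)
    have "{\<sigma> \<in> ?I. A \<subseteq> (`) \<phi> ` copy_edges \<kappa> E N \<sigma>} = {\<sigma> \<in> ?I. A' \<subseteq> copy_edges \<kappa> E N \<sigma>}"
      using A'(2) inj_on_image_subset_iff[OF inj A'V sub] by auto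
    then show ?thesis
      using card_perm_families_copy_edges_le[OF C N E _ D cA(2)] E2 cA(1) by simp
  qed
  then have "real (card {\<sigma> \<in> ?I. A \<subseteq> (`) \<phi> ` copy_edges \<kappa> E N \<sigma>}) / real (card ?I) \<le> (1 / ?R) ^ card A"
    using C by (simp add: card_perm_families field_simps)
  then show "(\<Sum>\<sigma> | \<sigma> \<in> ?I \<and> A \<subseteq> (`) \<phi> ` copy_edges \<kappa> E N \<sigma>. 1 / real (card ?I)) \<le> (1 / ?R) ^ card A"
    by simp
qed

subsection \<open>Tight vertex sets\<close>

definition edges_in :: "'a graph \<Rightarrow> 'a set \<Rightarrow> 'a set set" where
  "edges_in F U = {e \<in> edges F. e \<subseteq> U}"

lemma simple_graph_finite:
  assumes "simple_graph F"
  shows "finite (verts F)" "finite (edges F)" "\<And>e. e \<in> edges F \<Longrightarrow> e \<subseteq> verts F \<and> card e = 2"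
proof -
  show V: "finite (verts F)" and E: "\<And>e. e \<in> edges F \<Longrightarrow> e \<subseteq> verts F \<and> card e = 2"
    using assms by (auto simp: simple_graph_def all_edges_def)
  have "edges F \<subseteq> Pow (verts F)" using E by auto
  then show "finite (edges F)" using V by (auto intro: finite_subset)
qed

lemma finite_densities:
  assumes "simple_graph F"
  shows "finite {density H | H. subgraph H F \<and> card (verts H) \<ge> 2}"
proof -
  have "{density H | H. subgraph H F \<and> card (verts H) \<ge> 2} \<subseteq> density ` (Pow (verts F) \<times> Pow (edges F))"
    by (auto simp: subgraph_def image_iff)
  moreover have "finite (density ` (Pow (verts F) \<times> Pow (edges F)))"
    using simple_graph_finite[OF assms] by simp
  ultimately show ?thesis by (rule finite_subset)
qed

lemma density_le_max_density:
  assumes "simple_graph F" "subgraph H F" "card (verts H) \<ge> 2"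
  shows "density H \<le> max_density F"
  unfolding max_density_def using assms by (intro Max_ge finite_densities) blast+

lemma subgraph_edges_in:
  assumes "simple_graph F" "U \<subseteq> verts F"
  shows "subgraph (U, edges_in F U) F"
  using assms simple_graph_finite[OF assms(1)]
  by (auto simp: subgraph_def simple_graph_def all_edges_def edges_in_def intro: finite_subset)

text \<open>Multiplying out the density covers singletons too, for which both sides are 0.\<close>

lemma card_edges_in_le:
  assumes F: "simple_graph F" and U: "U \<subseteq> verts F" "U \<noteq> {}"
  shows "real (card (edges_in F U)) \<le> max_density F * (real (card U) - 1)"
proof (cases "card U \<ge> 2")
  case True
  have "density (U, edges_in F U) \<le> max_density F"
    using True by (intro density_le_max_density F subgraph_edges_in U) auto
  then show ?thesis using True by (simp add: density_def field_simps)
next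
  case False
  have fin: "finite U" using simple_graph_finite(1)[OF F] U finite_subset by blast
  then have 1: "card U = 1" using False U by (metis One_nat_def Suc_leI card_gt_0_iff le_antisym not_less_eq_eq numeral_2_eq_2)
  have "\<not> e \<subseteq> U" if "e \<in> edges F" for e
    using simple_graph_finite(3)[OF F that] card_mono[OF fin, of e] False by auto
  then have "edges_in F U = {}" by (auto simp: edges_in_def)
  then show ?thesis using 1 by simp
qed

text \<open>Equality in \<open>card_edges_in_le\<close>. Singletons are tight, so every vertex lies
  in a tight set and trivial classes need no separate treatment.\<close>

definition tight :: "'a graph \<Rightarrow> 'a set \<Rightarrow> bool" where
  "tight F U \<longleftrightarrow> U \<subseteq> verts F \<and> U \<noteq> {} \<and>
     real (card (edges_in F U)) = max_density F * (real (card U) - 1)"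

text \<open>The number of induced edges is supermodular, while the bound of
  \<open>card_edges_in_le\<close> is modular and applies to the intersection since that is nonempty.
  Equality for both sets forces equality for the union.\<close>

lemma tight_Un:
  assumes F: "simple_graph F" and U: "tight F U" "tight F U'" and int: "U \<inter> U' \<noteq> {}"
  shows "tight F (U \<union> U')"
proof -
  have fin: "finite (edges_in F X)" for X
    using simple_graph_finite(2)[OF F] by (simp add: edges_in_def)
  have finU: "finite U" "finite U'"
    using U simple_graph_finite(1)[OF F] by (auto simp: tight_def intro: finite_subset)
  have "card (edges_in F U) + card (edges_in F U')
      = card (edges_in F U \<union> edges_in F U') + card (edges_in F U \<inter> edges_in F U')"
    by (rule card_Un_Int[OF fin fin])
  also have "edges_in F U \<inter> edges_in F U' = edges_in F (U \<inter> U')" by (auto simp: edges_in_def)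
  also have "card (edges_in F U \<union> edges_in F U') \<le> card (edges_in F (U \<union> U'))"
    by (intro card_mono[OF fin]) (auto simp: edges_in_def)
  finally have 1: "real (card (edges_in F U)) + real (card (edges_in F U'))
      \<le> real (card (edges_in F (U \<union> U'))) + real (card (edges_in F (U \<inter> U')))" by simp
  have 2: "real (card (edges_in F (U \<inter> U'))) \<le> max_density F * (real (card (U \<inter> U')) - 1)"
    using U int by (intro card_edges_in_le F) (auto simp: tight_def)
  have 3: "real (card (edges_in F (U \<union> U'))) \<le> max_density F * (real (card (U \<union> U')) - 1)"
    using U by (intro card_edges_in_le F) (auto simp: tight_def)
  have 4: "real (card U) + real (card U') = real (card (U \<union> U')) + real (card (U \<inter> U'))"
    using card_Un_Int[OF finU] by linarith
  have "max_density F * (real (card U) - 1) + max_density F * (real (card U') - 1)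
      = max_density F * (real (card (U \<union> U')) - 1) + max_density F * (real (card (U \<inter> U')) - 1)"
    unfolding distrib_left[symmetric] using 4 by (intro arg_cong2[of _ _ _ _ "(*)"]) auto
  then have "real (card (edges_in F (U \<union> U'))) = max_density F * (real (card (U \<union> U')) - 1)"
    using 1 2 3 U by (simp add: tight_def)
  then show ?thesis using U by (auto simp: tight_def)
qed

text \<open>By \<open>tight_Un\<close> the union is itself tight, hence the largest tight set
  containing \<open>v\<close>. These hulls are the classes, and \<open>tight_hull F\<close> serves
  as the class map.\<close>

definition tight_hull :: "'a graph \<Rightarrow> 'a \<Rightarrow> 'a set" where
  "tight_hull F v = \<Union>{U. tight F U \<and> v \<in> U}"

lemma tight_singleton:
  assumes "simple_graph F" "v \<in> verts F"
  shows "tight F {v}"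
  using card_edges_in_le[OF assms(1), of "{v}"] assms(2) by (auto simp: tight_def)

lemma tight_hull:
  assumes F: "simple_graph F" and v: "v \<in> verts F"
  shows "tight F (tight_hull F v)" "v \<in> tight_hull F v"
    "\<And>U. tight F U \<Longrightarrow> v \<in> U \<Longrightarrow> U \<subseteq> tight_hull F v"
proof -
  have Un: "tight F (\<Union>\<U>)" if "finite \<U>" "\<U> \<noteq> {}" "\<forall>U\<in>\<U>. tight F U \<and> v \<in> U" for \<U>
    using that
  proof (induction \<U> rule: finite_ne_induct)
    case (insert U \<U>)
    then have "tight F (U \<union> \<Union>\<U>)" by (intro tight_Un F) auto
    then show ?case by simp
  qed simp
  have "{U. tight F U \<and> v \<in> U} \<subseteq> Pow (verts F)" by (auto simp: tight_def)
  then have "finite {U. tight F U \<and> v \<in> U}"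
    using simple_graph_finite(1)[OF F] by (meson finite_Pow_iff finite_subset)
  moreover have "{v} \<in> {U. tight F U \<and> v \<in> U}" using tight_singleton[OF F v] by simp
  ultimately show "tight F (tight_hull F v)" unfolding tight_hull_def
    by (intro Un) blast+
  show "v \<in> tight_hull F v" using tight_singleton[OF F v] by (auto simp: tight_hull_def)
  show "U \<subseteq> tight_hull F v" if "tight F U" "v \<in> U" for U using that by (auto simp: tight_hull_def)
qed

lemma tight_hull_eq:
  assumes F: "simple_graph F" and v: "v \<in> verts F" "u \<in> tight_hull F v"
  shows "tight_hull F u = tight_hull F v"
proof -
  have u: "u \<in> verts F" using tight_hull(1)[OF F v(1)] v(2) by (auto simp: tight_def)
  have 1: "tight_hull F v \<subseteq> tight_hull F u" using tight_hull(1)[OF F v(1)] tight_hull(3)[OF F u] v(2) by blast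
  then have "tight_hull F u \<subseteq> tight_hull F v"
    using tight_hull(1)[OF F u] tight_hull(2,3)[OF F v(1)] by blast
  with 1 show ?thesis by blast
qed

text \<open>Contracting each class to a point: \<open>inj_on (tight_hull F) e\<close> says that the
  ends of \<open>e\<close> lie in different classes. The inner edges of the tight classes are
  counted exactly, and subtracting them from the bound for the union \<open>B\<close> leaves the
  bound for the contracted graph.\<close>

lemma card_cross_edges:
  assumes F: "simple_graph F" and U: "U \<subseteq> tight_hull F ` verts F" "U \<noteq> {}"
  defines "X \<equiv> {e \<in> edges F. inj_on (tight_hull F) e \<and> tight_hull F ` e \<subseteq> U}"
  shows "real (card X) \<le> max_density F * (real (card U) - 1)"
    and "card U \<ge> 2 \<Longrightarrow> real (card X) < max_density F * (real (card U) - 1)"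
proof -
  note fin = simple_graph_finite[OF F]
  let ?\<kappa> = "tight_hull F"
  have finU: "finite U" using U fin finite_surj by blast
  have tP: "tight F P" and PV: "P \<subseteq> verts F" and P\<kappa>: "\<And>v. v \<in> P \<Longrightarrow> ?\<kappa> v = P" if P: "P \<in> U" for P
  proof -
    obtain v where v: "v \<in> verts F" "P = ?\<kappa> v" using U P by blast
    show "tight F P" using tight_hull(1)[OF F v(1)] v by simp
    then show "P \<subseteq> verts F" by (simp add: tight_def)
    show "?\<kappa> u = P" if "u \<in> P" for u using tight_hull_eq[OF F v(1), of u] v(2) that by simp
  qed
  have disj: "P \<inter> P' = {}" if "P \<in> U" "P' \<in> U" "P \<noteq> P'" for P P'
    using P\<kappa>[OF that(1)] P\<kappa>[OF that(2)] that(3) by blast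
  have finP: "finite P" if "P \<in> U" for P using PV[OF that] fin(1) finite_subset by blast
  define B where "B = \<Union>U"
  have BV: "B \<subseteq> verts F" using PV by (auto simp: B_def)
  have cardB: "card B = (\<Sum>P\<in>U. card P)"
    unfolding B_def using disj finP by (intro card_Union_disjoint) (auto simp: pairwise_def disjnt_def)
  have Bne: "B \<noteq> {}" using U(2) tP by (fastforce simp: B_def tight_def)
  have fe: "finite (edges_in F Y)" for Y using fin by (simp add: edges_in_def)
  have "card X + (\<Sum>P\<in>U. card (edges_in F P)) = card (X \<union> (\<Union>P\<in>U. edges_in F P))"
  proof -
    have d: "edges_in F P \<inter> edges_in F P' = {}" if "P \<in> U" "P' \<in> U" "P \<noteq> P'" for P P'
    proof (rule ccontr)
      assume "edges_in F P \<inter> edges_in F P' \<noteq> {}"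
      then obtain e where e: "e \<in> edges F" "e \<subseteq> P \<inter> P'" by (auto simp: edges_in_def)
      then have "e = {}" using disj[OF that] by auto
      then show False using fin(3)[OF e(1)] by simp
    qed
    have x: "X \<inter> (\<Union>P\<in>U. edges_in F P) = {}"
    proof (rule ccontr)
      assume "X \<inter> (\<Union>P\<in>U. edges_in F P) \<noteq> {}"
      then obtain e P where e: "e \<in> X" "P \<in> U" "e \<subseteq> P" by (auto simp: edges_in_def)
      then have i: "inj_on ?\<kappa> e" "card e = 2" using fin(3) by (auto simp: X_def)
      have "?\<kappa> ` e \<subseteq> {P}" using P\<kappa>[OF e(2)] e(3) by auto
      then have "card (?\<kappa> ` e) \<le> 1" using card_mono[of "{P}"] by force
      then show False using card_image[OF i(1)] i(2) by simp
    qed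
    have "card (\<Union>P\<in>U. edges_in F P) = (\<Sum>P\<in>U. card (edges_in F P))"
      using finU fe d by (intro card_UN_disjoint) auto
    moreover have "card (X \<union> (\<Union>P\<in>U. edges_in F P)) = card X + card (\<Union>P\<in>U. edges_in F P)"
      using fin finU fe x by (intro card_Un_disjoint) (auto simp: X_def)
    ultimately show ?thesis by simp
  qed
  also have "\<dots> \<le> card (edges_in F B)"
  proof (rule card_mono[OF fe])
    have "e \<subseteq> B" if "e \<in> X" for e
    proof
      fix v assume "v \<in> e"
      then have "v \<in> verts F" "?\<kappa> v \<in> U" using that fin(3) by (auto simp: X_def)
      then show "v \<in> B" using tight_hull(2)[OF F] by (auto simp: B_def)
    qed
    then show "X \<union> (\<Union>P\<in>U. edges_in F P) \<subseteq> edges_in F B"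
      by (auto simp: X_def edges_in_def B_def)
  qed
  finally have "real (card X) + (\<Sum>P\<in>U. real (card (edges_in F P))) \<le> real (card (edges_in F B))"
    by (metis of_nat_add of_nat_le_iff of_nat_sum)
  also have "(\<Sum>P\<in>U. real (card (edges_in F P))) = (\<Sum>P\<in>U. max_density F * (real (card P) - 1))"
    using tP by (intro sum.cong) (auto simp: tight_def)
  also have "\<dots> = max_density F * (real (card B) - real (card U))"
    by (simp add: sum_distrib_left[symmetric] sum_subtractf cardB)
  finally have 1: "real (card X) \<le> real (card (edges_in F B)) - max_density F * (real (card B) - real (card U))"
    by simp
  have 2: "real (card (edges_in F B)) \<le> max_density F * (real (card B) - 1)"
    by (rule card_edges_in_le[OF F BV Bne])
  show "real (card X) \<le> max_density F * (real (card U) - 1)"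
    using 1 2 by (simp add: algebra_simps)
  show "real (card X) < max_density F * (real (card U) - 1)" if c: "card U \<ge> 2"
  proof -
    \<comment> \<open>Equality would make \<open>B\<close> tight. By maximality \<open>B\<close>
      would then lie in the hull of each of its vertices, so \<open>U\<close> would consist of one
      class.\<close>
    have "\<not> tight F B"
    proof
      assume t: "tight F B"
      obtain P where P: "P \<in> U" using U by blast
      have "P' = P" if P': "P' \<in> U" for P'
      proof -
        obtain v where v: "v \<in> P" using tP[OF P] by (auto simp: tight_def)
        obtain w where w: "w \<in> P'" using tP[OF P'] by (auto simp: tight_def)
        have "w \<in> B" "v \<in> B" using w v P P' by (auto simp: B_def)
        then have "w \<in> ?\<kappa> v" using tight_hull(3)[OF F _ t, of v] v PV[OF P] by blast
        then have "w \<in> P" using P\<kappa>[OF P v] by simp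
        then show "P' = P" using disj[OF P P'] w by blast
      qed
      then have "U \<subseteq> {P}" by auto
      then have "card U \<le> card {P}" by (intro card_mono) auto
      then show False using c by simp
    qed
    then have "real (card (edges_in F B)) \<noteq> max_density F * (real (card B) - 1)"
      using BV Bne by (auto simp: tight_def)
    then show ?thesis using 1 2 by (simp add: algebra_simps)
  qed
qed

section \<open>Consequences of vertex imbalance\<close>

lemma exists_edge_if_not_vertex_balanced:
  assumes F: "simple_graph F" and nb: "\<not> vertex_balanced F"
  shows "edges F \<noteq> {}"
proof
  assume E: "edges F = {}"
  have d0: "density H = 0" if "subgraph H F" for H
    using that E by (auto simp: subgraph_def density_def)
  have "max_density_at v F = max_density F" if v: "v \<in> verts F" for v
  proof (cases "card (verts F) \<ge> 2")
    case True
    have FF: "subgraph F F" using F by (simp add: subgraph_def)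
    let ?S = "{density H | H. subgraph H F \<and> card (verts H) \<ge> 2}"
    let ?S' = "{density H | H. subgraph H F \<and> card (verts H) \<ge> 2 \<and> v \<in> verts H}"
    have "x = 0" if "x \<in> ?S \<union> ?S'" for x using that d0 by auto
    moreover have "density F \<in> ?S" "density F \<in> ?S'" using FF True v by blast+
    ultimately have "?S = {0}" "?S' = {0}" unfolding d0[OF FF]
      by (simp_all only: set_eq_iff singleton_iff Un_iff) blast+
    then show ?thesis by (simp add: max_density_def max_density_at_def)
  next
    case False
    have "card (verts H) < 2" if "subgraph H F" for H
      using False that card_mono[OF simple_graph_finite(1)[OF F], of "verts H"] by (auto simp: subgraph_def)
    then have "{density H | H. subgraph H F \<and> card (verts H) \<ge> 2 \<and> v \<in> verts H} = {}"
      "{density H | H. subgraph H F \<and> card (verts H) \<ge> 2} = {}" by (auto simp: not_le)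
    \<comment> \<open>Both maxima are over the empty set and have the same unspecified
      value.\<close>
    then show ?thesis by (simp only: max_density_def max_density_at_def)
  qed
  then show False using nb by (auto simp: vertex_balanced_def)
qed

lemma max_density_ge_1:
  assumes F: "simple_graph F" and nb: "\<not> vertex_balanced F"
  shows "1 \<le> max_density F"
proof -
  obtain e where e: "e \<in> edges F" using exists_edge_if_not_vertex_balanced[OF assms] by blast
  note fin = simple_graph_finite[OF F]
  have "finite e" using fin(1) fin(3)[OF e] finite_subset by blast
  then have "density (e, {e}) \<le> max_density F"
    using fin(3)[OF e] e by (intro density_le_max_density F)
      (auto simp: subgraph_def simple_graph_def all_edges_def)
  then show ?thesis using fin(3)[OF e] by (simp add: density_def)
qed

text \<open>A tight set with at least two vertices has density \<open>max_density F\<close>, so a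
  vertex whose \<open>max_density_at\<close> falls short lies in no such set.\<close>

lemma ex_trivial_tight_hull:
  assumes F: "simple_graph F" and nb: "\<not> vertex_balanced F"
  shows "\<exists>v\<in>verts F. tight_hull F v = {v}"
proof -
  obtain v where v: "v \<in> verts F" "max_density_at v F \<noteq> max_density F"
    using nb by (auto simp: vertex_balanced_def)
  have "U = {v}" if U: "tight F U" "v \<in> U" for U
  proof (rule ccontr)
    assume ne: "U \<noteq> {v}"
    let ?S = "{density H | H. subgraph H F \<and> card (verts H) \<ge> 2 \<and> v \<in> verts H}"
    have fU: "finite U" "U \<subseteq> verts F"
      using U simple_graph_finite(1)[OF F] by (auto simp: tight_def intro: finite_subset)
    have c: "card U \<ge> 2"
    proof (rule ccontr)
      assume "\<not> 2 \<le> card U"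
      then have "card U \<le> Suc 0" by simp
      then show False using U ne fU by (auto simp: card_le_Suc0_iff_eq)
    qed
    have d: "density (U, edges_in F U) = max_density F"
      using U c by (simp add: density_def tight_def)
    have "density (U, edges_in F U) \<in> ?S"
      using subgraph_edges_in[OF F fU(2)] c U by force
    moreover have "finite ?S" by (rule finite_subset[OF _ finite_densities[OF F]]) auto
    moreover have "x \<le> max_density F" if "x \<in> ?S" for x
      using that density_le_max_density[OF F] by auto
    ultimately have "max_density_at v F = max_density F"
      unfolding max_density_at_def using d by (intro Max_eqI) auto
    then show False using v by simp
  qed
  then have "tight_hull F v = {v}"
    using tight_hull(1,2)[OF F v(1)] by blast
  then show ?thesis using v by blast
qed

text \<open>Only finitely many \<open>U\<close> occur, so the strict inequalities of
  \<open>card_cross_edges\<close> leave a uniform gap below \<open>max_density F\<close>. This gap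
  drives the second exposure.\<close>

lemma ex_cross_density:
  assumes F: "simple_graph F" and nb: "\<not> vertex_balanced F"
  shows "\<exists>D>0. D < max_density F \<and> (\<forall>U. U \<subseteq> tight_hull F ` verts F \<longrightarrow> U \<noteq> {} \<longrightarrow>
    real (card {e \<in> edges F. inj_on (tight_hull F) e \<and> tight_hull F ` e \<subseteq> U}) \<le> D * (real (card U) - 1))"
proof -
  let ?X = "\<lambda>U. {e \<in> edges F. inj_on (tight_hull F) e \<and> tight_hull F ` e \<subseteq> U}"
  define \<U> where "\<U> = {U. U \<subseteq> tight_hull F ` verts F \<and> card U \<ge> 2}"
  \<comment> \<open>The entry \<open>1 / 2\<close> makes the maximum well defined and positive, and
    it stays below \<open>max_density F\<close>, which is at least 1.\<close>
  define D where "D = Max (insert (1 / 2) ((\<lambda>U. real (card (?X U)) / (real (card U) - 1)) ` \<U>))"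
  have fin\<U>: "finite \<U>" unfolding \<U>_def using simple_graph_finite(1)[OF F] by auto
  have "1 / 2 \<le> D" unfolding D_def using fin\<U> by (intro Max_ge) auto
  then have D0: "0 < D" by simp
  have 1: "D < max_density F"
    unfolding D_def using fin\<U> max_density_ge_1[OF assms]
  proof (subst Max_less_iff, simp, simp, intro ballI)
    fix x assume "x \<in> insert (1 / 2) ((\<lambda>U. real (card (?X U)) / (real (card U) - 1)) ` \<U>)"
    then consider "x = 1 / 2" | U where "U \<in> \<U>" "x = real (card (?X U)) / (real (card U) - 1)" by auto
    then show "x < max_density F"
    proof cases
      case 1
      then show ?thesis using max_density_ge_1[OF assms] by simp
    next
      case 2
      then have U: "U \<subseteq> tight_hull F ` verts F" "U \<noteq> {}" "card U \<ge> 2" by (auto simp: \<U>_def)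
      have "real (card (?X U)) / (real (card U) - 1) < max_density F"
        using card_cross_edges(2)[OF F U] U(3) by (simp add: divide_less_eq)
      then show ?thesis using 2 by simp
    qed
  qed
  have 2: "real (card (?X U)) \<le> D * (real (card U) - 1)" if U: "U \<subseteq> tight_hull F ` verts F" "U \<noteq> {}" for U
  proof (cases "card U \<ge> 2")
    case True
    then have "real (card (?X U)) / (real (card U) - 1) \<le> D"
      unfolding D_def using fin\<U> U by (intro Max_ge) (auto simp: \<U>_def)
    then show ?thesis using True by (simp add: field_simps)
  next
    case False
    have "finite U" using U simple_graph_finite(1)[OF F] finite_surj by blast
    then have "card U = 1" using False U by (metis One_nat_def Suc_leI card_gt_0_iff le_antisym not_less_eq_eq numeral_2_eq_2)
    then show ?thesis using card_cross_edges(1)[OF F U] by simp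
  qed
  show ?thesis using D0 1 2 by blast
qed

subsection \<open>Factors in a single block\<close>

lemma has_factor_mono:
  assumes "has_factor F (B, W)" "W \<subseteq> W'"
  shows "has_factor F (B, W')"
proof -
  have "subgraph H (B, W')" if "subgraph H (B, W)" for H
    using that assms(2) by (auto simp: subgraph_def)
  moreover obtain \<C> where "finite \<C>" "card \<C> * card (verts F) = card B"
    "\<forall>H\<in>\<C>. subgraph H (B, W) \<and> isomorphic F H"
    "\<forall>H\<in>\<C>. \<forall>H'\<in>\<C>. H \<noteq> H' \<longrightarrow> verts H \<inter> verts H' = {}"
    using assms(1) by (auto simp: has_factor_def)
  ultimately show ?thesis unfolding has_factor_def by (intro exI[of _ \<C>]) simp
qed

text \<open>\<open>\<Psi> (u, c)\<close> is the vertex that plays the role of \<open>u\<close> in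
  copy \<open>c\<close>.\<close>

lemma has_factorI:
  fixes N :: nat
  assumes F: "simple_graph F" and V: "verts F \<noteq> {}"
    and \<Psi>: "bij_betw \<Psi> (verts F \<times> {..<N}) B"
    and edge: "\<And>e c. e \<in> edges F \<Longrightarrow> c < N \<Longrightarrow> (\<lambda>u. \<Psi> (u, c)) ` e \<in> W"
  shows "has_factor F (B, W)"
proof -
  note fin = simple_graph_finite[OF F]
  define H where "H c = ((\<lambda>u. \<Psi> (u, c)) ` verts F, (\<lambda>e. (\<lambda>u. \<Psi> (u, c)) ` e) ` edges F)" for c
  have inj: "inj_on \<Psi> (verts F \<times> {..<N})" using \<Psi> by (auto simp: bij_betw_def)
  have injc: "inj_on (\<lambda>u. \<Psi> (u, c)) (verts F)" if "c < N" for c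
    using inj that by (auto simp: inj_on_def)
  have disj: "verts (H c) \<inter> verts (H c') = {}" if "c < N" "c' < N" "c \<noteq> c'" for c c'
    using inj that by (auto simp: H_def inj_on_def)
  have "H c \<noteq> H c'" if "c < N" "c' < N" "c \<noteq> c'" for c c'
    using disj[OF that] V by (auto simp: H_def)
  then have "inj_on H {..<N}" by (auto simp: inj_on_def)
  then have "card (H ` {..<N}) = N" by (simp add: card_image)
  moreover have "card B = card (verts F) * N"
    using bij_betw_same_card[OF \<Psi>] by (simp add: card_cartesian_product)
  moreover have "subgraph (H c) (B, W) \<and> isomorphic F (H c)" if c: "c < N" for c
  proof
    have "card ((\<lambda>u. \<Psi> (u, c)) ` e) = 2" if "e \<in> edges F" for e
      using fin(3)[OF that] card_image[OF inj_on_subset[OF injc[OF c]], of e] by simp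
    moreover have "(\<lambda>u. \<Psi> (u, c)) ` verts F \<subseteq> B" using \<Psi> c by (auto simp: bij_betw_def)
    moreover have "(\<lambda>u. \<Psi> (u, c)) ` e \<subseteq> (\<lambda>u. \<Psi> (u, c)) ` verts F" if "e \<in> edges F" for e
      using fin(3)[OF that] by (intro image_mono) simp
    ultimately show "subgraph (H c) (B, W)"
      using fin(1,2) c edge by (fastforce simp: subgraph_def simple_graph_def all_edges_def H_def)
    show "isomorphic F (H c)" unfolding isomorphic_def
      using injc[OF c] by (intro exI[of _ "\<lambda>u. \<Psi> (u, c)"]) (auto simp: H_def bij_betw_def)
  qed
  ultimately show ?thesis unfolding has_factor_def
    using disj by (intro exI[of _ "H ` {..<N}"]) (auto simp: mult.commute)
qed

section \<open>Permuted copies inside a block\<close>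

lemma perm_families_permutes:
  "\<sigma> \<in> perm_families C N \<Longrightarrow> P \<in> C \<Longrightarrow> \<sigma> P permutes {..<N}"
  by (auto simp: perm_families_def)

lemma perm_families_inv_less:
  assumes "\<sigma> \<in> perm_families C N" "P \<in> C" "c < N"
  shows "inv (\<sigma> P) c < N"
  using permutes_in_image[OF permutes_inv[OF perm_families_permutes[OF assms(1,2)]], of c] assms(3) by simp

lemma perm_families_inv_inj:
  assumes "\<sigma> \<in> perm_families C N" "P \<in> C" "inv (\<sigma> P) c = inv (\<sigma> P) c'"
  shows "c = c'"
  using permutes_inj[OF permutes_inv[OF perm_families_permutes[OF assms(1,2)]]] assms(3) by (auto dest: injD)

lemma image_copy_edges_subset:
  assumes \<sigma>: "\<sigma> \<in> perm_families C N" and \<phi>: "inj_on \<phi> (V \<times> {..<N})" "\<phi> ` (V \<times> {..<N}) \<subseteq> B"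
    and E: "\<And>e. e \<in> E \<Longrightarrow> card e = 2 \<and> e \<subseteq> V \<and> \<kappa> ` e \<subseteq> C"
  shows "(`) \<phi> ` copy_edges \<kappa> E N \<sigma> \<subseteq> all_edges B"
proof
  fix x assume "x \<in> (`) \<phi> ` copy_edges \<kappa> E N \<sigma>"
  then obtain e c where ec: "e \<in> E" "c < N" "x = (\<lambda>u. \<phi> (u, inv (\<sigma> (\<kappa> u)) c)) ` e"
    by (auto simp: copy_edges_def image_image)
  have lt: "inv (\<sigma> (\<kappa> u)) c < N" if "u \<in> e" for u
    using perm_families_inv_less[OF \<sigma> _ ec(2)] E[OF ec(1)] that by auto
  have "inj_on (\<lambda>u. \<phi> (u, inv (\<sigma> (\<kappa> u)) c)) e"
  proof (rule inj_onI)
    fix u w assume "u \<in> e" "w \<in> e" "\<phi> (u, inv (\<sigma> (\<kappa> u)) c) = \<phi> (w, inv (\<sigma> (\<kappa> w)) c)"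
    then have "(u, inv (\<sigma> (\<kappa> u)) c) = (w, inv (\<sigma> (\<kappa> w)) c)"
      using E[OF ec(1)] lt by (intro inj_onD[OF \<phi>(1)]) auto
    then show "u = w" by simp
  qed
  then have "card x = 2" using ec E by (simp add: card_image)
  moreover have "x \<subseteq> B"
  proof
    fix y assume "y \<in> x"
    then obtain u where u: "u \<in> e" "y = \<phi> (u, inv (\<sigma> (\<kappa> u)) c)" using ec(3) by auto
    then have "(u, inv (\<sigma> (\<kappa> u)) c) \<in> V \<times> {..<N}" using lt E[OF ec(1)] by auto
    then show "y \<in> B" using \<phi>(2) u(2) by blast
  qed
  ultimately show "x \<in> all_edges B" by (simp add: all_edges_def)
qed

lemma card_image_copy_edges_le:
  assumes "finite E"
  shows "card ((`) \<phi> ` copy_edges \<kappa> E N \<sigma>) \<le> card E * N"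
proof -
  have "card ((`) \<phi> ` copy_edges \<kappa> E N \<sigma>) \<le> card (copy_edges \<kappa> E N \<sigma>)"
    using assms by (intro card_image_le) (simp add: copy_edges_def)
  also have "\<dots> \<le> card E * N" by (rule card_copy_edges_le[OF assms])
  finally show ?thesis .
qed

text \<open>If more copies are placed than needed and few edges are missing, then enough of the copies are
  complete; the unused vertices play the role of the label \<open>v\<close>, which lies in no edge of \<open>E\<close>.\<close>

lemma arrangement_from_few_missing:
  assumes V: "finite V" "v \<in> V" and N: "N \<le> N'"
    and B: "finite B" "card B = card V * N"
    and \<sigma>: "\<sigma> \<in> perm_families (V - {v}) N'"
    and \<phi>: "inj_on \<phi> ((V - {v}) \<times> {..<N'})" "\<phi> ` ((V - {v}) \<times> {..<N'}) \<subseteq> B"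
    and E: "finite E" "\<And>e. e \<in> E \<Longrightarrow> e \<noteq> {} \<and> e \<subseteq> V - {v}"
    and few: "card ((`) \<phi> ` copy_edges id E N' \<sigma> - W) \<le> N' - N"
  obtains \<Phi> where "bij_betw \<Phi> (V \<times> {..<N}) B"
    "\<And>e c. e \<in> E \<Longrightarrow> c < N \<Longrightarrow> (\<lambda>u. \<Phi> (u, c)) ` e \<in> W"
proof -
  define cp where "cp e c = (\<lambda>u. \<phi> (u, inv (\<sigma> u) c)) ` e" for e c
  have cp_in: "cp e c \<in> (`) \<phi> ` copy_edges id E N' \<sigma>" if "e \<in> E" "c < N'" for e c
    using that by (force simp: cp_def copy_edges_def image_image)
  have \<phi>_inj: "u = w \<and> c = c'" if "u \<in> V - {v}" "w \<in> V - {v}" "c < N'" "c' < N'"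
    "\<phi> (u, inv (\<sigma> u) c) = \<phi> (w, inv (\<sigma> w) c')" for u w c c'
  proof -
    have "(u, inv (\<sigma> u) c) = (w, inv (\<sigma> w) c')"
      using that perm_families_inv_less[OF \<sigma>] by (intro inj_onD[OF \<phi>(1)]) auto
    then show ?thesis using perm_families_inv_inj[OF \<sigma> that(1)] by auto
  qed
  define bad where "bad = {c. c < N' \<and> (\<exists>e\<in>E. cp e c \<notin> W)}"
  \<comment> \<open>The copies are vertex-disjoint, so picking one missing edge for each incomplete
    copy gives distinct missing edges.\<close>
  have "card bad \<le> card ((`) \<phi> ` copy_edges id E N' \<sigma> - W)"
  proof -
    define m where "m c = (SOME e. e \<in> E \<and> cp e c \<notin> W)" for c
    have m: "m c \<in> E" "cp (m c) c \<notin> W" if "c \<in> bad" for c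
      using someI_ex[of "\<lambda>e. e \<in> E \<and> cp e c \<notin> W"] that by (auto simp: m_def bad_def)
    show ?thesis
    proof (rule card_inj_on_le[where f = "\<lambda>c. cp (m c) c"])
      show "inj_on (\<lambda>c. cp (m c) c) bad"
      proof (rule inj_onI)
        fix c c' assume c: "c \<in> bad" "c' \<in> bad" "cp (m c) c = cp (m c') c'"
        obtain u where u: "u \<in> m c" using E(2)[OF m(1)[OF c(1)]] by blast
        then have "\<phi> (u, inv (\<sigma> u) c) \<in> cp (m c') c'" using c(3) by (auto simp: cp_def)
        then obtain w where "w \<in> m c'" "\<phi> (u, inv (\<sigma> u) c) = \<phi> (w, inv (\<sigma> w) c')"
          by (auto simp: cp_def)
        then show "c = c'" using \<phi>_inj[of u w c c'] u c E(2)[OF m(1)[OF c(1)]] E(2)[OF m(1)[OF c(2)]]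
          by (auto simp: bad_def)
      qed
      show "(\<lambda>c. cp (m c) c) ` bad \<subseteq> (`) \<phi> ` copy_edges id E N' \<sigma> - W"
      proof (rule image_subsetI)
        fix c assume c: "c \<in> bad"
        then have "c < N'" by (simp add: bad_def)
        then show "cp (m c) c \<in> (`) \<phi> ` copy_edges id E N' \<sigma> - W"
          using cp_in m(2)[OF c] m(1)[OF c] by blast
      qed
      show "finite ((`) \<phi> ` copy_edges id E N' \<sigma> - W)" using E(1) by (simp add: copy_edges_def)
    qed
  qed
  then have "card bad \<le> N' - N" using few by simp
  moreover have "bad \<subseteq> {..<N'}" by (auto simp: bad_def)
  ultimately have "N \<le> card ({..<N'} - bad)"
    using N by (subst card_Diff_subset) (auto intro: finite_subset)
  then obtain G where G: "G \<subseteq> {..<N'} - bad" "card G = N" "finite G"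
    by (meson obtain_subset_with_card_n)
  then obtain g where g: "bij_betw g {..<N} G"
    using ex_bij_betw_nat_finite[OF G(3)] by (auto simp: atLeast0LessThan)
  have gG: "g c \<in> {..<N'} - bad" if "c < N" for c
    using g G(1) that by (auto simp: bij_betw_def)
  have ginj: "g c = g c' \<Longrightarrow> c = c'" if "c < N" "c' < N" for c c'
    using g that by (auto simp: bij_betw_def inj_on_def)
  define \<Phi>0 where "\<Phi>0 = (\<lambda>(u, c). \<phi> (u, inv (\<sigma> u) (g c)))"
  have inj0: "inj_on \<Phi>0 ((V - {v}) \<times> {..<N})"
  proof (rule inj_onI)
    fix x y assume xy: "x \<in> (V - {v}) \<times> {..<N}" "y \<in> (V - {v}) \<times> {..<N}" "\<Phi>0 x = \<Phi>0 y"
    then show "x = y"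
      using \<phi>_inj[of "fst x" "fst y" "g (snd x)" "g (snd y)"] gG ginj[of "snd x" "snd y"]
      by (auto simp: \<Phi>0_def case_prod_unfold prod_eq_iff)
  qed
  have img0: "\<Phi>0 ` ((V - {v}) \<times> {..<N}) \<subseteq> B"
  proof (rule image_subsetI)
    fix x assume "x \<in> (V - {v}) \<times> {..<N}"
    then have "(fst x, inv (\<sigma> (fst x)) (g (snd x))) \<in> (V - {v}) \<times> {..<N'}"
      using gG perm_families_inv_less[OF \<sigma>] by auto
    then show "\<Phi>0 x \<in> B" using \<phi>(2) by (auto simp: \<Phi>0_def case_prod_unfold)
  qed
  define Rst where "Rst = B - \<Phi>0 ` ((V - {v}) \<times> {..<N})"
  have "card (\<Phi>0 ` ((V - {v}) \<times> {..<N})) = (card V - 1) * N"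
    using card_image[OF inj0] V by (simp add: card_cartesian_product)
  then have "card Rst = card V * N - (card V - 1) * N"
    unfolding Rst_def using card_Diff_subset[OF finite_subset[OF img0 B(1)] img0] B(2) by simp
  also have "\<dots> = N"
  proof -
    have "card V > 0" using V by (auto simp: card_gt_0_iff)
    then have "card V * N = (card V - 1) * N + N" by (cases "card V") auto
    then show ?thesis by simp
  qed
  finally obtain r where r: "bij_betw r {..<N} Rst"
    using ex_bij_betw_nat_finite[of Rst] B(1) by (auto simp: atLeast0LessThan Rst_def)
  define \<Phi> where "\<Phi> = (\<lambda>(u, c). if u = v then r c else \<Phi>0 (u, c))"
  have b1: "bij_betw \<Phi> ((V - {v}) \<times> {..<N}) (\<Phi>0 ` ((V - {v}) \<times> {..<N}))"
  proof -
    have "bij_betw \<Phi>0 ((V - {v}) \<times> {..<N}) (\<Phi>0 ` ((V - {v}) \<times> {..<N}))"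
      using inj0 by (simp add: bij_betw_def)
    then show ?thesis by (rule bij_betw_cong[THEN iffD1, rotated]) (auto simp: \<Phi>_def split: if_splits)
  qed
  have b2: "bij_betw \<Phi> ({v} \<times> {..<N}) Rst"
  proof -
    have "bij_betw (r \<circ> snd) ({v} \<times> {..<N}) Rst"
      by (rule bij_betw_trans[OF _ r]) (auto simp: bij_betw_def inj_on_def image_def)
    then show ?thesis by (rule bij_betw_cong[THEN iffD1, rotated]) (auto simp: \<Phi>_def)
  qed
  have "bij_betw \<Phi> ((V - {v}) \<times> {..<N} \<union> {v} \<times> {..<N}) (\<Phi>0 ` ((V - {v}) \<times> {..<N}) \<union> Rst)"
    by (rule bij_betw_combine[OF b1 b2]) (auto simp: Rst_def)
  moreover have "(V - {v}) \<times> {..<N} \<union> {v} \<times> {..<N} = V \<times> {..<N}" using V by auto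
  moreover have "\<Phi>0 ` ((V - {v}) \<times> {..<N}) \<union> Rst = B" using img0 by (auto simp: Rst_def)
  ultimately have "bij_betw \<Phi> (V \<times> {..<N}) B" by simp
  moreover have "(\<lambda>u. \<Phi> (u, c)) ` e \<in> W" if "e \<in> E" "c < N" for e c
  proof -
    have "(\<lambda>u. \<Phi> (u, c)) ` e = cp e (g c)"
      unfolding cp_def using E(2)[OF that(1)] by (intro image_cong) (auto simp: \<Phi>_def \<Phi>0_def)
    then show ?thesis using gG[OF that(2)] that by (auto simp: bad_def)
  qed
  ultimately show ?thesis by (rule that)
qed

text \<open>The first exposure, with \<open>\<kappa> = id\<close> on the vertices other than
  \<open>v\<close>. The permitted number of missing edges is the surplus \<open>N div h\<close>,
  which is linear in \<open>N\<close>, while the placements have at most a constant times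
  \<open>N\<close> edges. A single round with ratio 1/2 therefore suffices once \<open>p\<close>
  times the spread parameter exceeds a constant, and it fails with exponentially small
  probability.\<close>

lemma arrangement_prob:
  fixes B :: "'v set"
  assumes F: "simple_graph F" and v: "v \<in> verts F" and E1: "E \<subseteq> edges F" "\<And>e. e \<in> E \<Longrightarrow> v \<notin> e"
    and E0: "edges F \<noteq> {}" and d: "1 \<le> max_density F"
    and N: "card (verts F) \<le> N" "exp 2 \<le> real N"
    and B: "finite B" "card B = card (verts F) * N" and X: "finite X" "all_edges B \<subseteq> X"
    and p: "16 * exp 3 * real (card (verts F)) * real (card (edges F)) * real N powr (- 1 / max_density F) \<le> p" "p \<le> 1"
  shows "rs_expect p X (\<lambda>W. of_bool (\<not> (\<exists>\<Phi>. bij_betw \<Phi> (verts F \<times> {..<N}) B \<and>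
    (\<forall>e\<in>E. \<forall>c<N. (\<lambda>u. \<Phi> (u, c)) ` e \<in> W)))) \<le> 2 * (1 / 2) powr (real N / real (card (verts F)))"
proof -
  note fin = simple_graph_finite[OF F]
  let ?V = "verts F" and ?h = "card (verts F)" and ?d = "max_density F"
  let ?good = "\<lambda>W. \<exists>\<Phi>. bij_betw \<Phi> (?V \<times> {..<N}) B \<and> (\<forall>e\<in>E. \<forall>c<N. (\<lambda>u. \<Phi> (u, c)) ` e \<in> W)"
  \<comment> \<open>The surplus copies fit because
    \<open>(h - 1) * (N + N div h) \<le> h * N\<close>: each copy leaves out
    \<open>v\<close>.\<close>
  define N' where "N' = N + N div ?h"
  define C where "C = ?V - {v}"
  have h: "?h > 0" using v fin by (auto simp: card_gt_0_iff)
  have finC: "finite C" using fin by (simp add: C_def)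
  have finE: "finite E" using E1 fin finite_subset by blast
  have N0: "N > 0" using N(2) by (intro gr0I) auto
  have Nh: "N div ?h > 0" using N h by (simp add: div_greater_zero_iff)
  have N'1: "real N \<le> real N'" "real N' \<le> 2 * real N" "N \<le> N'"
    using div_le_dividend[of N ?h] unfolding N'_def by linarith+
  have "card (C \<times> {..<N'}) \<le> card B"
  proof -
    have "(?h - 1) * (N + N div ?h) \<le> ?h * N"
    proof -
      obtain k where k: "?h = Suc k" using h by (cases ?h) auto
      have "k * (N div ?h) \<le> ?h * (N div ?h)" using k by simp
      also have "\<dots> \<le> N" by simp
      finally show ?thesis using k by (simp add: algebra_simps)
    qed
    then show ?thesis using v fin B by (simp add: C_def N'_def card_cartesian_product)
  qed
  then obtain \<phi> where \<phi>: "\<phi> ` (C \<times> {..<N'}) \<subseteq> B" "inj_on \<phi> (C \<times> {..<N'})"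
    using card_le_inj[of "C \<times> {..<N'}" B] finC B by auto
  have E2: "card e = 2 \<and> inj_on id e \<and> id ` e \<subseteq> C \<and> e \<subseteq> C" if "e \<in> E" for e
    using fin(3)[of e] E1 that by (auto simp: C_def)
  have dens: "real (card {e \<in> E. id ` e \<subseteq> U}) \<le> ?d * (real (card U) - 1)" if U: "U \<subseteq> C" "U \<noteq> {}" for U
  proof -
    have "card {e \<in> E. id ` e \<subseteq> U} \<le> card (edges_in F U)"
      using fin E1 by (intro card_mono) (auto simp: edges_in_def)
    moreover have "U \<subseteq> ?V" using U by (auto simp: C_def)
    ultimately show ?thesis using card_edges_in_le[OF F, of U] U(2) by linarith
  qed
  let ?I = "perm_families C N'" and ?R = "(real N' / exp 2) powr (1 / ?d)"
  let ?\<mu> = "\<lambda>_ :: 'a \<Rightarrow> nat \<Rightarrow> nat. 1 / real (card ?I)"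
  let ?S = "\<lambda>\<sigma>. (`) \<phi> ` copy_edges id E N' \<sigma>"
  have N'e: "N' > 0" "exp 2 \<le> real N'" using N'1 N N0 by auto
  have spread: "spread ?R ?I ?\<mu> ?S"
    using d dens by (intro spread_copy_edges[where V = C] finC N'e finE E2 \<phi>) auto
  have finI: "finite ?I" by (rule finite_perm_families[OF finC])
  have cI: "card ?I > 0" using finC by (simp add: card_perm_families)
  have SX: "?S \<sigma> \<subseteq> X" if "\<sigma> \<in> ?I" for \<sigma>
    using image_copy_edges_subset[OF that \<phi>(2,1), where E = E and \<kappa> = id] E2 X(2) by auto
  define L where "L = real (card (edges F)) * real N'"
  define L' where "L' = real (N div ?h)"
  have m: "card (edges F) > 0" using E0 fin by (simp add: card_gt_0_iff)
  have SL: "real (card (?S \<sigma>)) \<le> L" for \<sigma>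
  proof -
    have "card (?S \<sigma>) \<le> card E * N'" by (rule card_image_copy_edges_le[OF finE])
    also have "\<dots> \<le> card (edges F) * N'" using E1 fin by (intro mult_right_mono card_mono) auto
    finally show ?thesis unfolding L_def by (metis of_nat_le_iff of_nat_mult)
  qed
  have L: "0 < L" "0 < L'" using m N'e Nh by (auto simp: L_def L'_def)
  have Npos: "real N powr (- 1 / ?d) > 0" using N0 by simp
  have hE: "1 \<le> real ?h" "1 \<le> real (card (edges F))" using h m by linarith+
  have p0: "0 < p" using p(1) Npos hE
    by (smt (verit, best) exp_gt_zero mult_pos_pos)
  have R0: "0 < ?R" using N'e by simp
  \<comment> \<open>The \<open>exp 3\<close> of the hypothesis is \<open>exp 1\<close> from the
    fragment bound times \<open>exp 2\<close> from \<open>?R\<close>; \<open>1 \<le> ?d\<close>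
    allows \<open>exp (2 / ?d)\<close> to be replaced by \<open>exp 2\<close>.\<close>
  have pR: "16 * exp 1 * real ?h * real (card (edges F)) \<le> p * ?R"
  proof -
    have "1 * exp (-2) \<le> real N powr (- 1 / ?d) * (real N powr (1 / ?d) * exp (- 2 / ?d))"
      using N0 d by (simp add: powr_minus powr_minus_divide mult.assoc[symmetric] powr_add[symmetric] field_simps)
    also have "\<dots> \<le> real N powr (- 1 / ?d) * ?R"
    proof (rule mult_left_mono)
      have "exp 2 powr (1 / ?d) = exp (2 / ?d)" by (simp add: powr_def)
      then have "(real N / exp 2) powr (1 / ?d) = real N powr (1 / ?d) / exp (2 / ?d)"
        using powr_divide[of "real N" "exp 2" "1 / ?d"] by simp
      moreover have "exp (- 2 / ?d) = 1 / exp (2 / ?d)" by (simp add: exp_minus inverse_eq_divide)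
      ultimately have "real N powr (1 / ?d) * exp (- 2 / ?d) = (real N / exp 2) powr (1 / ?d)" by simp
      also have "\<dots> \<le> ?R" using N'1 d N0 by (intro powr_mono2 divide_right_mono) auto
      finally show "real N powr (1 / ?d) * exp (- 2 / ?d) \<le> ?R" .
    qed simp
    finally have 1: "exp (-2) \<le> real N powr (- 1 / ?d) * ?R" by simp
    have "16 * exp 1 * real ?h * real (card (edges F)) = 16 * exp 3 * real ?h * real (card (edges F)) * exp (-2)"
      by (simp add: exp_add[symmetric])
    also have "\<dots> \<le> 16 * exp 3 * real ?h * real (card (edges F)) * (real N powr (- 1 / ?d) * ?R)"
      using 1 by (intro mult_left_mono) auto
    also have "\<dots> \<le> p * ?R"
      unfolding mult.assoc[symmetric] using p(1) R0 by (intro mult_right_mono) auto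
    finally show ?thesis .
  qed
  have \<theta>: "exp 1 * L / (L' * (p * ?R)) \<le> 1 / 2"
  proof -
    have LL: "L \<le> 4 * real ?h * real (card (edges F)) * L'"
    proof -
      have "N < ?h * (N div ?h) + ?h" using h by (metis mod_less_divisor mult_div_mod_eq nat_add_left_cancel_less)
      also have "?h * (N div ?h) + ?h \<le> 2 * (?h * (N div ?h))" using Nh by simp
      finally have "N \<le> 2 * (?h * (N div ?h))" by simp
      then have "real N \<le> 2 * real ?h * L'" unfolding L'_def by (metis mult.assoc of_nat_le_iff of_nat_mult of_nat_numeral)
      then have "real N' \<le> 4 * real ?h * L'" using N'1 by linarith
      then have "L \<le> real (card (edges F)) * (4 * real ?h * L')"
        unfolding L_def by (intro mult_left_mono) auto
      then show ?thesis by (simp add: mult_ac)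
    qed
    have "2 * exp 1 * L \<le> 2 * exp 1 * (4 * real ?h * real (card (edges F)) * L')"
      using LL by (intro mult_left_mono) auto
    also have "\<dots> \<le> L' * (16 * exp 1 * real ?h * real (card (edges F)))" using L by simp
    also have "\<dots> \<le> L' * (p * ?R)" using pR L by (intro mult_left_mono) auto
    finally show ?thesis using L p0 R0 by (simp add: field_simps)
  qed
  obtain T where T: "\<And>W s. s \<in> ?I \<Longrightarrow> \<exists>s'\<in>?I. T W s = ?S s' - W"
    and tail: "rs_expect p X (\<lambda>W. \<Sum>s | s \<in> ?I \<and> L' < real (card (T W s)). ?\<mu> s)
      \<le> 2 * (1 / 2) ^ Suc (nat \<lfloor>L'\<rfloor>)"
    by (rule minimal_fragments_tail[OF X(1) finI SX SL _ spread p0 p(2) R0 L \<theta>]) auto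
  have "rs_expect p X (\<lambda>W. of_bool (\<not> ?good W))
      \<le> rs_expect p X (\<lambda>W. \<Sum>s | s \<in> ?I \<and> L' < real (card (T W s)). ?\<mu> s)"
  proof (rule rs_expect_mono)
    fix W
    show "of_bool (\<not> ?good W) \<le> (\<Sum>s | s \<in> ?I \<and> L' < real (card (T W s)). ?\<mu> s)"
    proof (cases "?good W")
      case True
      then show ?thesis by (simp add: sum_nonneg)
    next
      case False
      \<comment> \<open>Without an arrangement the fragment of every placement exceeds the surplus,
        so the weights in the sum add up to the full mass 1 and dominate the indicator.\<close>
      have "L' < real (card (T W s))" if s: "s \<in> ?I" for s
      proof (rule ccontr)
        assume nl: "\<not> L' < real (card (T W s))"
        obtain \<sigma> where \<sigma>: "\<sigma> \<in> ?I" "T W s = ?S \<sigma> - W" using T[OF s] by blast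
        then have few: "card (?S \<sigma> - W) \<le> N' - N" using nl by (simp add: L'_def N'_def)
        show False
        proof (rule arrangement_from_few_missing[OF fin(1) v N'1(3) B _ _ _ finE _ few])
          show "\<sigma> \<in> perm_families (?V - {v}) N'" using \<sigma> by (simp add: C_def)
          show "inj_on \<phi> ((?V - {v}) \<times> {..<N'})" "\<phi> ` ((?V - {v}) \<times> {..<N'}) \<subseteq> B"
            using \<phi> by (simp_all add: C_def)
          show "e \<noteq> {} \<and> e \<subseteq> ?V - {v}" if "e \<in> E" for e using E2[OF that] by (auto simp: C_def)
        qed (use False in blast)
      qed
      then have "{s. s \<in> ?I \<and> L' < real (card (T W s))} = ?I" by blast
      then show ?thesis using cI by simp
    qed
  qed (use p p0 in auto)
  also have "\<dots> \<le> 2 * (1 / 2) ^ Suc (N div ?h)" using tail by (simp add: L'_def)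
  also have "\<dots> \<le> 2 * (1 / 2) powr (real N / real ?h)"
  proof -
    have "real N / real ?h \<le> real (Suc (N div ?h))"
    proof -
      have "N < ?h * (N div ?h) + ?h"
        using h by (metis mod_less_divisor mult_div_mod_eq nat_add_left_cancel_less)
      then have "N \<le> Suc (N div ?h) * ?h" by (simp add: mult.commute)
      then have "real N \<le> real (Suc (N div ?h)) * real ?h" by (metis of_nat_le_iff of_nat_mult)
      then show ?thesis using h by (simp add: divide_le_eq)
    qed
    then have "(1 / 2) powr real (Suc (N div ?h)) \<le> (1 / 2 :: real) powr (real N / real ?h)"
      by (intro powr_mono') auto
    then show ?thesis by (simp only: powr_realpow[of "1/2"])
  qed
  finally show ?thesis .
qed

text \<open>An edge with both ends in a class \<open>P\<close> is moved by one permutation, so in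
  copy \<open>c\<close> it becomes the corresponding edge of copy \<open>inv (\<sigma> P) c\<close>
  of the arrangement. Renumbering keeps the inner copies intact and changes only how they are
  combined.\<close>

lemma has_factor_if_copy_edges_subset:
  assumes F: "simple_graph F" and V: "verts F \<noteq> {}"
    and \<Phi>: "bij_betw \<Phi> (verts F \<times> {..<N}) B"
    and \<sigma>: "\<sigma> \<in> perm_families (\<kappa> ` verts F) N"
    and inner: "\<And>e c. e \<in> edges F \<Longrightarrow> \<not> inj_on \<kappa> e \<Longrightarrow> c < N \<Longrightarrow> (\<lambda>u. \<Phi> (u, c)) ` e \<in> W"
    and cross: "(`) \<Phi> ` copy_edges \<kappa> {e \<in> edges F. inj_on \<kappa> e} N \<sigma> \<subseteq> W"
  shows "has_factor F (B, W)"
proof (rule has_factorI[OF F V])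
  define \<Psi> where "\<Psi> = (\<lambda>(u, c). \<Phi> (u, inv (\<sigma> (\<kappa> u)) c))"
  have perm: "inv (\<sigma> (\<kappa> u)) permutes {..<N}" if "u \<in> verts F" for u
    using perm_families_permutes[OF \<sigma>] that by (intro permutes_inv) auto
  have "bij_betw (\<lambda>(u, c). (u, inv (\<sigma> (\<kappa> u)) c)) (verts F \<times> {..<N}) (verts F \<times> {..<N})"
  proof (rule bij_betw_byWitness[where f' = "\<lambda>(u, c). (u, \<sigma> (\<kappa> u) c)"])
    have p: "\<sigma> (\<kappa> u) permutes {..<N}" if "u \<in> verts F" for u
      using perm_families_permutes[OF \<sigma>] that by auto
    show "\<forall>x\<in>verts F \<times> {..<N}. (\<lambda>(u, c). (u, \<sigma> (\<kappa> u) c)) ((\<lambda>(u, c). (u, inv (\<sigma> (\<kappa> u)) c)) x) = x"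
      "\<forall>x\<in>verts F \<times> {..<N}. (\<lambda>(u, c). (u, inv (\<sigma> (\<kappa> u)) c)) ((\<lambda>(u, c). (u, \<sigma> (\<kappa> u) c)) x) = x"
      using permutes_inverses[OF p] by auto
    show "(\<lambda>(u, c). (u, inv (\<sigma> (\<kappa> u)) c)) ` (verts F \<times> {..<N}) \<subseteq> verts F \<times> {..<N}"
      using permutes_in_image[OF perm] by auto
    show "(\<lambda>(u, c). (u, \<sigma> (\<kappa> u) c)) ` (verts F \<times> {..<N}) \<subseteq> verts F \<times> {..<N}"
      using permutes_in_image[OF p] by auto
  qed
  then have "bij_betw (\<Phi> \<circ> (\<lambda>(u, c). (u, inv (\<sigma> (\<kappa> u)) c))) (verts F \<times> {..<N}) B"
    by (rule bij_betw_trans[OF _ \<Phi>])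
  also have "\<Phi> \<circ> (\<lambda>(u, c). (u, inv (\<sigma> (\<kappa> u)) c)) = \<Psi>" by (auto simp: \<Psi>_def)
  finally show "bij_betw \<Psi> (verts F \<times> {..<N}) B" .
  fix e c assume e: "e \<in> edges F" and c: "c < N"
  show "(\<lambda>u. \<Psi> (u, c)) ` e \<in> W"
  proof (cases "inj_on \<kappa> e")
    case True
    then have "(\<lambda>u. \<Psi> (u, c)) ` e \<in> (`) \<Phi> ` copy_edges \<kappa> {e \<in> edges F. inj_on \<kappa> e} N \<sigma>"
      using e c unfolding copy_edges_def image_image
      by (intro image_eqI[of _ _ "(e, c)"]) (auto simp: \<Psi>_def image_image)
    then show ?thesis using cross by blast
  next
    case False
    obtain u w where uw: "e = {u, w}" using simple_graph_finite(3)[OF F e] by (auto simp: card_2_iff)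
    have eq: "\<kappa> w = \<kappa> u" using False uw by (auto simp: inj_on_def)
    have u: "u \<in> verts F" using simple_graph_finite(3)[OF F e] uw by auto
    have "inv (\<sigma> (\<kappa> u)) c < N" using permutes_in_image[OF perm[OF u], of c] c by simp
    from inner[OF e False this] show ?thesis using uw eq by (simp add: \<Psi>_def)
  qed
qed

text \<open>The second exposure, for an arrangement \<open>\<Phi>\<close> that is already fixed. The
  weights sum to 1, so only the term \<open>2 * r * \<theta>\<close> of \<open>spread_rounds\<close>
  remains.\<close>

lemma cross_edges_prob:
  fixes B :: "'v set"
  assumes F: "simple_graph F" and E0: "edges F \<noteq> {}"
    and D: "0 < D" "\<And>U. U \<subseteq> \<kappa> ` verts F \<Longrightarrow> U \<noteq> {} \<Longrightarrow>
      real (card {e \<in> edges F. inj_on \<kappa> e \<and> \<kappa> ` e \<subseteq> U}) \<le> D * (real (card U) - 1)"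
    and \<Phi>: "bij_betw \<Phi> (verts F \<times> {..<N}) B"
    and N: "exp 2 \<le> real N"
    and X: "finite X" "all_edges B \<subseteq> X"
    and p: "0 < p" "real r * p \<le> 1" and q: "0 < q"
    and \<theta>: "exp 1 * q / (p * (real N / exp 2) powr (1 / D)) \<le> \<theta>" "\<theta> \<le> 1 / 2"
    and L: "real (card (edges F) * N) < q ^ r"
  shows "rs_expect (real r * p) X (\<lambda>W. of_bool (\<not> (\<exists>\<sigma>\<in>perm_families (\<kappa> ` verts F) N.
    (`) \<Phi> ` copy_edges \<kappa> {e \<in> edges F. inj_on \<kappa> e} N \<sigma> \<subseteq> W))) \<le> 2 * real r * \<theta>"
proof -
  note fin = simple_graph_finite[OF F]
  let ?C = "\<kappa> ` verts F" and ?E = "{e \<in> edges F. inj_on \<kappa> e}"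
  let ?I = "perm_families ?C N" and ?R = "(real N / exp 2) powr (1 / D)"
  let ?S = "\<lambda>\<sigma>. (`) \<Phi> ` copy_edges \<kappa> ?E N \<sigma>"
  have N0: "N > 0" using N by (intro gr0I) auto
  have finC: "finite ?C" and finE: "finite ?E" using fin by auto
  have E2: "card e = 2 \<and> inj_on \<kappa> e \<and> \<kappa> ` e \<subseteq> ?C \<and> e \<subseteq> verts F" if "e \<in> ?E" for e
    using fin(3)[of e] that by auto
  have inj: "inj_on \<Phi> (verts F \<times> {..<N})" and img: "\<Phi> ` (verts F \<times> {..<N}) \<subseteq> B"
    using \<Phi> by (auto simp: bij_betw_def)
  have spread: "spread ?R ?I (\<lambda>_. 1 / real (card ?I)) ?S"
    using D(2) by (intro spread_copy_edges[OF finC N0 N finE E2 D(1) _ inj]) (auto simp: conj_assoc)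
  have SX: "?S \<sigma> \<subseteq> X" if "\<sigma> \<in> ?I" for \<sigma>
  proof -
    have "?S \<sigma> \<subseteq> all_edges B"
      by (rule image_copy_edges_subset[OF that inj img]) (use E2 in blast)
    then show ?thesis using X(2) by (rule subset_trans)
  qed
  have SL: "real (card (?S \<sigma>)) \<le> real (card (edges F) * N)" for \<sigma>
  proof -
    have "card (?S \<sigma>) \<le> card ?E * N" by (rule card_image_copy_edges_le[OF finE])
    also have "\<dots> \<le> card (edges F) * N" using fin by (intro mult_right_mono card_mono) auto
    finally show ?thesis by (rule of_nat_mono)
  qed
  have L0: "0 < real (card (edges F) * N)" using E0 fin N0 by (simp add: card_gt_0_iff)
  have finI: "finite ?I" by (rule finite_perm_families[OF finC])
  have cI: "card ?I > 0" using finC by (simp add: card_perm_families)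
  have R0: "0 < ?R" using N0 by simp
  have "rs_expect (real r * p) X (\<lambda>W. of_bool (\<not> (\<exists>\<sigma>\<in>?I. ?S \<sigma> \<subseteq> W)))
      \<le> 1 - (\<Sum>\<sigma>\<in>?I. 1 / real (card ?I)) + 2 * real r * \<theta>"
    by (rule spread_rounds[OF X(1) p(1) R0 q \<theta> finI SX SL _ spread p(2) L0 L]) auto
  then show ?thesis using cI by simp
qed

text \<open>The gap \<open>1 / D - 1 / d = 2 * \<epsilon>\<close> makes \<open>p\<close> times the
  spread parameter at least of order \<open>N powr (2 * \<epsilon>)\<close>. Half of the gap is
  spent on shrinking the fragments by \<open>q = N powr \<epsilon>\<close> in each round, the other
  half on a failure probability of order \<open>N powr (- \<epsilon>)\<close> per round. With
  \<open>r \<ge> 2 / \<epsilon>\<close> rounds, the fewer than \<open>N * N\<close> edges shrink to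
  none.\<close>

lemma factor_prob_aux:
  assumes F: "simple_graph F" and nb: "\<not> vertex_balanced F"
  obtains K c \<epsilon> :: real and N0 :: nat where "0 < K" "0 < c" "0 < \<epsilon>"
    "\<And>(N :: nat) p (B :: 'v set) X. N0 \<le> N \<Longrightarrow> finite B \<Longrightarrow> card B = card (verts F) * N \<Longrightarrow>
      finite X \<Longrightarrow> all_edges B \<subseteq> X \<Longrightarrow> K * real N powr (- 1 / max_density F) \<le> p \<Longrightarrow> p \<le> 1 \<Longrightarrow>
      rs_expect p X (\<lambda>W. of_bool (\<not> has_factor F (B, W))) \<le> c * real N powr (- \<epsilon>)"
proof -
  note fin = simple_graph_finite[OF F]
  let ?\<kappa> = "tight_hull F" and ?V = "verts F" and ?d = "max_density F" and ?h = "card (verts F)"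
  have E0: "edges F \<noteq> {}" by (rule exists_edge_if_not_vertex_balanced[OF F nb])
  have d: "1 \<le> ?d" by (rule max_density_ge_1[OF F nb])
  obtain v where v: "v \<in> ?V" "?\<kappa> v = {v}" using ex_trivial_tight_hull[OF F nb] by blast
  obtain D where D: "0 < D" "D < ?d" "\<And>U. U \<subseteq> ?\<kappa> ` ?V \<Longrightarrow> U \<noteq> {} \<Longrightarrow>
      real (card {e \<in> edges F. inj_on ?\<kappa> e \<and> ?\<kappa> ` e \<subseteq> U}) \<le> D * (real (card U) - 1)"
    using ex_cross_density[OF F nb] by blast
  have V: "?V \<noteq> {}" using v by auto
  have h: "?h > 0" using v fin by (auto simp: card_gt_0_iff)
  have m: "card (edges F) > 0" using E0 fin by (simp add: card_gt_0_iff)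
  \<comment> \<open>The ends of an inner edge share a class, which therefore has two vertices and is
    not \<open>{v}\<close>.\<close>
  have v_inner: "v \<notin> e" if e: "e \<in> edges F" "\<not> inj_on ?\<kappa> e" for e
  proof
    assume "v \<in> e"
    obtain u w where uw: "e = {u, w}" "u \<noteq> w" using fin(3)[OF e(1)] by (auto simp: card_2_iff)
    have eq: "?\<kappa> w = ?\<kappa> u" using e(2) uw by (auto simp: inj_on_def)
    have "u \<in> ?\<kappa> u" "w \<in> ?\<kappa> w" using fin(3)[OF e(1)] uw by (auto intro: tight_hull(2)[OF F])
    then show False using \<open>v \<in> e\<close> uw eq v(2) by auto
  qed
  define \<epsilon> where "\<epsilon> = (1 / D - 1 / ?d) / 2"
  have \<epsilon>: "0 < \<epsilon>" using D(1,2) unfolding \<epsilon>_def by (simp add: divide_strict_left_mono)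
  define r where "r = nat \<lceil>2 / \<epsilon>\<rceil>"
  have "2 / \<epsilon> > 0" using \<epsilon> by simp
  then have r: "r > 0" "2 / \<epsilon> \<le> real r" unfolding r_def by linarith+
  have r\<epsilon>: "2 \<le> real r * \<epsilon>" using r(2) \<epsilon> by (simp add: field_simps)
  \<comment> \<open>Twice the constant of \<open>arrangement_prob\<close>, since each exposure gets
    only \<open>p / 2\<close>.\<close>
  define K where "K = 32 * exp 3 * real ?h * real (card (edges F))"
  have hE: "1 \<le> real ?h" "1 \<le> real (card (edges F))" using h m by linarith+
  have "32 * 1 * 1 * 1 \<le> K"
    unfolding K_def using hE one_le_exp_iff[of 3] by (intro mult_mono) auto
  then have K: "1 \<le> K" "0 < K" by auto
  \<comment> \<open>Collects the constants of the round error: \<open>2 * r\<close> from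
    \<open>p'\<close>, \<open>exp 1\<close> from the fragment bound and \<open>exp (2 / D)\<close>
    from the spread parameter.\<close>
  define c1 where "c1 = 2 * real r * exp 1 * exp (2 / D)"
  have c1: "0 < c1" using r by (simp add: c1_def)
  define c where "c = 2 + 2 * real r * c1"
  have c: "0 < c" using c1 r by (auto simp: c_def intro: add_pos_nonneg)
  define \<eta> where "\<eta> = ln 2 / real ?h"
  have \<eta>: "0 < \<eta>" using h by (simp add: \<eta>_def)
  have "eventually (\<lambda>N. exp (- (\<eta> * real N)) \<le> real N powr (- \<epsilon>)) at_top"
    using \<eta> \<epsilon> by real_asymp
  moreover have "exp (- (\<eta> * real N)) = (1 / 2) powr (real N / real ?h)" for N
    by (simp add: powr_def \<eta>_def ln_div mult.commute)
  ultimately have ev1: "eventually (\<lambda>N. (1 / 2) powr (real N / real ?h) \<le> real N powr (- \<epsilon>)) at_top"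
    by simp
  have ev2: "eventually (\<lambda>N. c1 * real N powr (- \<epsilon>) \<le> 1 / 2) at_top"
    using \<epsilon> by real_asymp
  obtain N1 where N1: "\<And>N. N1 \<le> N \<Longrightarrow> (1 / 2) powr (real N / real ?h) \<le> real N powr (- \<epsilon>)
      \<and> c1 * real N powr (- \<epsilon>) \<le> 1 / 2"
    using eventually_conj[OF ev1 ev2] by (auto simp: eventually_at_top_linorder)
  \<comment> \<open>\<open>8\<close> exceeds \<open>exp 2\<close>, and
    \<open>Suc (card (edges F))\<close> keeps the number of edges below
    \<open>N * N\<close>.\<close>
  define N0 where "N0 = Max {N1, ?h, 8, Suc (card (edges F))}"
  have main: "rs_expect p X (\<lambda>W. of_bool (\<not> has_factor F (B, W))) \<le> c * real N powr (- \<epsilon>)"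
    if N: "N0 \<le> N" and B: "finite B" "card B = ?h * N" and X: "finite X" "all_edges B \<subseteq> X"
      and p: "K * real N powr (- 1 / ?d) \<le> p" "p \<le> 1" for N p and B :: "'v set" and X
  proof -
    have NN: "N1 \<le> N" "?h \<le> N" "8 \<le> N" "card (edges F) < N" using N by (auto simp: N0_def)
    have "exp (2 :: real) = exp 1 ^ 2" by (simp add: exp_of_nat_mult[symmetric])
    also have "\<dots> \<le> (2.75 :: real) ^ 2" using e_less_272 by (intro power_mono) auto
    also have "\<dots> \<le> real N" using NN by (simp add: power2_eq_square)
    finally have Ne: "exp 2 \<le> real N" .
    have Npos: "0 < real N" using NN by simp
    have p0: "0 < p" using p(1) K Npos by (smt (verit) mult_pos_pos powr_gt_zero)
    let ?E = "{e \<in> edges F. \<not> inj_on ?\<kappa> e}"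
    let ?arr = "\<lambda>W. \<exists>\<Phi>. bij_betw \<Phi> (?V \<times> {..<N}) B \<and> (\<forall>e\<in>?E. \<forall>c<N. (\<lambda>u. \<Phi> (u, c)) ` e \<in> W)"
    have 1: "rs_expect (p / 2) X (\<lambda>W. of_bool (\<not> ?arr W)) \<le> 2 * real N powr (- \<epsilon>)"
    proof -
      have "rs_expect (p / 2) X (\<lambda>W. of_bool (\<not> ?arr W)) \<le> 2 * (1 / 2) powr (real N / real ?h)"
        using p v_inner NN Ne by (intro arrangement_prob[OF F v(1) _ _ E0 d _ _ B X]) (auto simp: K_def)
      then show ?thesis using N1[OF NN(1)] by linarith
    qed
    define p' where "p' = p / (2 * real r)"
    have p': "0 < p'" "real r * p' = p / 2" using p0 r by (auto simp: p'_def)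
    have pp: "0 \<le> p / 2" "p / 2 \<le> 1" using p0 p by auto
    have \<theta>: "exp 1 * real N powr \<epsilon> / (p' * (real N / exp 2) powr (1 / D)) \<le> c1 * real N powr (- \<epsilon>)"
    proof -
      have "(real N / exp 2) powr (1 / D) = real N powr (1 / D) / exp (2 / D)"
        using powr_divide[of "real N" "exp 2" "1 / D"] by (simp add: powr_def)
      moreover have "1 / D = 1 / ?d + 2 * \<epsilon>"
      proof -
        have "2 * (x / 2) = x" for x :: real by simp
        then have "2 * \<epsilon> = 1 / D - 1 / ?d" unfolding \<epsilon>_def .
        then show ?thesis by simp
      qed
      ultimately have R: "(real N / exp 2) powr (1 / D)
          = real N powr (1 / ?d) * (real N powr \<epsilon> * real N powr \<epsilon>) / exp (2 / D)"
        by (simp add: powr_add[symmetric])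
      have "1 * real N powr (- 1 / ?d) \<le> p" using p(1) K
        by (meson mult_right_mono order_trans powr_ge_zero)
      then have "real N powr (- 1 / ?d) * real N powr (1 / ?d) \<le> p * real N powr (1 / ?d)"
        by (intro mult_right_mono) auto
      then have P: "1 \<le> p * real N powr (1 / ?d)" using Npos by (simp add: powr_add[symmetric])
      have "exp 1 * real N powr \<epsilon> / (p' * (real N / exp 2) powr (1 / D))
          = c1 / (p * real N powr (1 / ?d) * real N powr \<epsilon>)"
        using Npos p0 r unfolding R p'_def c1_def by (simp add: field_simps)
      also have "\<dots> \<le> c1 / (1 * real N powr \<epsilon>)"
        using P c1 Npos p0 by (intro divide_left_mono mult_right_mono mult_pos_pos) auto
      also have "\<dots> = c1 * real N powr (- \<epsilon>)" by (simp add: powr_minus_divide)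
      finally show ?thesis .
    qed
    have L: "real (card (edges F) * N) < (real N powr \<epsilon>) ^ r"
    proof -
      have "card (edges F) * N < N * N" using NN by simp
      then have "real (card (edges F) * N) < real (N * N)" by (rule of_nat_less_iff[THEN iffD2])
      also have "\<dots> = real N powr 2" using Npos by (simp add: power2_eq_square)
      also have "\<dots> \<le> real N powr (real r * \<epsilon>)" using r\<epsilon> NN by (intro powr_mono) auto
      also have "\<dots> = (real N powr \<epsilon>) ^ r" using Npos by (simp add: powr_powr powr_realpow[symmetric] mult.commute)
      finally show ?thesis .
    qed
    let ?f = "\<lambda>W. of_bool (\<not> has_factor F (B, W)) :: real"
    \<comment> \<open>\<open>W\<close> is the first exposure and \<open>W'\<close> the second; a
      \<open>W\<close> without an arrangement gets the trivial bound 1.\<close>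
    have 2: "rs_expect (p / 2) X (\<lambda>W'. ?f (W \<union> W')) \<le> of_bool (\<not> ?arr W) + 2 * real r * (c1 * real N powr (- \<epsilon>))" for W
    proof (cases "?arr W")
      case False
      have "rs_expect (p / 2) X (\<lambda>W'. ?f (W \<union> W')) \<le> rs_expect (p / 2) X (\<lambda>_. 1)"
        using pp by (intro rs_expect_mono) auto
      then show ?thesis using False X c1 by (simp add: add_increasing2)
    next
      case True
      then obtain \<Phi> where \<Phi>: "bij_betw \<Phi> (?V \<times> {..<N}) B"
        "\<And>e c. e \<in> ?E \<Longrightarrow> c < N \<Longrightarrow> (\<lambda>u. \<Phi> (u, c)) ` e \<in> W" by blast
      let ?ex = "\<lambda>W'. \<exists>\<sigma>\<in>perm_families (?\<kappa> ` ?V) N.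
        (`) \<Phi> ` copy_edges ?\<kappa> {e \<in> edges F. inj_on ?\<kappa> e} N \<sigma> \<subseteq> W'"
      have "rs_expect (p / 2) X (\<lambda>W'. ?f (W \<union> W')) \<le> rs_expect (p / 2) X (\<lambda>W'. of_bool (\<not> ?ex W'))"
      proof (rule rs_expect_mono[OF pp])
        fix W'
        have "has_factor F (B, W \<union> W')" if "?ex W'"
        proof -
          from that obtain \<sigma> where \<sigma>: "\<sigma> \<in> perm_families (?\<kappa> ` ?V) N"
            "(`) \<Phi> ` copy_edges ?\<kappa> {e \<in> edges F. inj_on ?\<kappa> e} N \<sigma> \<subseteq> W'" by blast
          show ?thesis
          proof (rule has_factor_if_copy_edges_subset[OF F V \<Phi>(1) \<sigma>(1)])
            show "(\<lambda>u. \<Phi> (u, c)) ` e \<in> W \<union> W'" if "e \<in> edges F" "\<not> inj_on ?\<kappa> e" "c < N" for e c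
              using \<Phi>(2)[of e c] that by blast
            show "(`) \<Phi> ` copy_edges ?\<kappa> {e \<in> edges F. inj_on ?\<kappa> e} N \<sigma> \<subseteq> W \<union> W'"
              using \<sigma>(2) by blast
          qed
        qed
        then show "?f (W \<union> W') \<le> of_bool (\<not> ?ex W')" by auto
      qed
      also have "\<dots> \<le> 2 * real r * (c1 * real N powr (- \<epsilon>))"
        unfolding p'(2)[symmetric]
        by (rule cross_edges_prob[OF F E0 D(1,3) \<Phi>(1) Ne X p'(1) _ _ \<theta> _ L])
          (use p' pp Npos N1[OF NN(1)] in auto)
      finally show ?thesis using True by simp
    qed
    have "antimono ?f"
    proof (rule antimonoI)
      fix W W' :: "'v set set" assume "W \<subseteq> W'"
      then show "?f W' \<le> ?f W" using has_factor_mono[of F B W W'] by auto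
    qed
    then have "rs_expect (p / 2 + p / 2) X ?f
        \<le> rs_expect (p / 2) X (\<lambda>W. rs_expect (p / 2) X (\<lambda>W'. ?f (W \<union> W')))"
      using pp p X by (intro rs_expect_union_le) auto
    also have "\<dots> \<le> rs_expect (p / 2) X (\<lambda>W. of_bool (\<not> ?arr W) + 2 * real r * (c1 * real N powr (- \<epsilon>)))"
      using pp 2 by (intro rs_expect_mono) auto
    also have "\<dots> \<le> 2 * real N powr (- \<epsilon>) + 2 * real r * (c1 * real N powr (- \<epsilon>))"
      using 1 X by (simp add: rs_expect_add)
    also have "\<dots> = c * real N powr (- \<epsilon>)" by (simp add: c_def algebra_simps)
    finally show ?thesis by simp
  qed
  show ?thesis by (rule that[OF K(2) c \<epsilon> main])
qed

text \<open>\<open>r\<close> repetitions at density \<open>p / r\<close> raise the failure bound to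
  the \<open>r\<close>-th power. The spare unit in \<open>C + 1 \<le> r * \<epsilon>\<close> absorbs
  \<open>c ^ r\<close> once \<open>N \<ge> c ^ r\<close>. The bound \<open>2 \<le> K\<close> serves
  the choice of block size, where it yields \<open>K / p \<ge> n powr \<delta>\<close>.\<close>

lemma factor_prob:
  assumes F: "simple_graph F" and nb: "\<not> vertex_balanced F" and C: "0 < C"
  obtains K :: real and N0 :: nat where "2 \<le> K"
    "\<And>(N :: nat) p (B :: 'v set) X. N0 \<le> N \<Longrightarrow> finite B \<Longrightarrow> card B = card (verts F) * N \<Longrightarrow>
      finite X \<Longrightarrow> all_edges B \<subseteq> X \<Longrightarrow> K * real N powr (- 1 / max_density F) \<le> p \<Longrightarrow> p \<le> 1 \<Longrightarrow>
      rs_expect p X (\<lambda>W. of_bool (\<not> has_factor F (B, W))) \<le> real N powr (- C)"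
proof -
  obtain K c \<epsilon> :: real and N0 :: nat where Kc: "0 < K" "0 < c" "0 < \<epsilon>"
    and aux: "\<And>(N :: nat) p (B :: 'v set) X. N0 \<le> N \<Longrightarrow> finite B \<Longrightarrow> card B = card (verts F) * N \<Longrightarrow>
      finite X \<Longrightarrow> all_edges B \<subseteq> X \<Longrightarrow> K * real N powr (- 1 / max_density F) \<le> p \<Longrightarrow> p \<le> 1 \<Longrightarrow>
      rs_expect p X (\<lambda>W. of_bool (\<not> has_factor F (B, W))) \<le> c * real N powr (- \<epsilon>)"
    using factor_prob_aux[OF F nb] by blast
  define r where "r = nat \<lceil>(C + 1) / \<epsilon>\<rceil>"
  have "(C + 1) / \<epsilon> > 0" using Kc C by simp
  then have r: "r > 0" "(C + 1) / \<epsilon> \<le> real r" unfolding r_def by linarith+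
  have r\<epsilon>: "C + 1 \<le> real r * \<epsilon>" using r(2) Kc by (simp add: field_simps)
  define K' where "K' = max 2 (real r * K)"
  define N1 where "N1 = max N0 (Suc (nat \<lceil>c ^ r\<rceil>))"
  have "rs_expect p X (\<lambda>W. of_bool (\<not> has_factor F (B, W))) \<le> real N powr (- C)"
    if N: "N1 \<le> N" and B: "finite B" "card B = card (verts F) * N" and X: "finite X" "all_edges B \<subseteq> X"
      and p: "K' * real N powr (- 1 / max_density F) \<le> p" "p \<le> 1" for N p and B :: "'v set" and X
  proof -
    have NN: "N0 \<le> N" "c ^ r \<le> real N" "1 \<le> N" using N unfolding N1_def by linarith+
    let ?f = "\<lambda>W. of_bool (\<not> has_factor F (B, W)) :: real"
    have le: "?f W' \<le> ?f W" if "W \<subseteq> W'" for W W' using has_factor_mono[OF _ that, of F B] by auto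
    have "real r * K * real N powr (- 1 / max_density F) \<le> K' * real N powr (- 1 / max_density F)"
      by (intro mult_right_mono) (auto simp: K'_def)
    then have pr: "K * real N powr (- 1 / max_density F) \<le> p / real r"
      using p(1) r by (simp add: field_simps)
    have pr0: "0 \<le> p / real r" using pr Kc by (meson mult_nonneg_nonneg less_imp_le order_trans powr_ge_zero)
    have pr1: "p / real r \<le> 1"
      using p r by (simp add: divide_le_eq)
    have "rs_expect (real r * (p / real r)) X ?f \<le> rs_expect (p / real r) X ?f ^ r"
    proof (rule rs_expect_power_le[OF X(1)])
      show "antimono ?f" using le by (intro antimonoI) auto
      show "?f (W \<union> W') \<le> ?f W * ?f W'" for W W' using le[of W "W \<union> W'"] le[of W' "W \<union> W'"] by auto
    qed (use pr0 p r in auto)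
    also have "\<dots> \<le> (c * real N powr (- \<epsilon>)) ^ r"
    proof (rule power_mono)
      show "rs_expect (p / real r) X ?f \<le> c * real N powr (- \<epsilon>)" by (rule aux[OF NN(1) B X pr pr1])
      show "0 \<le> rs_expect (p / real r) X ?f"
        using rs_expect_mono[OF pr0 pr1, of X "\<lambda>_. 0" ?f] X by simp
    qed
    also have "\<dots> = c ^ r * real N powr (- (real r * \<epsilon>))"
      using NN by (simp add: power_mult_distrib powr_powr powr_realpow[symmetric] mult.commute)
    also have "\<dots> \<le> real N * real N powr (- (C + 1))"
      using NN r\<epsilon> by (intro mult_mono powr_mono) auto
    also have "\<dots> = real N powr (- C)"
    proof -
      have "real N powr 1 * real N powr (- (C + 1)) = real N powr (- C)" unfolding powr_add[symmetric] by simp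
      then show ?thesis using NN by simp
    qed
    finally show ?thesis using r by simp
  qed
  then show ?thesis by (intro that[of K' N1]) (auto simp: K'_def)
qed

subsection \<open>Random edge orders\<close>

lemma card_permutations_prefix:
  assumes A: "finite A" and B: "B \<subseteq> A"
  shows "card {es \<in> permutations_of_set A. set (take (card B) es) = B} = fact (card B) * fact (card A - card B)"
proof -
  let ?P = "permutations_of_set B \<times> permutations_of_set (A - B)"
  have finB: "finite B" using A B finite_subset by blast
  have "{es \<in> permutations_of_set A. set (take (card B) es) = B} = (\<lambda>(xs, ys). xs @ ys) ` ?P"
  proof (intro equalityI subsetI)
    fix es assume "es \<in> {es \<in> permutations_of_set A. set (take (card B) es) = B}"
    then have es: "set es = A" "distinct es" "set (take (card B) es) = B"
      by (auto simp: permutations_of_set_def)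
    have "set (drop (card B) es) = A - B"
    proof -
      have "set (take (card B) es) \<union> set (drop (card B) es) = A"
        using es(1) by (metis append_take_drop_id set_append)
      moreover have "set (take (card B) es) \<inter> set (drop (card B) es) = {}"
        using es(2) by (rule set_take_disj_set_drop_if_distinct) simp
      ultimately show ?thesis using es(3) by auto
    qed
    then have "(take (card B) es, drop (card B) es) \<in> ?P" using es by (auto simp: permutations_of_set_def)
    then show "es \<in> (\<lambda>(xs, ys). xs @ ys) ` ?P"
      by (intro image_eqI[of _ _ "(take (card B) es, drop (card B) es)"]) auto
  next
    fix es assume "es \<in> (\<lambda>(xs, ys). xs @ ys) ` ?P"
    then obtain xs ys where xy: "es = xs @ ys" "set xs = B" "distinct xs" "set ys = A - B" "distinct ys"
      by (auto simp: permutations_of_set_def)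
    then have "length xs = card B" by (metis distinct_card)
    then show "es \<in> {es \<in> permutations_of_set A. set (take (card B) es) = B}"
      using xy B by (auto simp: permutations_of_set_def)
  qed
  moreover have "inj_on (\<lambda>(xs, ys). xs @ ys) ?P"
  proof (rule inj_onI, clarify)
    fix xs ys xs' ys' assume "xs \<in> permutations_of_set B" "xs' \<in> permutations_of_set B" "xs @ ys = xs' @ ys'"
    moreover from this have "length xs = length xs'" by (metis distinct_card permutations_of_setD)
    ultimately show "xs = xs' \<and> ys = ys'" by simp
  qed
  ultimately show ?thesis
    using A B finB by (simp add: card_image card_cartesian_product card_Diff_subset)
qed

text \<open>The first \<open>t\<close> entries of a uniform order form a uniform
  \<open>t\<close>-subset, in a form without division.\<close>

lemma card_permutations_prefix_pred:
  assumes A: "finite A" and t: "t \<le> card A"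
  shows "real (card {es \<in> permutations_of_set A. Q (set (take t es))}) * real (card A choose t)
    = real (card {B. B \<subseteq> A \<and> card B = t \<and> Q B}) * fact (card A)"
proof -
  let ?\<B> = "{B. B \<subseteq> A \<and> card B = t \<and> Q B}"
  let ?P = "\<lambda>B. {es \<in> permutations_of_set A. set (take t es) = B}"
  have fin: "finite ?\<B>" using A by (auto intro: finite_subset[of _ "Pow A"])
  have "{es \<in> permutations_of_set A. Q (set (take t es))} = (\<Union>B\<in>?\<B>. ?P B)"
  proof (intro equalityI subsetI)
    fix es assume es: "es \<in> {es \<in> permutations_of_set A. Q (set (take t es))}"
    then have d: "set es = A" "distinct es" by (auto simp: permutations_of_set_def)
    then have "length es = card A" by (metis distinct_card)
    then have "card (set (take t es)) = t" using d t by (simp add: distinct_card)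
    moreover have "set (take t es) \<subseteq> A" using d(1) set_take_subset[of t es] by simp
    ultimately show "es \<in> (\<Union>B\<in>?\<B>. ?P B)" using es by auto
  qed auto
  then have "card {es \<in> permutations_of_set A. Q (set (take t es))} = (\<Sum>B\<in>?\<B>. card (?P B))"
    using fin by (simp only:) (intro card_UN_disjoint; auto)
  also have "\<dots> = (\<Sum>B\<in>?\<B>. fact t * fact (card A - t))"
    using card_permutations_prefix[OF A] by (intro sum.cong) auto
  finally have "real (card {es \<in> permutations_of_set A. Q (set (take t es))})
      = real (card ?\<B>) * (fact t * fact (card A - t))" by simp
  moreover have "fact t * fact (card A - t) * real (card A choose t) = fact (card A)"
    using binomial_fact_lemma[OF t] by (metis of_nat_fact of_nat_mult)
  ultimately show ?thesis by (simp add: mult.assoc)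
qed

section \<open>Probabilities of events for a random order\<close>

definition order_prob :: "'b set \<Rightarrow> ('b list \<Rightarrow> bool) \<Rightarrow> real" where
  "order_prob A Q = real (card {es \<in> permutations_of_set A. Q es}) / fact (card A)"

lemma order_prob_mono:
  assumes "\<And>es. es \<in> permutations_of_set A \<Longrightarrow> Q es \<Longrightarrow> Q' es"
  shows "order_prob A Q \<le> order_prob A Q'"
proof -
  have "card {es \<in> permutations_of_set A. Q es} \<le> card {es \<in> permutations_of_set A. Q' es}"
    using assms by (intro card_mono) auto
  then show ?thesis by (simp add: order_prob_def divide_right_mono)
qed

lemma order_prob_ex_le:
  assumes "finite I"
  shows "order_prob A (\<lambda>es. \<exists>i\<in>I. Q i es) \<le> (\<Sum>i\<in>I. order_prob A (Q i))"
proof -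
  have "{es \<in> permutations_of_set A. \<exists>i\<in>I. Q i es} = (\<Union>i\<in>I. {es \<in> permutations_of_set A. Q i es})"
    by auto
  then have "card {es \<in> permutations_of_set A. \<exists>i\<in>I. Q i es} \<le> (\<Sum>i\<in>I. card {es \<in> permutations_of_set A. Q i es})"
    using card_UN_le[OF assms] by metis
  from of_nat_mono[OF this, where 'a = real]
  have "real (card {es \<in> permutations_of_set A. \<exists>i\<in>I. Q i es}) \<le> (\<Sum>i\<in>I. real (card {es \<in> permutations_of_set A. Q i es}))"
    by simp
  then show ?thesis unfolding order_prob_def by (simp add: sum_divide_distrib[symmetric] divide_right_mono)
qed

lemma order_prob_disj_le: "order_prob A (\<lambda>es. Q es \<or> Q' es) \<le> order_prob A Q + order_prob A Q'"
proof -
  have "{es \<in> permutations_of_set A. Q es \<or> Q' es}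
      = {es \<in> permutations_of_set A. Q es} \<union> {es \<in> permutations_of_set A. Q' es}" by auto
  then have "card {es \<in> permutations_of_set A. Q es \<or> Q' es}
      \<le> card {es \<in> permutations_of_set A. Q es} + card {es \<in> permutations_of_set A. Q' es}"
    using card_Un_le by metis
  then show ?thesis unfolding order_prob_def add_divide_distrib[symmetric]
    by (intro divide_right_mono) (simp_all flip: of_nat_add)
qed

text \<open>The first \<open>w\<close> edges of a random order, where \<open>w\<close> is binomially distributed, form a random
  subset, and \<open>w \<le> t\<close> with probability at least \<open>1 / 2\<close> by Markov's inequality.\<close>

lemma order_prob_le_rs_expect:
  assumes A: "finite A" and t: "0 < t" "t \<le> card A" and p: "0 \<le> p" "p \<le> 1" "2 * p * real (card A) \<le> real t"
    and Q: "\<And>B B'. B \<subseteq> B' \<Longrightarrow> Q B' \<Longrightarrow> Q B"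
  shows "order_prob A (\<lambda>es. Q (set (take t es))) \<le> 2 * rs_expect p A (\<lambda>W. of_bool (Q W))"
proof -
  let ?a = "\<lambda>w. order_prob A (\<lambda>es. Q (set (take w es)))"
  let ?w = "\<lambda>w. p ^ w * (1 - p) ^ (card A - w)"
  have decomp: "rs_expect p A (\<lambda>W. of_bool (card W \<le> t \<and> Q' W))
      = (\<Sum>w\<le>t. ?w w * real (card {W. W \<subseteq> A \<and> card W = w \<and> Q' W}))" for Q'
  proof -
    have "rs_expect p A (\<lambda>W. of_bool (card W \<le> t \<and> Q' W))
        = (\<Sum>W\<in>{W. W \<subseteq> A \<and> card W \<le> t \<and> Q' W}. ?w (card W))"
      unfolding rs_expect_def
    proof (rule sum.mono_neutral_cong_right)
      show "\<And>W. W \<in> {W. W \<subseteq> A \<and> card W \<le> t \<and> Q' W} \<Longrightarrow>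
          p ^ card W * (1 - p) ^ card (A - W) * of_bool (card W \<le> t \<and> Q' W) = ?w (card W)"
        using A by (auto simp: card_Diff_subset finite_subset)
    qed (use A in auto)
    also have "{W. W \<subseteq> A \<and> card W \<le> t \<and> Q' W} = (\<Union>w\<in>{..t}. {W. W \<subseteq> A \<and> card W = w \<and> Q' W})" by auto
    also have "(\<Sum>W\<in>\<dots>. ?w (card W)) = (\<Sum>w\<le>t. \<Sum>W\<in>{W. W \<subseteq> A \<and> card W = w \<and> Q' W}. ?w (card W))"
      using A by (intro sum.UNION_disjoint) (auto intro: finite_subset[of _ "Pow A"])
    also have "\<dots> = (\<Sum>w\<le>t. ?w w * real (card {W. W \<subseteq> A \<and> card W = w \<and> Q' W}))"
      by (intro sum.cong refl) (simp add: mult.commute)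
    finally show ?thesis .
  qed
  have a0: "0 \<le> ?a t" by (simp add: order_prob_def)
  have card_eq: "real (card {W. W \<subseteq> A \<and> card W = w \<and> Q W}) = ?a w * real (card A choose w)" if "w \<le> t" for w
    using card_permutations_prefix_pred[OF A, of w Q] that t by (simp add: order_prob_def field_simps)
  have mono: "?a t \<le> ?a w" if "w \<le> t" for w
  proof (rule order_prob_mono)
    fix es assume "Q (set (take t es))"
    then show "Q (set (take w es))" using Q[OF set_take_subset_set_take[OF that]] by simp
  qed
  have "?a t * rs_expect p A (\<lambda>W. of_bool (card W \<le> t))
      = (\<Sum>w\<le>t. ?a t * (?w w * real (card A choose w)))"
    using decomp[of "\<lambda>_. True"] A by (simp add: sum_distrib_left n_subsets)
  also have "\<dots> \<le> (\<Sum>w\<le>t. ?w w * real (card {W. W \<subseteq> A \<and> card W = w \<and> Q W}))"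
  proof (rule sum_mono)
    fix w assume "w \<in> {..t}"
    then have w: "w \<le> t" by simp
    have "?a t * (?w w * real (card A choose w)) \<le> ?a w * (?w w * real (card A choose w))"
      using p mono[OF w] by (intro mult_right_mono) auto
    then show "?a t * (?w w * real (card A choose w)) \<le> ?w w * real (card {W. W \<subseteq> A \<and> card W = w \<and> Q W})"
      unfolding card_eq[OF w] by (simp add: mult_ac)
  qed
  also have "\<dots> = rs_expect p A (\<lambda>W. of_bool (card W \<le> t \<and> Q W))" by (rule decomp[symmetric])
  also have "\<dots> \<le> rs_expect p A (\<lambda>W. of_bool (Q W))"
    using p by (intro rs_expect_mono) auto
  finally have 1: "?a t * rs_expect p A (\<lambda>W. of_bool (card W \<le> t)) \<le> rs_expect p A (\<lambda>W. of_bool (Q W))" .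
  \<comment> \<open>Markov's inequality in pointwise form: \<open>1 - card W / t\<close> is a lower
    bound for the indicator of \<open>card W \<le> t\<close>.\<close>
  have "rs_expect p A (\<lambda>W. 1 + (- 1 / real t) * real (card W)) \<le> rs_expect p A (\<lambda>W. of_bool (card W \<le> t))"
    using p t by (intro rs_expect_mono) (auto simp: field_simps)
  moreover have "rs_expect p A (\<lambda>W. 1 + (- 1 / real t) * real (card W)) = 1 - p * real (card A) / real t"
    using A by (simp only: rs_expect_add rs_expect_cmult rs_expect_const rs_expect_card) simp
  moreover have "p * real (card A) / real t \<le> 1 / 2" using p t by (simp add: field_simps)
  ultimately have "1 / 2 \<le> rs_expect p A (\<lambda>W. of_bool (card W \<le> t))" by linarith
  then have "?a t * (1 / 2) \<le> ?a t * rs_expect p A (\<lambda>W. of_bool (card W \<le> t))"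
    using a0 by (intro mult_left_mono) auto
  then show ?thesis using 1 by linarith
qed

text \<open>The quotient of the two binomial coefficients is the product of
  \<open>(t - i) / (M - i)\<close> over \<open>i < s\<close>, and each factor is at most
  \<open>t / M\<close>.\<close>

lemma binomial_diff_le:
  assumes "s \<le> t" "t \<le> M"
  shows "((M - s) choose (t - s)) * M ^ s \<le> (M choose t) * t ^ s"
  using assms(1)
proof (induction s)
  case (Suc s)
  define a b where "a = M - Suc s" and "b = t - Suc s"
  have ab: "M - s = Suc a" "t - s = Suc b" using Suc.prems assms by (auto simp: a_def b_def)
  have "(a choose b) * Suc a = (Suc a choose Suc b) * Suc b"
    using Suc_times_binomial_eq[of a b] by (simp add: mult.commute)
  then have "(a choose b) * M * Suc a = (Suc a choose Suc b) * (Suc b * M)"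
    by (metis mult.assoc mult.commute)
  moreover have "Suc b * M \<le> t * Suc a"
  proof -
    have "t * s \<le> M * s" using assms by simp
    then have "t * M - s * M \<le> t * M - t * s" by (intro diff_le_mono2) (simp add: mult.commute)
    then have "(t - s) * M \<le> t * (M - s)" by (simp only: diff_mult_distrib diff_mult_distrib2)
    then show ?thesis by (simp add: ab)
  qed
  ultimately have "(a choose b) * M * Suc a \<le> (Suc a choose Suc b) * t * Suc a"
    by (simp only: mult.assoc mult_le_mono2)
  then have "(a choose b) * M \<le> (Suc a choose Suc b) * t"
    by (simp only: mult_le_cancel2 zero_less_Suc simp_thms)
  then have "(a choose b) * M * M ^ s \<le> (Suc a choose Suc b) * t * M ^ s" by (rule mult_le_mono1)
  also have "\<dots> \<le> (M choose t) * t ^ s * t" using Suc.IH Suc.prems by (simp add: ab mult_ac)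
  finally show ?case by (simp add: a_def b_def mult_ac)
qed simp

lemma order_prob_superset_le:
  assumes A: "finite A" "A \<noteq> {}" and t: "t \<le> card A" and S: "S \<subseteq> A"
  shows "order_prob A (\<lambda>es. S \<subseteq> set (take t es)) \<le> (real t / real (card A)) ^ card S"
proof -
  let ?M = "card A" and ?s = "card S"
  have finS: "finite S" using A S finite_subset by blast
  have M: "?M > 0" using A by (simp add: card_gt_0_iff)
  have "real (card {B. B \<subseteq> A \<and> card B = t \<and> S \<subseteq> B}) * real ?M ^ ?s \<le> real (?M choose t) * real t ^ ?s"
  proof (cases "?s \<le> t")
    case True
    have "card {B. B \<subseteq> A \<and> card B = t \<and> S \<subseteq> B} \<le> card {B. B \<subseteq> A - S \<and> card B = t - ?s}"
    proof (rule card_inj_on_le[where f = "\<lambda>B. B - S"])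
      show "inj_on (\<lambda>B. B - S) {B. B \<subseteq> A \<and> card B = t \<and> S \<subseteq> B}" by (auto simp: inj_on_def)
      show "(\<lambda>B. B - S) ` {B. B \<subseteq> A \<and> card B = t \<and> S \<subseteq> B} \<subseteq> {B. B \<subseteq> A - S \<and> card B = t - ?s}"
        using finS by (auto simp: card_Diff_subset)
      show "finite {B. B \<subseteq> A - S \<and> card B = t - ?s}" using A by (auto intro: finite_subset[of _ "Pow A"])
    qed
    also have "\<dots> = (?M - ?s) choose (t - ?s)" using A S finS by (simp add: n_subsets card_Diff_subset)
    finally have "card {B. B \<subseteq> A \<and> card B = t \<and> S \<subseteq> B} * ?M ^ ?s \<le> (?M choose t) * t ^ ?s"
      using binomial_diff_le[OF True t] by (meson mult_le_mono1 order_trans)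
    from of_nat_mono[OF this, where 'a = real] show ?thesis by simp
  next
    case False
    have "\<not> S \<subseteq> B" if "B \<subseteq> A" "card B = t" for B
      using False that card_mono[OF finite_subset[OF that(1) A(1)], of S] by auto
    then have "{B. B \<subseteq> A \<and> card B = t \<and> S \<subseteq> B} = {}" by blast
    then show ?thesis by (simp only: card.empty) simp
  qed
  moreover have "real (card {B. B \<subseteq> A \<and> card B = t \<and> S \<subseteq> B}) = order_prob A (\<lambda>es. S \<subseteq> set (take t es)) * real (?M choose t)"
    using card_permutations_prefix_pred[OF A(1) t, of "\<lambda>B. S \<subseteq> B"] by (simp add: order_prob_def field_simps)
  ultimately have "real (?M choose t) * (order_prob A (\<lambda>es. S \<subseteq> set (take t es)) * real ?M ^ ?s)
      \<le> real (?M choose t) * real t ^ ?s" by (simp add: mult_ac)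
  then have "order_prob A (\<lambda>es. S \<subseteq> set (take t es)) * real ?M ^ ?s \<le> real t ^ ?s"
    using t by (simp add: zero_less_binomial_iff)
  then show ?thesis using M by (simp add: power_divide field_simps)
qed

text \<open>A union bound over the \<open>s\<close>-subsets of \<open>S\<close>. When
  \<open>s\<close> is at least \<open>2 * exp 1\<close> times the mean
  \<open>card S * t / card A\<close>, the base is at most 1/2, which replaces a concentration
  inequality.\<close>

lemma order_prob_card_ge_le:
  assumes A: "finite A" "A \<noteq> {}" and t: "t \<le> card A" and S: "S \<subseteq> A" and s: "s > 0"
  shows "order_prob A (\<lambda>es. s \<le> card (set (take t es) \<inter> S))
    \<le> (exp 1 * real (card S) * real t / (real s * real (card A))) ^ s"
proof -
  have finS: "finite S" using A S finite_subset by blast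
  have fin: "finite {T. T \<subseteq> S \<and> card T = s}" using finS by (auto intro: finite_subset[of _ "Pow S"])
  have "order_prob A (\<lambda>es. s \<le> card (set (take t es) \<inter> S))
      \<le> order_prob A (\<lambda>es. \<exists>T\<in>{T. T \<subseteq> S \<and> card T = s}. T \<subseteq> set (take t es))"
  proof (rule order_prob_mono)
    fix es :: "'a list" assume "s \<le> card (set (take t es) \<inter> S)"
    then obtain T where "T \<subseteq> set (take t es) \<inter> S" "card T = s" by (meson obtain_subset_with_card_n)
    then show "\<exists>T\<in>{T. T \<subseteq> S \<and> card T = s}. T \<subseteq> set (take t es)" by auto
  qed
  also have "\<dots> \<le> (\<Sum>T\<in>{T. T \<subseteq> S \<and> card T = s}. order_prob A (\<lambda>es. T \<subseteq> set (take t es)))"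
    by (rule order_prob_ex_le[OF fin])
  also have "\<dots> \<le> (\<Sum>T\<in>{T. T \<subseteq> S \<and> card T = s}. (real t / real (card A)) ^ s)"
    using order_prob_superset_le[OF A t] S by (intro sum_mono) auto
  also have "\<dots> = real (card S choose s) * (real t / real (card A)) ^ s"
    using n_subsets[OF finS] by simp
  also have "\<dots> \<le> (exp 1 * real (card S) / real s) ^ s * (real t / real (card A)) ^ s"
    using s by (intro mult_right_mono binomial_le_exp_power) auto
  also have "\<dots> = (exp 1 * real (card S) * real t / (real s * real (card A))) ^ s"
    by (simp add: power_mult_distrib[symmetric])
  finally show ?thesis .
qed

subsection \<open>Buying the edges inside blocks\<close>

text \<open>The cap counts the edges of \<open>S\<close> presented so far, not those bought, so the
  decision needs no recursion over earlier decisions. Once the count exceeds \<open>b\<close> buying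
  stops for good, and the budget is respected for every order and not only with high
  probability.\<close>

definition capped_rule :: "nat set set \<Rightarrow> real \<Rightarrow> rule" where
  "capped_rule S b es \<longleftrightarrow> last es \<in> S \<and> real (card (set es \<inter> S)) \<le> b"

lemma purchased_capped_rule:
  "purchased (capped_rule S b) t es =
    {es ! i | i. i < t \<and> i < length es \<and> es ! i \<in> S \<and> real (card (set (take (Suc i) es) \<inter> S)) \<le> b}"
proof -
  have last: "last (take (Suc i) es) = es ! i" if "i < length es" for i
    using that by (simp add: take_Suc_conv_app_nth)
  show ?thesis unfolding purchased_def capped_rule_def by (simp add: last cong: conj_cong)
qed

text \<open>At the time of the last purchase, everything bought is among the edges of
  \<open>S\<close> presented by then, and the rule has just checked that these are at most
  \<open>b\<close>.\<close>

lemma card_purchased_capped_rule_le: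
  assumes "0 \<le> b"
  shows "real (card (purchased (capped_rule S b) t es)) \<le> b"
proof -
  define I where "I = {i. i < t \<and> i < length es \<and> es ! i \<in> S \<and> real (card (set (take (Suc i) es) \<inter> S)) \<le> b}"
  have eq: "purchased (capped_rule S b) t es = (!) es ` I"
    by (auto simp: purchased_capped_rule I_def)
  show ?thesis
  proof (cases "I = {}")
    case True
    then show ?thesis using assms eq by simp
  next
    case False
    have fin: "finite I" by (simp add: I_def)
    have M: "Max I \<in> I" using Max_in[OF fin False] .
    have "(!) es ` I \<subseteq> set (take (Suc (Max I)) es) \<inter> S"
    proof (rule image_subsetI)
      fix i assume i: "i \<in> I"
      then have "i < Suc (Max I)" using Max_ge[OF fin i] by simp
      then have "es ! i \<in> set (take (Suc (Max I)) es)"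
        using i by (auto simp: I_def in_set_conv_nth intro!: exI[of _ i])
      then show "es ! i \<in> set (take (Suc (Max I)) es) \<inter> S" using i by (simp add: I_def)
    qed
    then have "card ((!) es ` I) \<le> card (set (take (Suc (Max I)) es) \<inter> S)" by (intro card_mono) auto
    then show ?thesis using M eq by (simp add: I_def)
  qed
qed

lemma purchased_capped_rule_eq:
  assumes "real (card (set (take t es) \<inter> S)) \<le> b"
  shows "purchased (capped_rule S b) t es = set (take t es) \<inter> S"
proof -
  have "real (card (set (take (Suc i) es) \<inter> S)) \<le> b" if "i < t" for i
  proof -
    have "set (take (Suc i) es) \<subseteq> set (take t es)" using that by (intro set_take_subset_set_take) simp
    then have "card (set (take (Suc i) es) \<inter> S) \<le> card (set (take t es) \<inter> S)" by (intro card_mono) auto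
    then show ?thesis using assms by linarith
  qed
  then have "purchased (capped_rule S b) t es = {es ! i | i. i < t \<and> i < length es \<and> es ! i \<in> S}"
    by (simp add: purchased_capped_rule cong: conj_cong)
  moreover have "set (take t es) = {es ! i | i. i < t \<and> i < length es}"
  proof -
    have "set (take t es) = {take t es ! i | i. i < length es \<and> i < t}" by (simp add: set_conv_nth)
    also have "\<dots> = {es ! i | i. i < t \<and> i < length es}" by (intro Collect_cong ex_cong1) auto
    finally show ?thesis .
  qed
  ultimately show ?thesis by auto
qed

lemma has_factor_restrict:
  assumes "has_factor F (B, W)" "all_edges B \<subseteq> S"
  shows "has_factor F (B, W \<inter> S)"
proof -
  have "subgraph H (B, W \<inter> S)" if "subgraph H (B, W)" for H
    using that assms(2) by (auto simp: subgraph_def simple_graph_def all_edges_def)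
  moreover obtain \<C> where "finite \<C>" "card \<C> * card (verts F) = card B"
    "\<forall>H\<in>\<C>. subgraph H (B, W) \<and> isomorphic F H"
    "\<forall>H\<in>\<C>. \<forall>H'\<in>\<C>. H \<noteq> H' \<longrightarrow> verts H \<inter> verts H' = {}"
    using assms(1) by (auto simp: has_factor_def)
  ultimately show ?thesis unfolding has_factor_def by (intro exI[of _ \<C>]) simp
qed

lemma has_factor_Union:
  assumes V: "verts F \<noteq> {}" and P: "finite \<P>" "\<And>P. P \<in> \<P> \<Longrightarrow> finite P" "pairwise disjnt \<P>"
    and fac: "\<And>P. P \<in> \<P> \<Longrightarrow> has_factor F (P, W)"
  shows "has_factor F (\<Union>\<P>, W)"
proof -
  have "\<forall>P\<in>\<P>. \<exists>\<C>. finite \<C> \<and> card \<C> * card (verts F) = card P \<and>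
     (\<forall>H\<in>\<C>. subgraph H (P, W) \<and> isomorphic F H) \<and>
     (\<forall>H\<in>\<C>. \<forall>H'\<in>\<C>. H \<noteq> H' \<longrightarrow> verts H \<inter> verts H' = {})"
    using fac unfolding has_factor_def by simp
  then obtain \<C> where \<C>: "\<And>P. P \<in> \<P> \<Longrightarrow> finite (\<C> P)" "\<And>P. P \<in> \<P> \<Longrightarrow> card (\<C> P) * card (verts F) = card P"
    "\<And>P H. P \<in> \<P> \<Longrightarrow> H \<in> \<C> P \<Longrightarrow> subgraph H (P, W) \<and> isomorphic F H"
    "\<And>P H H'. P \<in> \<P> \<Longrightarrow> H \<in> \<C> P \<Longrightarrow> H' \<in> \<C> P \<Longrightarrow> H \<noteq> H' \<Longrightarrow> verts H \<inter> verts H' = {}"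
    by metis
  have sub: "verts H \<subseteq> P" if "P \<in> \<P>" "H \<in> \<C> P" for P H
    using \<C>(3)[OF that] by (simp add: subgraph_def)
  have ne: "verts H \<noteq> {}" if PH: "P \<in> \<P>" "H \<in> \<C> P" for P H
  proof -
    obtain f where "bij_betw f (verts F) (verts H)" using \<C>(3)[OF PH] by (auto simp: isomorphic_def)
    then show ?thesis using V by (auto simp: bij_betw_def)
  qed
  have dP: "P \<inter> P' = {}" if "P \<in> \<P>" "P' \<in> \<P>" "P \<noteq> P'" for P P'
    using P(3) that by (auto simp: pairwise_def disjnt_def)
  have disj: "\<C> P \<inter> \<C> P' = {}" if "P \<in> \<P>" "P' \<in> \<P>" "P \<noteq> P'" for P P'
    using sub[OF that(1)] sub[OF that(2)] ne[OF that(1)] dP[OF that] by blast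
  have "card (\<Union>P\<in>\<P>. \<C> P) = (\<Sum>P\<in>\<P>. card (\<C> P))"
    using P(1) \<C>(1) disj by (intro card_UN_disjoint) auto
  then have "card (\<Union>P\<in>\<P>. \<C> P) * card (verts F) = (\<Sum>P\<in>\<P>. card P)"
    using \<C>(2) by (simp add: sum_distrib_right)
  also have "\<dots> = card (\<Union>\<P>)" using P by (intro card_Union_disjoint[symmetric]) auto
  finally have 1: "card (\<Union>P\<in>\<P>. \<C> P) * card (verts F) = card (\<Union>\<P>)" .
  have 2: "subgraph H (\<Union>\<P>, W) \<and> isomorphic F H" if H: "H \<in> (\<Union>P\<in>\<P>. \<C> P)" for H
  proof -
    obtain P where P: "P \<in> \<P>" "H \<in> \<C> P" using H by blast
    then have "P \<subseteq> \<Union>\<P>" by blast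
    then show ?thesis using \<C>(3)[OF P] by (auto simp: subgraph_def)
  qed
  have 3: "verts H \<inter> verts H' = {}" if "H \<in> (\<Union>P\<in>\<P>. \<C> P)" "H' \<in> (\<Union>P\<in>\<P>. \<C> P)" "H \<noteq> H'" for H H'
  proof -
    obtain P P' where P: "P \<in> \<P>" "H \<in> \<C> P" "P' \<in> \<P>" "H' \<in> \<C> P'" using \<open>H \<in> _\<close> \<open>H' \<in> _\<close> by blast
    show ?thesis
    proof (cases "P = P'")
      case True
      then show ?thesis using \<C>(4) P that(3) by blast
    next
      case False
      then show ?thesis using sub[OF P(1,2)] sub[OF P(3,4)] dP[OF P(1,3)] by blast
    qed
  qed
  show ?thesis unfolding has_factor_def fst_conv
    using P(1) \<C>(1) 1 2 3 by (intro exI[of _ "\<Union>P\<in>\<P>. \<C> P"] conjI ballI impI) auto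
qed

text \<open>Blocks of \<open>h * N\<close> vertices are split off as long as
  \<open>m \<ge> 2 * N\<close>; the last block takes the rest, so no remainder is left over.\<close>

lemma ex_block_partition:
  assumes "finite A" "card A = h * m" "0 < N" "N \<le> m"
  shows "\<exists>\<P>. finite \<P> \<and> \<Union>\<P> = A \<and> pairwise disjnt \<P> \<and> (\<forall>P\<in>\<P>. \<exists>k. N \<le> k \<and> k < 2 * N \<and> card P = h * k)"
  using assms(1,2,4)
proof (induction m arbitrary: A rule: less_induct)
  case (less m)
  show ?case
  proof (cases "m < 2 * N")
    case True
    then show ?thesis using less.prems by (intro exI[of _ "{A}"]) auto
  next
    case False
    have "h * N \<le> card A" using less.prems by simp
    then obtain S where S: "S \<subseteq> A" "card S = h * N" by (meson obtain_subset_with_card_n)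
    have finS: "finite S" using S less.prems finite_subset by blast
    have "card (A - S) = h * (m - N)"
      using S finS less.prems by (simp add: card_Diff_subset diff_mult_distrib2)
    then have "\<exists>\<P>. finite \<P> \<and> \<Union>\<P> = A - S \<and> pairwise disjnt \<P> \<and>
        (\<forall>P\<in>\<P>. \<exists>k. N \<le> k \<and> k < 2 * N \<and> card P = h * k)"
      by (intro less.IH[of "m - N"]) (use False less.prems(1) assms(3) in auto)
    then obtain \<P> where \<P>: "finite \<P>" "\<Union>\<P> = A - S" "pairwise disjnt \<P>"
      "\<forall>P\<in>\<P>. \<exists>k. N \<le> k \<and> k < 2 * N \<and> card P = h * k"
      by blast
    have "disjnt S P" if "P \<in> \<P>" for P using \<P>(2) that by (auto simp: disjnt_def)
    then show ?thesis using \<P> S assms(3)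
      by (intro exI[of _ "insert S \<P>"]) (auto simp: pairwise_insert disjnt_sym)
  qed
qed

section \<open>From blocks to a strategy\<close>

lemma finite_all_edges: "finite B \<Longrightarrow> finite (all_edges B)"
  unfolding all_edges_def by (rule finite_subset[of _ "Pow B"]) auto

lemma card_all_edges: "finite B \<Longrightarrow> card (all_edges B) = card B choose 2"
  unfolding all_edges_def by (rule n_subsets)

lemma success_prob_return:
  "success_prob n t (return_pmf D) Q = order_prob (all_edges {1..n}) (\<lambda>es. Q ({1..n}, purchased D t es))"
proof -
  let ?O = "permutations_of_set (all_edges {1..n})"
  have fin: "finite (all_edges {1..n})" by (simp add: finite_all_edges)
  have ne: "?O \<noteq> {}" using fin by simp
  have "success_prob n t (return_pmf D) Q = measure_pmf.prob (pmf_of_set ?O) {es. Q ({1..n}, purchased D t es)}"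
    by (simp add: success_prob_def edge_orders_def pair_return_pmf1 vimage_def)
  also have "\<dots> = order_prob (all_edges {1..n}) (\<lambda>es. Q ({1..n}, purchased D t es))"
    using ne fin by (simp add: measure_pmf_of_set order_prob_def Int_def)
  finally show ?thesis .
qed

lemma order_prob_not: "finite A \<Longrightarrow> order_prob A (\<lambda>es. \<not> Q es) = 1 - order_prob A Q"
proof -
  assume A: "finite A"
  have "{es \<in> permutations_of_set A. \<not> Q es} = permutations_of_set A - {es \<in> permutations_of_set A. Q es}" by auto
  then have "card {es \<in> permutations_of_set A. \<not> Q es} + card {es \<in> permutations_of_set A. Q es} = fact (card A)"
    using card_Diff_subset[of "{es \<in> permutations_of_set A. Q es}" "permutations_of_set A"]
      card_mono[of "permutations_of_set A" "{es \<in> permutations_of_set A. Q es}"] A by simp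
  then have "real (card {es \<in> permutations_of_set A. \<not> Q es}) + real (card {es \<in> permutations_of_set A. Q es}) = fact (card A)"
    by (metis of_nat_add of_nat_fact)
  then show ?thesis by (simp add: order_prob_def field_simps)
qed

text \<open>There are two ways to fail. Some block has no factor: at most \<open>n\<close> blocks,
  each with probability at most \<open>2 * \<beta>\<close> after passing from random subsets to
  random orders. Or the cap is reached: the expected number of presented edges inside blocks is at
  most \<open>b / (2 * exp 1)\<close>.\<close>

lemma block_strategy:
  fixes F :: "'a graph"
  assumes F: "simple_graph F" and V: "verts F \<noteq> {}"
    and N: "0 < N" "N \<le> m" and n: "n = card (verts F) * m"
    and t: "0 < t" "t \<le> n choose 2" and p: "0 \<le> p" "p \<le> 1" "2 * p * real (n choose 2) \<le> real t"
    and \<beta>: "\<And>k B. N \<le> k \<Longrightarrow> B \<subseteq> {1..n} \<Longrightarrow> card B = card (verts F) * k \<Longrightarrow>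
      rs_expect p (all_edges {1..n}) (\<lambda>W. of_bool (\<not> has_factor F (B, W))) \<le> \<beta>"
    and b: "real n \<le> b" "2 * exp 1 * (real n * (real (card (verts F)) * real N)) * real t / real (n choose 2) \<le> b"
  shows "\<exists>S. is_strategy n t b S \<and> success_prob n t S (has_factor F) \<ge> 1 - (2 * real n * \<beta> + (1 / 2) ^ n)"
proof -
  let ?h = "card (verts F)" and ?X = "all_edges {1..n}"
  have h: "?h > 0" using V simple_graph_finite(1)[OF F] by (simp add: card_gt_0_iff)
  have finX: "finite ?X" by (simp add: finite_all_edges)
  have cX: "card ?X = n choose 2" by (simp add: card_all_edges)
  have M: "n choose 2 > 0" using t by linarith
  have neX: "?X \<noteq> {}" using cX M by auto
  obtain \<P> where \<P>: "finite \<P>" "\<Union>\<P> = {1..n}" "pairwise disjnt \<P>"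
    "\<forall>P\<in>\<P>. \<exists>k. N \<le> k \<and> k < 2 * N \<and> card P = ?h * k"
    using ex_block_partition[of "{1..n}" ?h m N] N n by auto
  have Pn: "P \<subseteq> {1..n}" "finite P" if "P \<in> \<P>" for P
    using \<P>(2) that by (auto intro: finite_subset)
  have sumP: "(\<Sum>P\<in>\<P>. card P) = n"
    using card_Union_disjoint[OF \<P>(3) Pn(2)] \<P>(2) by simp
  define S where "S = (\<Union>P\<in>\<P>. all_edges P)"
  have SX: "S \<subseteq> ?X" using Pn(1) by (fastforce simp: S_def all_edges_def)
  \<comment> \<open>A block \<open>P\<close> has fewer than \<open>2 * h * N\<close> vertices, hence
    at most \<open>card P * (h * N)\<close> pairs, and the sizes sum to \<open>n\<close>.\<close>
  have cardS: "real (card S) \<le> real n * (real ?h * real N)"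
  proof -
    have "card S \<le> (\<Sum>P\<in>\<P>. card (all_edges P))" unfolding S_def by (rule card_UN_le[OF \<P>(1)])
    also have "\<dots> \<le> (\<Sum>P\<in>\<P>. card P * (?h * N))"
    proof (rule sum_mono)
      fix P assume P: "P \<in> \<P>"
      then obtain k where k: "k < 2 * N" "card P = ?h * k" using \<P>(4) by blast
      have "card (all_edges P) = card P * (card P - 1) div 2"
        using Pn(2)[OF P] by (simp add: card_all_edges choose_two)
      also have "\<dots> \<le> card P * (2 * (?h * N)) div 2"
        using k by (intro div_le_mono mult_left_mono) (auto intro: order_trans[of _ "?h * k"])
      also have "\<dots> = card P * (?h * N)" by simp
      finally show "card (all_edges P) \<le> card P * (?h * N)" .
    qed
    also have "\<dots> = n * (?h * N)" by (simp add: sum_distrib_right[symmetric] sumP)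
    finally have "real (card S) \<le> real (n * (?h * N))" by (rule of_nat_mono)
    then show ?thesis by simp
  qed
  have cardP: "card \<P> \<le> n"
  proof -
    have "(\<Sum>P\<in>\<P>. 1) \<le> (\<Sum>P\<in>\<P>. card P)"
      using \<P>(4) N h by (intro sum_mono) (fastforce simp: Suc_le_eq)
    then show ?thesis using sumP by simp
  qed
  have b0: "0 \<le> b" using b(1) by (meson of_nat_0_le_iff order_trans)
  define D where "D = capped_rule S b"
  \<comment> \<open>The least integer above \<open>b\<close>. Since \<open>n \<le> b\<close>, the
    tail \<open>(1 / 2) ^ s\<close> is at most \<open>(1 / 2) ^ n\<close>.\<close>
  define s where "s = Suc (nat \<lfloor>b\<rfloor>)"
  have s: "b < real s" "n < s" using b(1) b0 unfolding s_def by linarith+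
  have strat: "is_strategy n t b (return_pmf D)"
    using card_purchased_capped_rule_le[OF b0] by (simp add: is_strategy_def D_def)
  have good: "has_factor F ({1..n}, purchased D t es)"
    if "\<not> (\<exists>P\<in>\<P>. \<not> has_factor F (P, set (take t es)))" "\<not> s \<le> card (set (take t es) \<inter> S)" for es
  proof -
    have "real (card (set (take t es) \<inter> S)) \<le> b"
      using that(2) b0 by (simp add: s_def not_le less_Suc_eq_le le_nat_iff le_floor_iff)
    then have eq: "purchased D t es = set (take t es) \<inter> S"
      unfolding D_def by (rule purchased_capped_rule_eq)
    have "has_factor F (P, set (take t es) \<inter> S)" if "P \<in> \<P>" for P
      using \<open>\<not> (\<exists>P\<in>\<P>. \<not> has_factor F (P, set (take t es)))\<close> that
      by (intro has_factor_restrict) (auto simp: S_def)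
    then have "has_factor F (\<Union>\<P>, set (take t es) \<inter> S)"
      using has_factor_Union[OF V \<P>(1) Pn(2) \<P>(3)] by blast
    then show ?thesis using eq \<P>(2) by simp
  qed
  have fail1: "order_prob ?X (\<lambda>es. \<exists>P\<in>\<P>. \<not> has_factor F (P, set (take t es))) \<le> 2 * real n * \<beta>"
  proof -
    have each: "order_prob ?X (\<lambda>es. \<not> has_factor F (P, set (take t es))) \<le> 2 * \<beta>" if P: "P \<in> \<P>" for P
    proof -
      obtain k where k: "N \<le> k" "card P = ?h * k" using \<P>(4) P by blast
      have "order_prob ?X (\<lambda>es. \<not> has_factor F (P, set (take t es)))
          \<le> 2 * rs_expect p ?X (\<lambda>W. of_bool (\<not> has_factor F (P, W)))"
        using t p has_factor_mono[of F P] cX finX by (intro order_prob_le_rs_expect) auto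
      also have "\<dots> \<le> 2 * \<beta>" using \<beta>[OF k(1) Pn(1)[OF P] k(2)] by simp
      finally show ?thesis .
    qed
    have \<beta>0: "0 \<le> \<beta>"
    proof -
      have "0 \<le> rs_expect p ?X (\<lambda>W. of_bool (\<not> has_factor F ({1..n}, W)))"
        using rs_expect_mono[OF p(1,2), of ?X "\<lambda>_. 0"] finX by simp
      then show ?thesis using \<beta>[of m "{1..n}"] N n by simp
    qed
    have "order_prob ?X (\<lambda>es. \<exists>P\<in>\<P>. \<not> has_factor F (P, set (take t es))) \<le> (\<Sum>P\<in>\<P>. 2 * \<beta>)"
      using each by (intro order_trans[OF order_prob_ex_le[OF \<P>(1)]] sum_mono)
    also have "\<dots> \<le> 2 * real n * \<beta>" using cardP \<beta>0 by (simp add: mult_right_mono)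
    finally show ?thesis .
  qed
  have fail2: "order_prob ?X (\<lambda>es. s \<le> card (set (take t es) \<inter> S)) \<le> (1 / 2) ^ n"
  proof -
    have "2 * (exp 1 * real (card S) * real t) / real (n choose 2)
        \<le> 2 * (exp 1 * (real n * (real ?h * real N)) * real t) / real (n choose 2)"
      using cardS by (intro divide_right_mono mult_left_mono mult_right_mono) auto
    also have "\<dots> \<le> real s" using b(2) s(1) by (simp add: mult_ac)
    finally have "2 * (exp 1 * real (card S) * real t) \<le> real s * real (n choose 2)"
      using M by (simp add: pos_divide_le_eq)
    moreover have "0 < real s * real (n choose 2)" using M by (simp add: s_def)
    ultimately have le: "exp 1 * real (card S) * real t / (real s * real (n choose 2)) \<le> 1 / 2"
      by (subst pos_divide_le_eq) linarith+
    have "order_prob ?X (\<lambda>es. s \<le> card (set (take t es) \<inter> S))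
        \<le> (exp 1 * real (card S) * real t / (real s * real (card ?X))) ^ s"
      using t cX by (intro order_prob_card_ge_le finX neX SX) (auto simp: s_def)
    also have "\<dots> \<le> (1 / 2) ^ s" using le cX by (intro power_mono) auto
    also have "\<dots> \<le> (1 / 2) ^ n" using s(2) by (intro power_decreasing) auto
    finally show ?thesis .
  qed
  have "order_prob ?X (\<lambda>es. \<not> has_factor F ({1..n}, purchased D t es)) \<le>
      order_prob ?X (\<lambda>es. (\<exists>P\<in>\<P>. \<not> has_factor F (P, set (take t es))) \<or> s \<le> card (set (take t es) \<inter> S))"
    using good by (intro order_prob_mono) blast
  also have "\<dots> \<le> 2 * real n * \<beta> + (1 / 2) ^ n"
    by (rule order_trans[OF order_prob_disj_le add_mono[OF fail1 fail2]])
  finally have "success_prob n t (return_pmf D) (has_factor F) \<ge> 1 - (2 * real n * \<beta> + (1 / 2) ^ n)"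
    using order_prob_not[OF finX] by (simp add: success_prob_return)
  with strat show ?thesis by blast
qed

subsection \<open>Choice of the block size\<close>

lemma eventually_multiples_at_top:
  "eventually P (multiples_at_top v) \<longleftrightarrow> eventually (\<lambda>n. v dvd n \<longrightarrow> P n) at_top"
  by (simp add: multiples_at_top_def eventually_inf_principal)

text \<open>The exponent \<open>2 / \<delta>\<close> is taken because
  \<open>N \<ge> n powr \<delta>\<close>: a block then fails with probability at most
  \<open>1 / n^2\<close>, and at most \<open>n\<close> blocks contribute \<open>2 / n\<close>. The
  cap adds at most \<open>1 / n\<close>.\<close>

lemma strategy_at:
  fixes F :: "'a graph"
  assumes F: "simple_graph F" and nb: "\<not> vertex_balanced F" and \<delta>: "0 < \<delta>"
  obtains K1 K2 :: real and n0 :: nat where "0 < K1" "0 < K2"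
    "\<And>n t. n0 \<le> n \<Longrightarrow> card (verts F) dvd n \<Longrightarrow>
      K1 * real n powr (2 - 1 / max_density F) \<le> real t \<Longrightarrow> real t \<le> real n powr (2 - \<delta>) \<Longrightarrow>
      \<exists>S. is_strategy n t (K2 * real t powr (1 - max_density F) * real n powr (2 * max_density F - 1)) S \<and>
        1 - 3 / real n \<le> success_prob n t S (has_factor F)"
proof -
  let ?d = "max_density F" and ?h = "card (verts F)"
  have d: "1 \<le> ?d" by (rule max_density_ge_1[OF F nb])
  obtain v where "v \<in> verts F" using ex_trivial_tight_hull[OF F nb] by blast
  then have V: "verts F \<noteq> {}" by auto
  then have h: "?h > 0" using simple_graph_finite(1)[OF F] by (simp add: card_gt_0_iff)
  have "0 < 2 / \<delta>" using \<delta> by simp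
  then obtain K :: real and N0 :: nat where K: "2 \<le> K"
    and fac: "\<And>(N :: nat) p (B :: nat set) X. N0 \<le> N \<Longrightarrow> finite B \<Longrightarrow> card B = ?h * N \<Longrightarrow>
      finite X \<Longrightarrow> all_edges B \<subseteq> X \<Longrightarrow> K * real N powr (- 1 / ?d) \<le> p \<Longrightarrow> p \<le> 1 \<Longrightarrow>
      rs_expect p X (\<lambda>W. of_bool (\<not> has_factor F (B, W))) \<le> real N powr (- (2 / \<delta>))"
    using factor_prob[OF F nb] by blast
  \<comment> \<open>The factor \<open>2 * h\<close> yields \<open>y powr d \<le> n / (2 * h)\<close>
    below, so that \<open>N \<le> n / h\<close> still holds after rounding up.\<close>
  define K1 where "K1 = 2 * real ?h * K"
  \<comment> \<open>\<open>16 = 2 * 2 * 4\<close>: the factor 2 in the cost condition of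
    \<open>block_strategy\<close>, \<open>N \<le> 2 * y powr d\<close>, and
    \<open>n choose 2 \<ge> x^2 / 4\<close>.\<close>
  define K2 where "K2 = 16 * exp 1 * real ?h * K powr ?d"
  have K1: "0 < K1" using K h by (simp add: K1_def)
  have hr: "1 \<le> real ?h" using h by linarith
  have "1 * 1 * 1 * 1 \<le> K2"
    unfolding K2_def using hr K d ge_one_powr_ge_zero[of K ?d]
    by (intro mult_mono) auto
  then have K2: "1 \<le> K2" by simp
  have "eventually (\<lambda>n. real N0 \<le> real n powr \<delta>) at_top" using \<delta> by real_asymp
  moreover have "eventually (\<lambda>n. 2 * real n powr (- \<delta>) \<le> 1 / 2) at_top" using \<delta> by real_asymp
  ultimately have "eventually (\<lambda>n. real N0 \<le> real n powr \<delta> \<and> 2 * real n powr (- \<delta>) \<le> 1 / 2 \<and> 2 * ?h + 2 \<le> n) at_top"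
    by (intro eventually_conj eventually_ge_at_top)
  then obtain n0 where n0: "\<And>n. n0 \<le> n \<Longrightarrow>
      real N0 \<le> real n powr \<delta> \<and> 2 * real n powr (- \<delta>) \<le> 1 / 2 \<and> 2 * ?h + 2 \<le> n"
    by (auto simp: eventually_at_top_linorder)
  have "\<exists>S. is_strategy n t (K2 * real t powr (1 - ?d) * real n powr (2 * ?d - 1)) S \<and>
        1 - 3 / real n \<le> success_prob n t S (has_factor F)"
    if n: "n0 \<le> n" "?h dvd n" and t: "K1 * real n powr (2 - 1 / ?d) \<le> real t" "real t \<le> real n powr (2 - \<delta>)"
    for n t
  proof -
    define x where "x = real n"
    define T where "T = real t"
    define b where "b = K2 * T powr (1 - ?d) * x powr (2 * ?d - 1)"
    have x: "real N0 \<le> x powr \<delta>" "2 * x powr (- \<delta>) \<le> 1 / 2" "2 * real ?h \<le> x" "2 \<le> x"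
      using n0[OF n(1)] unfolding x_def by linarith+
    have tx: "K1 * x powr (2 - 1 / ?d) \<le> T" "T \<le> x powr (2 - \<delta>)" using t by (auto simp: x_def T_def)
    have T0: "0 < T" using tx(1) K1 x by (smt (verit) mult_pos_pos powr_gt_zero)
    have M: "real (n choose 2) = x * (x - 1) / 2"
    proof -
      have "even (n * (n - 1))" by (cases n) auto
      then have "real (n * (n - 1) div 2) = real (n * (n - 1)) / 2" by (simp add: real_of_nat_div del: of_nat_mult)
      then show ?thesis using x by (simp add: choose_two x_def of_nat_diff)
    qed
    have xx: "0 < x * (x - 1)" "x\<^sup>2 / 2 \<le> x * (x - 1)" "x * (x - 1) \<le> x\<^sup>2"
    proof -
      show "0 < x * (x - 1)" using x by simp
      have "x * 2 \<le> x * x" using x by (intro mult_left_mono) auto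
      then show "x\<^sup>2 / 2 \<le> x * (x - 1)" by (simp add: power2_eq_square algebra_simps)
      show "x * (x - 1) \<le> x\<^sup>2" using x by (simp add: power2_eq_square algebra_simps)
    qed
    \<comment> \<open>Half of \<open>t / (n choose 2)\<close>, as required by
      \<open>order_prob_le_rs_expect\<close>.\<close>
    define p where "p = T / (x * (x - 1))"
    have p0: "0 < p" using T0 xx by (simp add: p_def)
    have p_le: "p \<le> 2 * x powr (- \<delta>)"
    proof -
      have "p \<le> x powr (2 - \<delta>) / (x\<^sup>2 / 2)"
        unfolding p_def using T0 tx(2) xx x by (intro frac_le) auto
      also have "\<dots> = 2 * (x powr (2 - \<delta>) / x powr 2)" using x by simp
      also have "\<dots> = 2 * x powr (- \<delta>)" by (simp only: powr_diff[symmetric]) simp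
      finally show ?thesis .
    qed
    then have p_half: "p \<le> 1 / 2" using x(2) by linarith
    \<comment> \<open>\<open>y powr d\<close> is the real block parameter at which
      \<open>K * N powr (-1/d) = p\<close>; \<open>N\<close> below is the least integer not under
      it.\<close>
    define y where "y = K / p"
    have y0: "0 < y" using K p0 by (simp add: y_def)
    have y_ge: "x powr \<delta> \<le> y"
    proof -
      have "2 / (2 * x powr (- \<delta>)) \<le> K / p" using K p0 p_le by (intro frac_le) auto
      then show ?thesis using x by (simp add: y_def powr_minus_divide)
    qed
    have y1: "1 \<le> y"
    proof -
      have "p \<le> K" using p_half K by linarith
      then show ?thesis using p0 by (simp add: y_def)
    qed
    have yd: "y \<le> y powr ?d" using powr_mono[of 1 ?d y] d y1 by simp
    define N where "N = nat \<lceil>y powr ?d\<rceil>"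
    have N: "y powr ?d \<le> real N" "real N \<le> y powr ?d + 1"
      using powr_ge_zero[of y ?d] unfolding N_def by linarith+
    have N2: "real N \<le> 2 * y powr ?d" using N(2) yd y1 by linarith
    have Nx: "x powr \<delta> \<le> real N" using N(1) yd y_ge by linarith
    have NN0: "N0 \<le> N" using Nx x(1) by linarith
    have N0: "0 < N" using N(1) yd y1 by linarith
    have p_ge: "K1 * x powr (- 1 / ?d) \<le> p"
    proof -
      have "x powr (2 - 1 / ?d) / x powr 2 = x powr (- 1 / ?d)"
        by (subst powr_diff[symmetric]) simp
      then have "K1 * x powr (- 1 / ?d) = K1 * x powr (2 - 1 / ?d) / x powr 2"
        by (metis times_divide_eq_right)
      also have "\<dots> = K1 * x powr (2 - 1 / ?d) / x\<^sup>2" using x by simp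
      also have "\<dots> \<le> p" unfolding p_def using tx(1) xx T0 x K1 by (intro frac_le) auto
      finally show ?thesis .
    qed
    define m where "m = n div ?h"
    have nm: "n = ?h * m" using n(2) by (simp add: m_def)
    have Nm: "N \<le> m"
    proof -
      have pos: "0 < K1 * x powr (- 1 / ?d)" using K1 x by simp
      have "y \<le> K / (K1 * x powr (- 1 / ?d))"
        unfolding y_def using p_ge K pos by (intro divide_left_mono) (auto intro: mult_pos_pos p0)
      also have "\<dots> = x powr (1 / ?d) / (2 * real ?h)"
        using K h x by (simp add: K1_def powr_minus_divide field_simps)
      finally have "y powr ?d \<le> (x powr (1 / ?d) / (2 * real ?h)) powr ?d"
        using d y0 by (intro powr_mono2) auto
      also have "\<dots> = x / (2 * real ?h) powr ?d"
        using d x powr_divide[of "x powr (1 / ?d)" "2 * real ?h" ?d] by (simp add: powr_powr)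
      also have "\<dots> \<le> x / (2 * real ?h)"
      proof (rule divide_left_mono)
        show "2 * real ?h \<le> (2 * real ?h) powr ?d" using powr_mono[of 1 ?d "2 * real ?h"] d hr by simp
      qed (use x hr in auto)
      finally have "real N \<le> x / (2 * real ?h) + 1" using N(2) by linarith
      also have "1 \<le> x / (2 * real ?h)" using x(3) hr by simp
      finally have "real N \<le> x / real ?h" by (simp add: field_simps)
      also have "x / real ?h = real m" using nm h unfolding x_def by (metis less_numeral_extra(3) nonzero_mult_div_cancel_left of_nat_eq_0_iff of_nat_mult)
      finally show ?thesis by simp
    qed
    have \<beta>: "rs_expect p (all_edges {1..n}) (\<lambda>W. of_bool (\<not> has_factor F (B, W))) \<le> 1 / x\<^sup>2"
      if k: "N \<le> k" "B \<subseteq> {1..n}" "card B = ?h * k" for k B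
    proof -
      have "y \<le> real k powr (1 / ?d)"
      proof -
        have "y = (y powr ?d) powr (1 / ?d)" using y0 d by (simp add: powr_powr)
        also have "\<dots> \<le> real k powr (1 / ?d)" using N(1) k(1) d by (intro powr_mono2) auto
        finally show ?thesis .
      qed
      then have "K \<le> p * real k powr (1 / ?d)" using p0 by (simp add: y_def pos_divide_le_eq mult.commute)
      then have "K * real k powr (- 1 / ?d) \<le> (p * real k powr (1 / ?d)) * real k powr (- 1 / ?d)"
        by (intro mult_right_mono) auto
      also have "\<dots> = p" using N0 k(1) by (simp add: mult.assoc powr_add[symmetric])
      finally have pk: "K * real k powr (- 1 / ?d) \<le> p" .
      have "all_edges B \<subseteq> all_edges {1..n}" using k(2) by (auto simp: all_edges_def)
      moreover have "finite (all_edges {1..n})" by (simp add: finite_all_edges)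
      moreover have "finite B" using k(2) finite_subset by blast
      ultimately have "rs_expect p (all_edges {1..n}) (\<lambda>W. of_bool (\<not> has_factor F (B, W))) \<le> real k powr (- (2 / \<delta>))"
        using fac[of k B "all_edges {1..n}" p] NN0 k pk p_half by simp
      also have "\<dots> \<le> (x powr \<delta>) powr (- (2 / \<delta>))"
        using Nx k(1) x \<delta> by (intro powr_mono2') auto
      also have "\<dots> = x powr (- 2)" using \<delta> by (simp add: powr_powr)
      also have "\<dots> = 1 / x\<^sup>2" using x by (simp add: powr_minus_divide)
      finally show ?thesis .
    qed
    \<comment> \<open>The exponent \<open>1 - d\<close> is not positive, so
      \<open>T \<le> x powr 2\<close> bounds the budget from below, and the powers of
      \<open>x\<close> then combine to exponent 1.\<close>
    have bx: "x \<le> b"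
    proof -
      have "T \<le> x powr 2" using tx(2) x \<delta> powr_mono[of "2 - \<delta>" 2 x] by linarith
      then have "(x powr 2) powr (1 - ?d) \<le> T powr (1 - ?d)" using T0 d by (intro powr_mono2') auto
      then have "1 * (x powr 2) powr (1 - ?d) \<le> K2 * T powr (1 - ?d)"
        using K2 by (intro mult_mono) auto
      then have "(x powr 2) powr (1 - ?d) * x powr (2 * ?d - 1) \<le> b"
        unfolding b_def by (intro mult_right_mono) auto
      also have "(x powr 2) powr (1 - ?d) * x powr (2 * ?d - 1) = x powr (2 * (1 - ?d) + (2 * ?d - 1))"
        by (simp only: powr_powr powr_add)
      also have "\<dots> = x" using x by (simp add: algebra_simps)
      finally show ?thesis .
    qed
    have bE: "2 * exp 1 * (x * (real ?h * real N)) * T / real (n choose 2) \<le> b"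
    proof -
      have y_le: "y \<le> K * x\<^sup>2 / T"
        using K T0 xx(3) by (simp add: y_def p_def divide_right_mono)
      then have "y powr ?d \<le> (K * x\<^sup>2 / T) powr ?d" using d y0 by (intro powr_mono2) auto
      also have "\<dots> = K powr ?d * x powr (2 * ?d) * T powr (- ?d)"
      proof -
        have "(K * x\<^sup>2 / T) powr ?d = K powr ?d * (x powr 2) powr ?d / T powr ?d"
          using K T0 x by (simp add: powr_divide powr_mult)
        then show ?thesis by (simp add: powr_powr powr_minus_divide)
      qed
      finally have "real N \<le> 2 * (K powr ?d * x powr (2 * ?d) * T powr (- ?d))" using N2 by linarith
      then have "2 * exp 1 * (x * (real ?h * real N)) * T \<le>
          2 * exp 1 * (x * (real ?h * (2 * (K powr ?d * x powr (2 * ?d) * T powr (- ?d))))) * T"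
        using T0 x by (intro mult_right_mono mult_left_mono) auto
      then have "2 * exp 1 * (x * (real ?h * real N)) * T / real (n choose 2) \<le>
          2 * exp 1 * (x * (real ?h * (2 * (K powr ?d * x powr (2 * ?d) * T powr (- ?d))))) * T / (x\<^sup>2 / 4)"
        using M xx T0 x by (intro frac_le) auto
      also have "\<dots> = K2 * (T powr (- ?d) * T powr 1) * (x powr (2 * ?d) * x powr (- 1))"
        using T0 x by (simp add: K2_def powr_minus_divide power2_eq_square field_simps)
      also have "T powr (- ?d) * T powr 1 = T powr (1 - ?d)"
        unfolding powr_add[symmetric] by simp
      also have "x powr (2 * ?d) * x powr (- 1) = x powr (2 * ?d - 1)"
        unfolding powr_add[symmetric] by simp
      also have "K2 * T powr (1 - ?d) * x powr (2 * ?d - 1) = b" by (simp add: b_def)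
      finally show ?thesis .
    qed
    have "\<exists>S. is_strategy n t b S \<and> success_prob n t S (has_factor F) \<ge> 1 - (2 * real n * (1 / x\<^sup>2) + (1 / 2) ^ n)"
    proof (rule block_strategy[OF F V N0 Nm nm])
      show "0 < t" using T0 by (simp add: T_def)
      have pM: "2 * p * real (n choose 2) = T" using x(4) by (simp add: M p_def)
      then show "2 * p * real (n choose 2) \<le> real t" by (simp add: T_def)
      have "2 * p * real (n choose 2) \<le> 1 * real (n choose 2)" using p_half by (intro mult_right_mono) auto
      then have "real t \<le> real (n choose 2)" using pM by (simp add: T_def)
      then show "t \<le> n choose 2" by simp
      show "0 \<le> p" "p \<le> 1" using p0 p_half by auto
      show "real n \<le> b" using bx by (simp add: x_def)
      show "2 * exp 1 * (real n * (real ?h * real N)) * real t / real (n choose 2) \<le> b"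
        using bE by (simp add: x_def T_def)
    qed (use \<beta> in auto)
    moreover have "2 * real n * (1 / x\<^sup>2) + (1 / 2) ^ n \<le> 3 / real n"
    proof -
      have "2 * real n * (1 / x\<^sup>2) = 2 / real n" using x by (simp add: x_def power2_eq_square)
      moreover have "(1 / 2) ^ n \<le> 1 / real n"
      proof -
        have "real n \<le> 2 ^ n" using of_nat_less_two_power[of n, where 'a = real] by simp
        then show ?thesis using x by (simp add: x_def power_divide frac_le)
      qed
      ultimately show ?thesis by simp
    qed
    ultimately obtain S where "is_strategy n t b S" "1 - 3 / real n \<le> success_prob n t S (has_factor F)"
      by (meson diff_left_mono order_trans)
    then show ?thesis by (auto simp: b_def T_def x_def)
  qed
  then show ?thesis using K1 K2 by (intro that[of K1 K2 n0]) auto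
qed

theorem theorem5p7:
  fixes F :: "'a graph"
  assumes "simple_graph F" and "\<not> vertex_balanced F"
  shows "\<forall>\<delta>>0. \<exists>K\<^sub>1>0. \<exists>K\<^sub>2>0. \<forall>t :: nat \<Rightarrow> nat.
    (\<forall>\<^sub>F n in multiples_at_top (card (verts F)).
       K\<^sub>1 * real n powr (2 - 1 / max_density F) \<le> real (t n) \<and>
       real (t n) \<le> real n powr (2 - \<delta>)) \<longrightarrow>
    (\<exists>S :: nat \<Rightarrow> strategy.
       (\<forall>n. card (verts F) dvd n \<longrightarrow>
          is_strategy n (t n)
            (K\<^sub>2 * real (t n) powr (1 - max_density F) * real n powr (2 * max_density F - 1))
            (S n)) \<and>
       ((\<lambda>n. success_prob n (t n) (S n) (has_factor F)) \<longlongrightarrow> 1)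
         (multiples_at_top (card (verts F))))"
proof (intro allI impI)
  fix \<delta> :: real assume "0 < \<delta>"
  then obtain K1 K2 :: real and n0 where K: "0 < K1" "0 < K2"
    and ex: "\<And>n t. n0 \<le> n \<Longrightarrow> card (verts F) dvd n \<Longrightarrow>
      K1 * real n powr (2 - 1 / max_density F) \<le> real t \<Longrightarrow> real t \<le> real n powr (2 - \<delta>) \<Longrightarrow>
      \<exists>S. is_strategy n t (K2 * real t powr (1 - max_density F) * real n powr (2 * max_density F - 1)) S \<and>
        1 - 3 / real n \<le> success_prob n t S (has_factor F)"
    using strategy_at[OF assms] by blast
  let ?v = "card (verts F)"
  let ?b = "\<lambda>n t. K2 * real t powr (1 - max_density F) * real n powr (2 * max_density F - 1)"
  let ?good = "\<lambda>n t S. is_strategy n t (?b n t) S \<and> 1 - 3 / real n \<le> success_prob n t S (has_factor F)"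
  have "\<exists>S. (\<forall>n. ?v dvd n \<longrightarrow> is_strategy n (t n) (?b n (t n)) (S n)) \<and>
      ((\<lambda>n. success_prob n (t n) (S n) (has_factor F)) \<longlongrightarrow> 1) (multiples_at_top ?v)"
    if t: "\<forall>\<^sub>F n in multiples_at_top ?v. K1 * real n powr (2 - 1 / max_density F) \<le> real (t n) \<and>
       real (t n) \<le> real n powr (2 - \<delta>)" for t :: "nat \<Rightarrow> nat"
  proof -
    \<comment> \<open>The budget must be respected for every multiple of \<open>v(F)\<close>, also
      where the bounds on \<open>t n\<close> fail. There Builder buys nothing, which is allowed
      because the budget is nonnegative.\<close>
    define S where "S n = (if \<exists>S. ?good n (t n) S then SOME S. ?good n (t n) S else return_pmf (\<lambda>_. False))" for n
    have S: "?good n (t n) (S n)" if "\<exists>S. ?good n (t n) S" for n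
      using someI_ex[OF that] that by (simp add: S_def)
    have strat: "is_strategy n (t n) (?b n (t n)) (S n)" for n
    proof (cases "\<exists>S. ?good n (t n) S")
      case True
      then show ?thesis using S by blast
    next
      case False
      then have "S n = return_pmf (\<lambda>_. False)" by (simp only: S_def if_False)
      then show ?thesis using K(2) by (simp add: is_strategy_def purchased_def)
    qed
    have "\<forall>\<^sub>F n in multiples_at_top ?v. n0 \<le> n \<and> ?v dvd n"
      unfolding eventually_multiples_at_top using eventually_ge_at_top[of n0] by eventually_elim simp
    with t have low: "\<forall>\<^sub>F n in multiples_at_top ?v. 1 - 3 / real n \<le> success_prob n (t n) (S n) (has_factor F)"
    proof eventually_elim
      case (elim n)
      then show ?case using S[OF ex[of n "t n"]] by blast
    qed
    have up: "\<forall>\<^sub>F n in multiples_at_top ?v. success_prob n (t n) (S n) (has_factor F) \<le> 1"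
      unfolding success_prob_def by (intro always_eventually allI) simp
    have "((\<lambda>n. 1 - 3 / real n) \<longlongrightarrow> 1) at_top" by real_asymp
    then have "((\<lambda>n. 1 - 3 / real n) \<longlongrightarrow> 1) (multiples_at_top ?v)"
      by (rule tendsto_mono[rotated]) (simp add: multiples_at_top_def)
    then have "((\<lambda>n. success_prob n (t n) (S n) (has_factor F)) \<longlongrightarrow> 1) (multiples_at_top ?v)"
      by (rule tendsto_sandwich[OF low up _ tendsto_const])
    with strat show ?thesis by blast
  qed
  with K show "\<exists>K\<^sub>1>0. \<exists>K\<^sub>2>0. \<forall>t :: nat \<Rightarrow> nat.
    (\<forall>\<^sub>F n in multiples_at_top (card (verts F)).
       K\<^sub>1 * real n powr (2 - 1 / max_density F) \<le> real (t n) \<and>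
       real (t n) \<le> real n powr (2 - \<delta>)) \<longrightarrow>
    (\<exists>S :: nat \<Rightarrow> strategy.
       (\<forall>n. card (verts F) dvd n \<longrightarrow>
          is_strategy n (t n)
            (K\<^sub>2 * real (t n) powr (1 - max_density F) * real n powr (2 * max_density F - 1))
            (S n)) \<and>
       ((\<lambda>n. success_prob n (t n) (S n) (has_factor F)) \<longlongrightarrow> 1)
         (multiples_at_top (card (verts F))))"
    by blast
qed

end
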